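(* Let $\delta>0$, let $(X,d,\mu)$ be an Ahlfors $\delta$-regular metric-measure space and let $\Delta$ be its logarithmic Dirichlet Laplacian on $L^2(X,\mu)$. Then $\Delta$ has compact resolvent and its eigenvalues grow logarithmically fast, in the sense that $(1+\Delta)^{-1}$ is a compact operator whose singular values $s_n((1+\Delta)^{-1})$ (listed in decreasing order with multiplicity) satisfy $s_n((1+\Delta)^{-1})=O((\log n)^{-1})$ as $n\to\infty$. In particular, there is some $t_0>0$ such that $e^{-t\Delta}$ is a trace-class operator on $L^2(X,\mu)$ for every $t>t_0$.
   Context: A metric-measure space is a triple $(X,d,\mu)$ where $(X,d)$ is a locally compact second-countable metric space and $\mu$ is a finite Borel measure on $X$. It is Ahlfors $\delta$-regular ($\delta>0$) if there is $C\ge 1$ such that $C^{-1}r^\delta\le\mu(\overline B(x,r))\le Cr^\delta$ for all $x\in X$ and $0\le r<\operatorname{diam}X$; then $\operatorname{diam} X<\infty$. $L^2(X,\mu)$ denotes the real Hilbert space of real-valued square-integrable functions. Define $$\operatorname{Dom}\mathcal E=\Big\{f\in L^2(X,\mu):\int_X\int_X\frac{|f(x)-f(y)|^2}{d(x,y)^\delta}\,d\mu(y)\,d\mu(x)<\infty\Big\},$$ $$\mathcal E(f,g)=\frac12\int_X\int_X\frac{(f(x)-f(y))(g(x)-g(y))}{d(x,y)^\delta}\,d\mu(y)\,d\mu(x),\qquad f,g\in\operatorname{Dom}\mathcal E,$$ the integrals being over the complement of the diagonal in $X\times X$. This is a densely defined closed form. The logarithmic Dirichlet Laplacian $\Delta$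 is the positive self-adjoint operator associated with $\mathcal E$: if $R:L^2(X,\mu)\to\operatorname{Dom}\mathcal E$ is determined by $\langle Rf,g\rangle_{L^2}+\mathcal E(Rf,g)=\langle f,g\rangle_{L^2}$ for all $g\in\operatorname{Dom}\mathcal E$, then $\operatorname{Dom}\Delta=R(L^2(X,\mu))$ and $\Delta Rf=f-Rf$. Thus $R=(1+\Delta)^{-1}$, $\operatorname{Dom}\mathcal E=\operatorname{Dom}\Delta^{1/2}$ and $\mathcal E(f,g)=\langle\Delta^{1/2}f,\Delta^{1/2}g\rangle_{L^2}$. The operators $e^{-t\Delta}$ are defined by functional calculus. The singular values of a compact operator $A$ are the eigenvalues of $(A^*A)^{1/2}$. *)

theory Defs
  imports "HOL-Analysis.Analysis" "HOL-Library.Landau_Symbols"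
begin

section \<open>Metric-measure spaces\<close>

text \<open>The measure is a parameter of the type class, just as the metric is in \<^class>\<open>metric_space\<close>,
  so that $L^2(X,\mu)$ can be a type. The space $X$ is the whole type.\<close>

class metric_measure_space = metric_space + second_countable_topology +
  fixes mmeasure :: "'a measure"
  assumes locally_compact: "\<exists>U K. open U \<and> compact K \<and> x \<in> U \<and> U \<subseteq> K"
    and sets_mmeasure_sigma: "sets mmeasure = sigma_sets UNIV {S. open S}"
    and finite_mmeasure: "finite_measure mmeasure"

lemma sets_mmeasure: "sets (mmeasure :: 'a::metric_measure_space measure) = sets borel"
  by (simp add: sets_mmeasure_sigma borel_def)

text \<open>The diameter is extended-real valued: \<^const>\<open>diameter\<close> is unspecified on unbounded sets.\<close>

definition ahlfors_regular :: "'a::metric_measure_space itself \<Rightarrow> real \<Rightarrow> bool" where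
  "ahlfors_regular _ \<delta> \<longleftrightarrow>
    (\<exists>C\<ge>1. \<forall>(x::'a) r. 0 \<le> r \<longrightarrow> ereal r < (SUP y::'a. SUP z::'a. ereal (dist y z)) \<longrightarrow>
       inverse C * r powr \<delta> \<le> measure mmeasure (cball x r) \<and>
       measure mmeasure (cball x r) \<le> C * r powr \<delta>)"

section \<open>The space of square-integrable functions modulo null functions\<close>

definition square_integrable :: "('a::metric_measure_space \<Rightarrow> real) \<Rightarrow> bool" where
  "square_integrable f \<longleftrightarrow> f \<in> borel_measurable mmeasure \<and> integrable mmeasure (\<lambda>x. (f x)\<^sup>2)"

lemma square_integrable_measurable [measurable_dest]:
  "square_integrable f \<Longrightarrow> f \<in> borel_measurable mmeasure"
  by (simp add: square_integrable_def)

lemma square_integrable_zero: "square_integrable (\<lambda>x. 0)"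
  by (simp add: square_integrable_def)

lemma square_integrable_mult:
  assumes f: "square_integrable f" and g: "square_integrable g"
  shows "integrable mmeasure (\<lambda>x. f x * g x)"
proof (rule Bochner_Integration.integrable_bound)
  show "integrable mmeasure (\<lambda>x. (f x)\<^sup>2 + (g x)\<^sup>2)"
    using f g by (auto simp: square_integrable_def)
  show "(\<lambda>x. f x * g x) \<in> borel_measurable mmeasure"
    using f g by measurable
  have "\<bar>a * b\<bar> \<le> a\<^sup>2 + b\<^sup>2" for a b :: real
  proof -
    have "2 * (\<bar>a\<bar> * \<bar>b\<bar>) \<le> \<bar>a\<bar>\<^sup>2 + \<bar>b\<bar>\<^sup>2"
      using sum_squares_bound[of "\<bar>a\<bar>" "\<bar>b\<bar>"] by (simp add: algebra_simps)
    moreover have "0 \<le> \<bar>a\<bar> * \<bar>b\<bar>" by simp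
    ultimately show ?thesis unfolding abs_mult power2_abs by linarith
  qed
  then show "AE x in mmeasure. norm (f x * g x) \<le> norm ((f x)\<^sup>2 + (g x)\<^sup>2)"
    by simp
qed

lemma square_integrable_add:
  assumes f: "square_integrable f" and g: "square_integrable g"
  shows "square_integrable (\<lambda>x. f x + g x)"
proof -
  have "integrable mmeasure (\<lambda>x. (f x)\<^sup>2 + (g x)\<^sup>2 + 2 * (f x * g x))"
    using f g square_integrable_mult[OF f g] by (auto simp: square_integrable_def)
  then show ?thesis
    using f g by (auto simp: square_integrable_def power2_sum mult.assoc)
qed

lemma square_integrable_cmult:
  "square_integrable f \<Longrightarrow> square_integrable (\<lambda>x. c * f x)"
  by (auto simp: square_integrable_def power_mult_distrib)

quotient_type (overloaded) 'a L2 = "'a::metric_measure_space \<Rightarrow> real" / partial: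
  "\<lambda>f g. square_integrable f \<and> square_integrable g \<and> (AE x in mmeasure. f x = g x)"
proof (rule part_equivpI)
  show "\<exists>f. square_integrable f \<and> square_integrable f \<and> (AE x in mmeasure. f x = f x)"
    using square_integrable_zero by blast
  show "symp (\<lambda>f g. square_integrable f \<and> square_integrable g \<and> (AE x in mmeasure. f x = g x))"
    by (auto simp: symp_def elim: AE_mp)
  show "transp (\<lambda>f g. square_integrable f \<and> square_integrable g \<and> (AE x in mmeasure. f x = g x))"
    by (auto simp: transp_def elim: AE_mp)
qed

instantiation L2 :: (metric_measure_space) real_inner
begin

lift_definition zero_L2 :: "'a L2" is "\<lambda>x. 0"
  by (simp add: square_integrable_zero)

lift_definition plus_L2 :: "'a L2 \<Rightarrow> 'a L2 \<Rightarrow> 'a L2" is "\<lambda>f g x. f x + g x"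
  by (auto intro: square_integrable_add elim!: AE_mp)

lift_definition scaleR_L2 :: "real \<Rightarrow> 'a L2 \<Rightarrow> 'a L2" is "\<lambda>c f x. c * f x"
  by (auto intro: square_integrable_cmult elim!: AE_mp)

lift_definition uminus_L2 :: "'a L2 \<Rightarrow> 'a L2" is "\<lambda>f x. - f x"
  by (auto simp: square_integrable_def elim!: AE_mp)

definition minus_L2 :: "'a L2 \<Rightarrow> 'a L2 \<Rightarrow> 'a L2" where
  "minus_L2 f g = f + - g"

lift_definition inner_L2 :: "'a L2 \<Rightarrow> 'a L2 \<Rightarrow> real"
  is "\<lambda>f g. \<integral>x. f x * g x \<partial>mmeasure"
  by (intro integral_cong_AE) (auto simp: square_integrable_measurable elim!: AE_mp)

definition norm_L2 :: "'a L2 \<Rightarrow> real" where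
  "norm_L2 f = sqrt (inner f f)"

definition sgn_L2 :: "'a L2 \<Rightarrow> 'a L2" where
  "sgn_L2 f = inverse (norm f) *\<^sub>R f"

definition dist_L2 :: "'a L2 \<Rightarrow> 'a L2 \<Rightarrow> real" where
  "dist_L2 f g = norm (f - g)"

definition uniformity_L2 :: "('a L2 \<times> 'a L2) filter" where
  "uniformity_L2 = (INF e\<in>{0 <..}. principal {(x, y). dist x y < e})"

definition open_L2 :: "'a L2 set \<Rightarrow> bool" where
  "open_L2 U = (\<forall>x\<in>U. eventually (\<lambda>(x', y). x' = x \<longrightarrow> y \<in> U) uniformity)"

instance
proof
  fix f g h :: "'a L2" and c d :: real and U :: "'a L2 set"
  show "f + g + h = f + (g + h)"
    by transfer (auto intro!: square_integrable_add simp: add.assoc)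
  show "f + g = g + f"
    by transfer (auto intro!: square_integrable_add simp: add.commute)
  show "0 + f = f"
    by transfer auto
  show "- f + f = 0"
    by transfer (auto simp: square_integrable_zero)
  show "f - g = f + - g"
    by (simp add: minus_L2_def)
  show "c *\<^sub>R (f + g) = c *\<^sub>R f + c *\<^sub>R g"
    by transfer (auto intro!: square_integrable_add square_integrable_cmult simp: algebra_simps)
  show "(c + d) *\<^sub>R f = c *\<^sub>R f + d *\<^sub>R f"
    by transfer (auto intro!: square_integrable_add square_integrable_cmult
        simp: distrib_right simp flip: distrib_right)
  show "c *\<^sub>R d *\<^sub>R f = (c * d) *\<^sub>R f"
    by transfer (auto intro!: square_integrable_cmult simp: mult.assoc)
  show "1 *\<^sub>R f = f"
    by transfer auto
  show "sgn f = inverse (norm f) *\<^sub>R f" by (rule sgn_L2_def)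
  show "dist f g = norm (f - g)" by (rule dist_L2_def)
  show "(uniformity :: ('a L2 \<times> 'a L2) filter) = (INF e\<in>{0 <..}. principal {(x, y). dist x y < e})"
    by (rule uniformity_L2_def)
  show "open U = (\<forall>x\<in>U. eventually (\<lambda>(x', y). x' = x \<longrightarrow> y \<in> U) uniformity)"
    by (rule open_L2_def)
  show "inner f g = inner g f"
    by transfer (simp add: mult.commute)
  show "inner (f + g) h = inner f h + inner g h"
    by transfer (simp add: distrib_right square_integrable_mult)
  show "inner (c *\<^sub>R f) g = c * inner f g"
    by transfer (simp add: mult.assoc)
  show "0 \<le> inner f f"
    by transfer simp
  show "inner f f = 0 \<longleftrightarrow> f = 0"
    by transfer (auto simp: square_integrable_zero square_integrable_mult
        integral_nonneg_eq_0_iff_AE)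
  show "norm f = sqrt (inner f f)" by (rule norm_L2_def)
qed

end

section \<open>The logarithmic Dirichlet form and its Laplacian\<close>

lemma borel_measurable_kernel [measurable]:
  fixes f g :: "'a::metric_measure_space \<Rightarrow> real"
  assumes [measurable]: "f \<in> borel_measurable mmeasure" "g \<in> borel_measurable mmeasure"
  shows "(\<lambda>(x, y). indicator (- {x}) y *\<^sub>R ((f x - f y) * (g x - g y) / dist x y powr \<delta>))
    \<in> borel_measurable (mmeasure \<Otimes>\<^sub>M mmeasure)"
proof -
  have [measurable_cong]: "sets mmeasure = sets (borel :: 'a measure)"
    by (rule sets_mmeasure)
  have eq: "(\<lambda>(x, y). indicator (- {x}) y *\<^sub>R ((f x - f y) * (g x - g y) / dist x y powr \<delta>)) =
      (\<lambda>(x, y). (f x - f y) * (g x - g y) / dist x y powr \<delta>)"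
    by (auto simp: fun_eq_iff indicator_def)
  show ?thesis
    unfolding eq by measurable
qed

lift_definition dirichlet_energy :: "real \<Rightarrow> 'a::metric_measure_space L2 \<Rightarrow> ennreal"
  is "\<lambda>\<delta> f. \<integral>\<^sup>+x. (\<integral>\<^sup>+y\<in>-{x}. ennreal (\<bar>f x - f y\<bar>\<^sup>2 / dist x y powr \<delta>) \<partial>mmeasure) \<partial>mmeasure"
proof -
  fix \<delta> and f g :: "'a \<Rightarrow> real"
  assume "square_integrable f \<and> square_integrable g \<and> (AE x in mmeasure. f x = g x)"
  then have ae: "AE x in mmeasure. f x = g x" by blast
  show "(\<integral>\<^sup>+x. (\<integral>\<^sup>+y\<in>-{x}. ennreal (\<bar>f x - f y\<bar>\<^sup>2 / dist x y powr \<delta>) \<partial>mmeasure) \<partial>mmeasure) =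
    (\<integral>\<^sup>+x. (\<integral>\<^sup>+y\<in>-{x}. ennreal (\<bar>g x - g y\<bar>\<^sup>2 / dist x y powr \<delta>) \<partial>mmeasure) \<partial>mmeasure)"
    by (rule nn_integral_cong_AE, rule AE_mp[OF ae], rule AE_I2, rule impI,
        rule nn_integral_cong_AE, rule AE_mp[OF ae]) auto
qed

definition dirichlet_dom :: "real \<Rightarrow> 'a::metric_measure_space L2 set" where
  "dirichlet_dom \<delta> = {f. dirichlet_energy \<delta> f < \<infinity>}"

lift_definition dirichlet_form ::
  "real \<Rightarrow> 'a::metric_measure_space L2 \<Rightarrow> 'a L2 \<Rightarrow> real"
  is "\<lambda>\<delta> f g. 1 / 2 * (\<integral>x. (\<integral>y\<in>-{x}. (f x - f y) * (g x - g y) / dist x y powr \<delta> \<partial>mmeasure) \<partial>mmeasure)"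
proof -
  fix \<delta> and f f' g g' :: "'a \<Rightarrow> real"
  let ?K = "\<lambda>f g x y. indicator (- {x}) y *\<^sub>R ((f x - f y) * (g x - g y) / dist x y powr \<delta>)"
  assume "square_integrable f \<and> square_integrable f' \<and> (AE x in mmeasure. f x = f' x)"
    and "square_integrable g \<and> square_integrable g' \<and> (AE x in mmeasure. g x = g' x)"
  then have sq: "square_integrable f" "square_integrable f'" "square_integrable g" "square_integrable g'"
    and ae: "AE x in mmeasure. f x = f' x \<and> g x = g' x" by auto
  interpret finite_measure "mmeasure :: 'a measure" by (rule finite_mmeasure)
  have meas: "(\<lambda>y. ?K h k x y) \<in> borel_measurable mmeasure"
    "(\<lambda>x. \<integral>y. ?K h k x y \<partial>mmeasure) \<in> borel_measurable mmeasure"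
    if "square_integrable h" "square_integrable k" for h k and x :: 'a
  proof -
    have *: "(\<lambda>(x, y). ?K h k x y) \<in> borel_measurable (mmeasure \<Otimes>\<^sub>M mmeasure)"
      using that by (intro borel_measurable_kernel square_integrable_measurable)
    show "(\<lambda>x. \<integral>y. ?K h k x y \<partial>mmeasure) \<in> borel_measurable mmeasure"
      using * by (rule borel_measurable_lebesgue_integral)
    have "x \<in> space mmeasure"
      using sets_eq_imp_space_eq[OF sets_mmeasure] by (metis UNIV_I space_borel)
    from measurable_Pair2[OF * this] show "(\<lambda>y. ?K h k x y) \<in> borel_measurable mmeasure"
      by simp
  qed
  have "(\<integral>x. (\<integral>y. ?K f g x y \<partial>mmeasure) \<partial>mmeasure) = (\<integral>x. (\<integral>y. ?K f' g' x y \<partial>mmeasure) \<partial>mmeasure)"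
  proof (rule integral_cong_AE)
    show "AE x in mmeasure. (\<integral>y. ?K f g x y \<partial>mmeasure) = (\<integral>y. ?K f' g' x y \<partial>mmeasure)"
      using ae
    proof eventually_elim
      case (elim x)
      show ?case
      proof (rule integral_cong_AE)
        show "AE y in mmeasure. ?K f g x y = ?K f' g' x y"
          using ae by eventually_elim (simp add: elim)
      qed (use meas(1) sq in blast)+
    qed
  qed (use meas(2) sq in blast)+
  then show "1 / 2 * (\<integral>x. (\<integral>y\<in>-{x}. (f x - f y) * (g x - g y) / dist x y powr \<delta> \<partial>mmeasure) \<partial>mmeasure) =
    1 / 2 * (\<integral>x. (\<integral>y\<in>-{x}. (f' x - f' y) * (g' x - g' y) / dist x y powr \<delta> \<partial>mmeasure) \<partial>mmeasure)"
    by (simp add: set_lebesgue_integral_def)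
qed

definition form_resolvent :: "real \<Rightarrow> 'a::metric_measure_space L2 \<Rightarrow> 'a L2" where
  "form_resolvent \<delta> f = (THE u. u \<in> dirichlet_dom \<delta> \<and>
     (\<forall>g\<in>dirichlet_dom \<delta>. inner u g + dirichlet_form \<delta> u g = inner f g))"

text \<open>An operator that need not be everywhere defined is represented by its graph.\<close>

type_synonym 'h partial_operator = "('h \<times> 'h) set"

definition log_laplacian :: "real \<Rightarrow> 'a::metric_measure_space L2 partial_operator" where
  "log_laplacian \<delta> = {(form_resolvent \<delta> f, f - form_resolvent \<delta> f) | f. True}"

section \<open>Compact and trace-class operators\<close>

definition inverse_one_plus :: "'h::real_inner partial_operator \<Rightarrow> 'h \<Rightarrow> 'h" where
  "inverse_one_plus A f = (THE u. \<exists>v. (u, v) \<in> A \<and> u + v = f)"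

definition compact_operator :: "('h::real_inner \<Rightarrow> 'h) \<Rightarrow> bool" where
  "compact_operator T \<longleftrightarrow> bounded_linear T \<and> compact (closure (T ` cball 0 1))"

definition positive_operator :: "('h::real_inner \<Rightarrow> 'h) \<Rightarrow> bool" where
  "positive_operator S \<longleftrightarrow> bounded_linear S \<and>
     (\<forall>x y. inner (S x) y = inner x (S y)) \<and> (\<forall>x. 0 \<le> inner (S x) x)"

definition operator_abs :: "('h::real_inner \<Rightarrow> 'h) \<Rightarrow> 'h \<Rightarrow> 'h" where
  "operator_abs T = (THE S. positive_operator S \<and> S \<circ> S = adjoint T \<circ> T)"

definition eigenspace :: "('h::real_inner \<Rightarrow> 'h) \<Rightarrow> real \<Rightarrow> 'h set" where
  "eigenspace S l = {x. S x = l *\<^sub>R x}"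

text \<open>The sequence lists the positive eigenvalues of a compact positive operator in decreasing order,
  each as often as the (finite) dimension of its eigenspace; if there are only finitely many of them,
  it continues with zeros.\<close>

definition lists_eigenvalues :: "('h::real_inner \<Rightarrow> 'h) \<Rightarrow> (nat \<Rightarrow> real) \<Rightarrow> bool" where
  "lists_eigenvalues S s \<longleftrightarrow> decseq s \<and> (\<forall>n. 0 \<le> s n) \<and>
     (\<forall>l>0. finite {n. s n = l} \<and> card {n. s n = l} = dim (eigenspace S l))"

text \<open>Singular values are numbered from 1.\<close>

definition singular_value :: "('h::real_inner \<Rightarrow> 'h) \<Rightarrow> nat \<Rightarrow> real" where
  "singular_value T n = (THE s. lists_eigenvalues (operator_abs T) s) (n - 1)"

definition trace_class :: "('h::real_inner \<Rightarrow> 'h) \<Rightarrow> bool" where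
  "trace_class T \<longleftrightarrow> compact_operator T \<and> summable (\<lambda>n. singular_value T (Suc n))"

section \<open>Functional calculus of a self-adjoint operator\<close>

definition projection_valued_measure :: "(real set \<Rightarrow> 'h::real_inner \<Rightarrow> 'h) \<Rightarrow> bool" where
  "projection_valued_measure E \<longleftrightarrow>
     (\<forall>B\<in>sets borel. bounded_linear (E B) \<and> E B \<circ> E B = E B \<and>
        (\<forall>x y. inner (E B x) y = inner x (E B y))) \<and>
     E UNIV = id \<and>
     (\<forall>B :: nat \<Rightarrow> real set. range B \<subseteq> sets borel \<longrightarrow> disjoint_family B \<longrightarrow>
        (\<forall>x. (\<lambda>i. E (B i) x) sums E (\<Union>i. B i) x))"

definition scalar_measure :: "(real set \<Rightarrow> 'h::real_inner \<Rightarrow> 'h) \<Rightarrow> 'h \<Rightarrow> real measure" where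
  "scalar_measure E x = measure_of UNIV (sets borel) (\<lambda>B. ennreal (inner (E B x) x))"

definition spectral_dom :: "(real set \<Rightarrow> 'h::real_inner \<Rightarrow> 'h) \<Rightarrow> (real \<Rightarrow> real) \<Rightarrow> 'h set" where
  "spectral_dom E \<phi> = {x. (\<integral>\<^sup>+l. ennreal ((\<phi> l)\<^sup>2) \<partial>scalar_measure E x) < \<infinity>}"

text \<open>The graph of the operator $\int \varphi\,dE$: the element $y$ is its value at $x$ if
  $\langle y,z\rangle = \int \varphi\,d\langle E x,z\rangle$ for all $z$ in the (dense) domain, where
  the integral against the signed measure $\langle E x,z\rangle$ is expressed by polarization.\<close>

definition spectral_integral ::
  "(real set \<Rightarrow> 'h::real_inner \<Rightarrow> 'h) \<Rightarrow> (real \<Rightarrow> real) \<Rightarrow> 'h partial_operator" where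
  "spectral_integral E \<phi> = {(x, y). x \<in> spectral_dom E \<phi> \<and>
     (\<forall>z\<in>spectral_dom E \<phi>. inner y z =
        ((\<integral>l. \<phi> l \<partial>scalar_measure E (x + z)) - (\<integral>l. \<phi> l \<partial>scalar_measure E (x - z))) / 4)}"

text \<open>The value $\varphi(A)x$, meaningful for $x$ in the domain of $\varphi(A)$, where $A$ is self-adjoint
  and $E$ is its spectral measure, i.e. $A = \int \lambda\,dE(\lambda)$.\<close>

definition functional_calculus ::
  "'h::real_inner partial_operator \<Rightarrow> (real \<Rightarrow> real) \<Rightarrow> 'h \<Rightarrow> 'h" where
  "functional_calculus A \<phi> x = (THE y. \<exists>E. projection_valued_measure E \<and>
     spectral_integral E (\<lambda>l. l) = A \<and> (x, y) \<in> spectral_integral E \<phi>)"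

end

theory Submission
  imports Defs
begin

text \<open>
  Write $R = (1+\Delta)^{-1}$ for the resolvent of the form. Everything follows from one counting
  estimate: there are constants $A$ and $B$ such that an orthonormal family $f_1,\dots,f_n$ with
  $\langle Rf_i,f_i\rangle \ge \varepsilon$ for all $i$ has at most $A e^{B/\varepsilon}$ members
  (\<open>resolvent_exponentially_few_large\<close>).

  The estimate comes from truncating the kernel $d(x,y)^{-\delta}$. At the dyadic radii $\rho 2^{-j}$, $j<k$,
  put $K_k(x,y) = \sum_{j<k} 2^{\delta j} 1_{d(x,y)\le\rho 2^{-j}}$. This is at most a constant times
  $d(x,y)^{-\delta}$ and is bounded by a multiple of $2^{\delta k}$, but by regularity every one of its $k$
  summands has mass at least $a>0$ in $y$. Expanding the square in
  $\frac12\iint |u(x)-u(y)|^2 K_k(x,y)$ therefore shows that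
  $ka\|u\|^2 \le C\mathcal E(u,u) + \langle K_ku,u\rangle$: the energy controls $\|u\|^2$ with a gain of a
  factor $k$, up to an integral operator whose Hilbert--Schmidt norm is only exponential in $k$. For
  $u = Rf$ with $\|f\| = 1$ and $\langle Rf,f\rangle\ge\varepsilon$ the energy is at most
  $\|u\|^2/\varepsilon$, which is absorbed once $k$ is of order $1/\varepsilon$. So each $f_i$ uses up a fixed
  amount of the square of the Hilbert--Schmidt norm of $K_kR$, which is at most exponential in $1/\varepsilon$.

  The rest is operator theory. A positive operator for which such families have bounded size is a norm limit
  of operators of finite rank, hence compact (\<open>compact_operator_if_few_large\<close>). The resolvent is
  injective because the form domain contains enough Lipschitz functions to separate $L^2$
  (\<open>orthogonal_to_dirichlet_dom\<close>), so it is diagonal in an orthonormal basis with eigenvalues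
  $s_0\ge s_1\ge\cdots$ (\<open>spectral_theorem_compact_positive\<close>). Applied to the first $n+1$ basis vectors,
  the counting estimate gives $n+1\le Ae^{B/s_n}$, which is the logarithmic decay. Finally,
  $\Delta$ is diagonal with eigenvalues $\lambda_n = 1/s_n-1$; for any spectral measure $E$ of $\Delta$ the
  projection $E(\{\lambda_n\})$ fixes the $n$-th basis vector, and hence $e^{-t\Delta}$ is diagonal with eigenvalues $e^{-t\lambda_n} = O(n^{-t/B})$
  (\<open>functional_calculus_diag\<close>, \<open>logarithmic_growth_if_exponentially_few_large\<close>).

  The resolvent itself is obtained by minimising a quadratic functional over the form domain
  (\<open>closed_form_representation\<close>), which is complete by Fatou's lemma.
\<close>

section \<open>Orthonormal bases and diagonal operators\<close>

lemma bessel_inequality: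
  fixes f :: "nat \<Rightarrow> 'h::real_inner"
  assumes orth: "\<And>i j. i < n \<Longrightarrow> j < n \<Longrightarrow> i \<noteq> j \<Longrightarrow> inner (f i) (f j) = 0"
    and unit: "\<And>i. i < n \<Longrightarrow> norm (f i) = 1 \<or> f i = 0"
  shows "(\<Sum>i<n. (inner x (f i))\<^sup>2) \<le> (norm x)\<^sup>2"
proof -
  define s where "s = (\<Sum>i<n. inner x (f i) *\<^sub>R f i)"
  have fs: "inner (f j) s = inner x (f j)" if "j < n" for j
  proof -
    have "inner (f j) s = (\<Sum>i<n. if i = j then inner x (f i) * inner (f j) (f i) else 0)"
      unfolding s_def inner_sum_right using that orth by (intro sum.cong) auto
    also have "\<dots> = inner x (f j) * inner (f j) (f j)"
      using that by simp
    also have "\<dots> = inner x (f j)"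
      using unit[OF that] by (auto simp: norm_eq_1)
    finally show ?thesis .
  qed
  have xs: "inner x s = (\<Sum>i<n. (inner x (f i))\<^sup>2)"
    unfolding s_def inner_sum_right by (simp add: power2_eq_square)
  have "inner s s = (\<Sum>i<n. inner x (f i) * inner (f i) s)"
    by (subst (1) s_def) (simp add: inner_sum_left)
  also have "\<dots> = (\<Sum>i<n. (inner x (f i))\<^sup>2)"
    by (intro sum.cong) (auto simp: fs power2_eq_square)
  finally have ss: "inner s s = (\<Sum>i<n. (inner x (f i))\<^sup>2)" .
  have "0 \<le> inner (x - s) (x - s)" by simp
  also have "\<dots> = (norm x)\<^sup>2 - (\<Sum>i<n. (inner x (f i))\<^sup>2)"
    using xs ss by (simp add: inner_diff_left inner_diff_right inner_commute power2_norm_eq_inner)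
  finally show ?thesis by simp
qed

lemma summable_orthogonal:
  fixes v :: "nat \<Rightarrow> 'h::{real_inner,banach}"
  assumes orth: "\<And>i j. i \<noteq> j \<Longrightarrow> inner (v i) (v j) = 0" and sq: "summable (\<lambda>i. (norm (v i))\<^sup>2)"
  shows "summable v"
  unfolding summable_Cauchy
proof (intro allI impI)
  fix r :: real assume "0 < r"
  with sq obtain N where N: "\<And>m n. m \<ge> N \<Longrightarrow> norm (\<Sum>i\<in>{m..<n}. (norm (v i))\<^sup>2) < r\<^sup>2"
    unfolding summable_Cauchy by (meson zero_less_power)
  have "norm (\<Sum>i\<in>{m..<n}. v i) < r" if "m \<ge> N" for m n
  proof -
    have "(norm (\<Sum>i\<in>{m..<n}. v i))\<^sup>2 = (\<Sum>i\<in>{m..<n}. (norm (v i))\<^sup>2)"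
      using orth by (intro norm_sum_Pythagorean) (auto simp: pairwise_def orthogonal_def)
    then have "(norm (\<Sum>i\<in>{m..<n}. v i))\<^sup>2 < r\<^sup>2"
      using N[OF that, of n] by (simp add: sum_nonneg)
    then show ?thesis
      using \<open>0 < r\<close> by (simp add: power2_less_imp_less)
  qed
  then show "\<exists>N. \<forall>m\<ge>N. \<forall>n. norm (\<Sum>i\<in>{m..<n}. v i) < r" by blast
qed

text \<open>Zero entries are admitted so that finite-dimensional spaces, too, have a basis
  indexed by \<^typ>\<open>nat\<close>.\<close>

locale orthonormal_basis =
  fixes e :: "nat \<Rightarrow> 'h::{real_inner,banach}"
  assumes orth: "\<And>i j. i \<noteq> j \<Longrightarrow> inner (e i) (e j) = 0"
    and unit: "\<And>i. norm (e i) = 1 \<or> e i = 0"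
    and total: "\<And>x. (\<And>i. inner x (e i) = 0) \<Longrightarrow> x = 0"
begin

lemma inner_self_mult: "inner x (e i) * inner (e i) (e i) = inner x (e i)"
  using unit[of i] by (auto simp: norm_eq_1)

lemma summable_square_coords: "summable (\<lambda>i. (inner x (e i))\<^sup>2)"
proof (rule summableI_nonneg_bounded)
  show "(\<Sum>i<n. (inner x (e i))\<^sup>2) \<le> (norm x)\<^sup>2" for n
    using orth unit by (intro bessel_inequality) auto
qed simp

lemma summable_series:
  assumes "summable (\<lambda>i. (c i)\<^sup>2)"
  shows "summable (\<lambda>i. c i *\<^sub>R e i)"
proof (rule summable_orthogonal)
  show "summable (\<lambda>i. (norm (c i *\<^sub>R e i))\<^sup>2)"
  proof (rule summable_comparison_test'[OF assms])
    show "norm ((norm (c i *\<^sub>R e i))\<^sup>2) \<le> (c i)\<^sup>2" if "i \<ge> 0" for i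
      using unit[of i] by (auto simp: power_mult_distrib)
  qed
qed (simp add: orth)

lemma inner_series:
  assumes "summable (\<lambda>i. (c i)\<^sup>2)"
  shows "inner (\<Sum>i. c i *\<^sub>R e i) (e j) = c j * inner (e j) (e j)"
proof -
  have "(\<lambda>i. inner (c i *\<^sub>R e i) (e j)) sums inner (\<Sum>i. c i *\<^sub>R e i) (e j)"
    by (rule bounded_linear.sums[OF bounded_linear_inner_left summable_sums[OF summable_series[OF assms]]])
  moreover have "(\<lambda>i. inner (c i *\<^sub>R e i) (e j)) sums (\<Sum>i\<in>{j}. inner (c i *\<^sub>R e i) (e j))"
    using orth by (intro sums_finite) auto
  ultimately show ?thesis
    using sums_unique2 by fastforce
qed

lemma eq_by_coords:
  assumes "\<And>i. inner x (e i) = inner y (e i)"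
  shows "x = y"
  using total[of "x - y"] assms by (simp add: inner_diff_left)

lemma expansion_sums: "(\<lambda>i. inner x (e i) *\<^sub>R e i) sums x"
proof -
  have "(\<Sum>i. inner x (e i) *\<^sub>R e i) = x"
    by (rule eq_by_coords) (simp add: inner_series[OF summable_square_coords] inner_self_mult)
  then show ?thesis
    using summable_sums[OF summable_series[OF summable_square_coords, of x]] by simp
qed

lemma parseval: "(\<lambda>i. inner x (e i) * inner y (e i)) sums inner x y"
  using bounded_linear.sums[OF bounded_linear_inner_left expansion_sums, of x y]
  by (simp add: inner_commute)

lemma parseval_norm: "(\<lambda>i. (inner x (e i))\<^sup>2) sums (norm x)\<^sup>2"
  using parseval[of x x] by (simp add: power2_norm_eq_inner) (simp add: power2_eq_square)

definition diag :: "(nat \<Rightarrow> real) \<Rightarrow> 'h \<Rightarrow> 'h" where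
  "diag \<tau> x = (\<Sum>i. (\<tau> i * inner x (e i)) *\<^sub>R e i)"

lemma inner_diag:
  assumes "\<And>i. \<bar>\<tau> i\<bar> \<le> M"
  shows "inner (diag \<tau> x) (e j) = \<tau> j * inner x (e j)"
proof -
  have "summable (\<lambda>i. (\<tau> i * inner x (e i))\<^sup>2)"
  proof (rule summable_comparison_test')
    show "summable (\<lambda>i. M\<^sup>2 * (inner x (e i))\<^sup>2)"
      by (intro summable_mult summable_square_coords)
    show "norm ((\<tau> n * inner x (e n))\<^sup>2) \<le> M\<^sup>2 * (inner x (e n))\<^sup>2" if "n \<ge> 0" for n
      using power_mono[OF assms[of n], of 2] by (simp add: power_mult_distrib mult_right_mono)
  qed
  from inner_series[OF this, of j] show ?thesis
    by (simp add: diag_def mult.assoc inner_self_mult)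
qed

lemma norm_diag_le:
  assumes "\<And>i. \<bar>\<tau> i\<bar> \<le> M"
  shows "norm (diag \<tau> x) \<le> M * norm x"
proof -
  have M: "0 \<le> M" using assms[of 0] by linarith
  have "(norm (diag \<tau> x))\<^sup>2 \<le> M\<^sup>2 * (norm x)\<^sup>2"
  proof (rule sums_le[OF _ parseval_norm sums_mult[OF parseval_norm]])
    show "(inner (diag \<tau> x) (e i))\<^sup>2 \<le> M\<^sup>2 * (inner x (e i))\<^sup>2" for i
      using power_mono[OF assms[of i], of 2]
      by (simp add: inner_diag[OF assms] power_mult_distrib mult_right_mono)
  qed
  then show ?thesis
    using M by (auto simp: power_mult_distrib intro: power2_le_imp_le)
qed

lemma bounded_linear_diag:
  assumes "\<And>i. \<bar>\<tau> i\<bar> \<le> M"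
  shows "bounded_linear (diag \<tau>)"
proof (rule bounded_linear_intro)
  show "diag \<tau> (x + y) = diag \<tau> x + diag \<tau> y" for x y
    by (rule eq_by_coords) (simp add: inner_diag[OF assms] inner_add_left distrib_left)
  show "diag \<tau> (r *\<^sub>R x) = r *\<^sub>R diag \<tau> x" for r x
    by (rule eq_by_coords) (simp add: inner_diag[OF assms])
  show "norm (diag \<tau> x) \<le> norm x * M" for x
    using norm_diag_le[of \<tau> M x, OF assms] by (simp add: mult.commute)
qed

lemma inner_diag_symmetric:
  assumes "\<And>i. \<bar>\<tau> i\<bar> \<le> M"
  shows "inner (diag \<tau> x) y = inner x (diag \<tau> y)"
proof -
  have "(\<lambda>i. inner (diag \<tau> x) (e i) * inner y (e i)) = (\<lambda>i. inner x (e i) * inner (diag \<tau> y) (e i))"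
    by (simp add: inner_diag[OF assms] mult_ac)
  then show ?thesis
    using parseval[of "diag \<tau> x" y] parseval[of x "diag \<tau> y"] by (simp add: sums_unique2)
qed

lemma positive_operator_diag:
  assumes "\<And>i. \<bar>\<tau> i\<bar> \<le> M" and "\<And>i. 0 \<le> \<tau> i"
  shows "positive_operator (diag \<tau>)"
  unfolding positive_operator_def
proof (intro conjI allI)
  show "bounded_linear (diag \<tau>)" by (rule bounded_linear_diag[OF assms(1)])
  show "inner (diag \<tau> x) y = inner x (diag \<tau> y)" for x y
    by (rule inner_diag_symmetric[OF assms(1)])
  show "0 \<le> inner (diag \<tau> x) x" for x
  proof (rule sums_le[OF _ sums_zero parseval])
    show "0 \<le> inner (diag \<tau> x) (e i) * inner x (e i)" for i
      by (simp add: inner_diag[OF assms(1)] mult.assoc assms(2))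
  qed
qed

lemma diag_basis:
  assumes "\<And>i. \<bar>\<tau> i\<bar> \<le> M"
  shows "diag \<tau> (e j) = \<tau> j *\<^sub>R e j"
proof (rule eq_by_coords)
  show "inner (diag \<tau> (e j)) (e i) = inner (\<tau> j *\<^sub>R e j) (e i)" for i
    using orth[of j i] by (cases "i = j") (auto simp: inner_diag[OF assms])
qed

end

section \<open>Compact operators\<close>

lemma compact_box_image:
  fixes b :: "nat \<Rightarrow> 'h::real_normed_vector"
  shows "compact {\<Sum>i<n. c i *\<^sub>R b i | c. \<forall>i<n. \<bar>c i\<bar> \<le> M i}"
proof (induction n)
  case 0
  then show ?case by simp
next
  case (Suc n)
  let ?S = "\<lambda>n. {\<Sum>i<n. c i *\<^sub>R b i | c. \<forall>i<n. \<bar>c i\<bar> \<le> M i}"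
  have "compact ((\<lambda>t. t *\<^sub>R b n) ` {- M n..M n})"
    by (intro compact_continuous_image continuous_intros) simp
  then have "compact {x + y | x y. x \<in> ?S n \<and> y \<in> (\<lambda>t. t *\<^sub>R b n) ` {- M n..M n}}"
    by (rule compact_sums[OF Suc.IH])
  moreover have "?S (Suc n) = {x + y | x y. x \<in> ?S n \<and> y \<in> (\<lambda>t. t *\<^sub>R b n) ` {- M n..M n}}"
  proof (intro equalityI subsetI)
    fix z assume "z \<in> ?S (Suc n)"
    then obtain c where "z = (\<Sum>i<n. c i *\<^sub>R b i) + c n *\<^sub>R b n" "\<forall>i<Suc n. \<bar>c i\<bar> \<le> M i" by auto
    then show "z \<in> {x + y | x y. x \<in> ?S n \<and> y \<in> (\<lambda>t. t *\<^sub>R b n) ` {- M n..M n}}"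
      by (force simp: abs_le_iff less_Suc_eq)
  next
    fix z assume "z \<in> {x + y | x y. x \<in> ?S n \<and> y \<in> (\<lambda>t. t *\<^sub>R b n) ` {- M n..M n}}"
    then obtain c t where z: "z = (\<Sum>i<n. c i *\<^sub>R b i) + t *\<^sub>R b n"
      and c: "\<forall>i<n. \<bar>c i\<bar> \<le> M i" "\<bar>t\<bar> \<le> M n" by (auto simp: abs_le_iff)
    have "z = (\<Sum>i<Suc n. (c(n := t)) i *\<^sub>R b i)" unfolding z by simp
    moreover have "\<forall>i<Suc n. \<bar>(c(n := t)) i\<bar> \<le> M i" using c by (auto simp: less_Suc_eq)
    ultimately show "z \<in> ?S (Suc n)" by blast
  qed
  ultimately show ?case by simp
qed

text \<open>A bounded operator that is a norm limit of finite-rank operators is compact: the image of the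
  unit ball stays close to a compact box.\<close>

lemma compact_operator_if_finite_rank_limit:
  fixes T :: "'h::{real_inner,banach} \<Rightarrow> 'h"
  assumes T: "bounded_linear T"
    and approx: "\<And>\<epsilon>. 0 < \<epsilon> \<Longrightarrow> \<exists>(n::nat) a b. \<forall>x. norm (T x - (\<Sum>i<n. inner x (a i) *\<^sub>R b i)) \<le> \<epsilon> * norm x"
  shows "compact_operator T"
proof -
  have "\<exists>k. finite k \<and> closure (T ` cball 0 1) \<subseteq> (\<Union>x\<in>k. ball x \<epsilon>)" if "0 < \<epsilon>" for \<epsilon>
  proof -
    obtain n and a b :: "nat \<Rightarrow> 'h"
      where ab: "\<And>x. norm (T x - (\<Sum>i<n. inner x (a i) *\<^sub>R b i)) \<le> \<epsilon> / 4 * norm x"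
      using approx[of "\<epsilon> / 4"] \<open>0 < \<epsilon>\<close> by auto
    define S where "S = {\<Sum>i<n. c i *\<^sub>R b i | c. \<forall>i<n. \<bar>c i\<bar> \<le> norm (a i)}"
    have "compact S" unfolding S_def by (rule compact_box_image)
    then obtain k where k: "finite k" "S \<subseteq> (\<Union>x\<in>k. ball x (\<epsilon> / 4))"
      unfolding compact_eq_totally_bounded using \<open>0 < \<epsilon>\<close> by (metis zero_less_divide_iff zero_less_numeral)
    have "closure (T ` cball 0 1) \<subseteq> (\<Union>x\<in>k. ball x \<epsilon>)"
    proof
      fix y assume "y \<in> closure (T ` cball 0 1)"
      then obtain x where x: "norm x \<le> 1" "dist (T x) y < \<epsilon> / 4"
        using \<open>0 < \<epsilon>\<close> unfolding closure_approachable by (force dest: spec[of _ "\<epsilon> / 4"])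
      have "\<bar>inner x (a i)\<bar> \<le> norm (a i)" for i
        using Cauchy_Schwarz_ineq2[of x "a i"] x(1) mult_left_le_one_le[of "norm (a i)" "norm x"]
        by auto
      then have "(\<Sum>i<n. inner x (a i) *\<^sub>R b i) \<in> S"
        unfolding S_def by (intro CollectI exI[of _ "\<lambda>i. inner x (a i)"]) auto
      then obtain z where z: "z \<in> k" "dist z (\<Sum>i<n. inner x (a i) *\<^sub>R b i) < \<epsilon> / 4"
        using k(2) by auto
      have "norm (T x - (\<Sum>i<n. inner x (a i) *\<^sub>R b i)) \<le> \<epsilon> / 4"
        using ab[of x] mult_left_le[OF x(1), of "\<epsilon> / 4"] \<open>0 < \<epsilon>\<close> by linarith
      then have "dist (T x) (\<Sum>i<n. inner x (a i) *\<^sub>R b i) \<le> \<epsilon> / 4" by (simp add: dist_norm)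
      then have "dist z y < \<epsilon>"
        using z(2) x(2) dist_triangle[of z y "T x"] \<open>0 < \<epsilon>\<close>
          dist_triangle2[of z "T x" "\<Sum>i<n. inner x (a i) *\<^sub>R b i"] by linarith
      then show "y \<in> (\<Union>x\<in>k. ball x \<epsilon>)" using z(1) by auto
    qed
    with k(1) show ?thesis by blast
  qed
  then have "compact (closure (T ` cball 0 1))"
    unfolding compact_eq_totally_bounded by (simp add: complete_eq_closed)
  with T show ?thesis by (simp add: compact_operator_def)
qed

lemma (in orthonormal_basis) compact_operator_diag:
  assumes bounded: "\<And>i. \<bar>\<tau> i\<bar> \<le> M" and lim: "\<tau> \<longlonglongrightarrow> 0"
  shows "compact_operator (diag \<tau>)"
proof (rule compact_operator_if_finite_rank_limit[OF bounded_linear_diag[OF bounded]])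
  fix \<epsilon> :: real assume "0 < \<epsilon>"
  then obtain n where n: "\<And>i. n \<le> i \<Longrightarrow> \<bar>\<tau> i\<bar> \<le> \<epsilon>"
    using LIMSEQ_D[OF lim] by (metis diff_zero less_imp_le real_norm_def)
  define \<tau>' where "\<tau>' i = (if i < n then 0 else \<tau> i)" for i
  have \<tau>': "\<bar>\<tau>' i\<bar> \<le> \<epsilon>" for i using n[of i] \<open>0 < \<epsilon>\<close> by (auto simp: \<tau>'_def)
  have "diag \<tau> x - (\<Sum>i<n. inner x (e i) *\<^sub>R (\<tau> i *\<^sub>R e i)) = diag \<tau>' x" for x
  proof (rule eq_by_coords)
    fix j
    have "inner (\<Sum>i<n. inner x (e i) *\<^sub>R (\<tau> i *\<^sub>R e i)) (e j) =
        (\<Sum>i<n. if i = j then \<tau> i * inner x (e i) else 0)"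
      unfolding inner_sum_left using orth inner_self_mult by (intro sum.cong) auto
    also have "\<dots> = (if j < n then \<tau> j * inner x (e j) else 0)" by simp
    finally show "inner (diag \<tau> x - (\<Sum>i<n. inner x (e i) *\<^sub>R (\<tau> i *\<^sub>R e i))) (e j) = inner (diag \<tau>' x) (e j)"
      by (simp add: inner_diff_left inner_diag[OF bounded] inner_diag[OF \<tau>']) (simp add: \<tau>'_def)
  qed
  then show "\<exists>n a b. \<forall>x. norm (diag \<tau> x - (\<Sum>i<(n::nat). inner x (a i) *\<^sub>R b i)) \<le> \<epsilon> * norm x"
    using norm_diag_le[OF \<tau>'] by (intro exI[of _ n] exI[of _ e] exI[of _ "\<lambda>i. \<tau> i *\<^sub>R e i"]) simp
qed

section \<open>The spectral theorem for compact positive operators\<close>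

text \<open>The Cauchy--Schwarz inequality for the form $\langle Ax,y\rangle$, applied to $x$ and $Ax$.\<close>

lemma norm_image_le_positive_form:
  fixes A :: "'h::real_inner \<Rightarrow> 'h"
  assumes A: "linear A" "\<And>x y. inner (A x) y = inner x (A y)"
    and V: "subspace V" "\<And>x. x \<in> V \<Longrightarrow> A x \<in> V"
    and pos: "\<And>x. x \<in> V \<Longrightarrow> 0 \<le> inner (A x) x"
    and upper: "\<And>x. x \<in> V \<Longrightarrow> inner (A x) x \<le> c * (norm x)\<^sup>2" and c: "0 < c"
    and x: "x \<in> V"
  shows "(norm (A x))\<^sup>2 \<le> c * inner (A x) x"
proof -
  \<comment> \<open>Evaluate the nonnegative form at $x-tAx$, with $t=1/c$ minimising the resulting bound.\<close>
  define y where "y = A x"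
  have y: "y \<in> V" using V(2)[OF x] by (simp add: y_def)
  have xy: "x - inverse c *\<^sub>R y \<in> V" using V(1) x y by (simp add: subspace_diff subspace_mul)
  have "0 \<le> inner (A (x - inverse c *\<^sub>R y)) (x - inverse c *\<^sub>R y)" by (rule pos[OF xy])
  also have "\<dots> = inner y x - 2 * inverse c * (norm y)\<^sup>2 + (inverse c)\<^sup>2 * inner (A y) y"
  proof -
    have "inner (A y) x = (norm y)\<^sup>2"
      by (simp add: A(2) y_def power2_norm_eq_inner)
    moreover have "inner (A x) y = (norm y)\<^sup>2" by (simp add: y_def power2_norm_eq_inner)
    ultimately show ?thesis
      by (simp add: linear_diff[OF A(1)] linear_scale[OF A(1)] inner_diff_left inner_diff_right
          power2_eq_square algebra_simps flip: y_def)
  qed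
  also have "\<dots> \<le> inner y x - 2 * inverse c * (norm y)\<^sup>2 + (inverse c)\<^sup>2 * (c * (norm y)\<^sup>2)"
    by (intro add_left_mono mult_left_mono upper[OF y]) simp
  also have "\<dots> = inner y x - inverse c * (norm y)\<^sup>2"
    using c by (simp add: power2_eq_square field_simps)
  finally show ?thesis
    using c by (simp add: y_def field_simps)
qed

lemma compact_operator_convergent_subseq:
  assumes T: "compact_operator T" and x: "\<And>n. norm (x n) \<le> 1"
  obtains r y where "strict_mono (r :: nat \<Rightarrow> nat)" "(\<lambda>n. T (x (r n))) \<longlonglongrightarrow> y"
proof -
  have "compact (closure (T ` cball 0 1))" using T by (simp add: compact_operator_def)
  moreover have "T (x n) \<in> closure (T ` cball 0 1)" for n
    using x[of n] by (intro subsetD[OF closure_subset] imageI) simp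
  ultimately obtain y r where "strict_mono (r :: nat \<Rightarrow> nat)" "((\<lambda>n. T (x n)) \<circ> r) \<longlonglongrightarrow> y"
    unfolding compact_def by metis
  with that show ?thesis by (simp add: comp_def)
qed

text \<open>A maximising sequence $x_n$ for the Rayleigh quotient consists of approximate eigenvectors,
  $\|(s-T)x_n\| \to 0$; as $Tx_n$ has a limit point, so has $x_n$.\<close>

lemma rayleigh_maximizer_exists:
  fixes T :: "'h::real_inner \<Rightarrow> 'h"
  assumes T: "compact_operator T" "positive_operator T"
    and V: "subspace V" "closed V" "\<And>x. x \<in> V \<Longrightarrow> T x \<in> V"
    and x0: "x0 \<in> V" "0 < inner (T x0) x0"
  obtains u s where "u \<in> V" "norm u = 1" "0 < s" "T u = s *\<^sub>R u"
    "\<And>x. x \<in> V \<Longrightarrow> inner (T x) x \<le> s * (norm x)\<^sup>2"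
proof -
  have bl: "bounded_linear T" and sym: "\<And>x y. inner (T x) y = inner x (T y)"
    and pos: "\<And>x. 0 \<le> inner (T x) x"
    using T(2) by (auto simp: positive_operator_def)
  interpret T: bounded_linear T by (rule bl)
  obtain K where K: "\<And>x. norm (T x) \<le> norm x * K" using T.bounded by blast
  define Q where "Q = {inner (T x) x | x. x \<in> V \<and> norm x = 1}"
  define s where "s = Sup Q"
  have bdd: "bdd_above Q"
  proof (rule bdd_aboveI)
    fix q assume "q \<in> Q"
    then obtain x where x: "q = inner (T x) x" "norm x = 1" by (auto simp: Q_def)
    then show "q \<le> K"
      using norm_cauchy_schwarz[of "T x" x] K[of x] by simp
  qed
  have upper: "inner (T x) x \<le> s * (norm x)\<^sup>2" if "x \<in> V" for x
  proof (cases "x = 0")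
    case True
    then show ?thesis by (simp add: T.zero)
  next
    case False
    let ?z = "inverse (norm x) *\<^sub>R x"
    have "inner (T ?z) ?z \<in> Q"
      unfolding Q_def using that False V(1) by (intro CollectI exI[of _ ?z]) (simp add: subspace_mul)
    then have "inner (T ?z) ?z \<le> s" unfolding s_def using bdd by (rule cSup_upper)
    then show ?thesis
      using False by (simp add: T.scaleR field_simps power2_eq_square)
  qed
  have "0 < s"
  proof -
    have "x0 \<noteq> 0" using x0(2) by auto
    then show ?thesis
      using upper[OF x0(1)] x0(2) by (metis less_le_trans zero_less_mult_pos2 zero_less_norm_iff zero_less_power)
  qed
  have "Q \<noteq> {}"
  proof -
    have "x0 \<noteq> 0" using x0(2) by auto
    then have "inner (T (inverse (norm x0) *\<^sub>R x0)) (inverse (norm x0) *\<^sub>R x0) \<in> Q"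
      unfolding Q_def using x0 V(1)
      by (intro CollectI exI[of _ "inverse (norm x0) *\<^sub>R x0"]) (simp add: subspace_mul)
    then show ?thesis by blast
  qed
  have "\<exists>x. x \<in> V \<and> norm x = 1 \<and> s - inverse (Suc n) < inner (T x) x" for n :: nat
  proof -
    have "s - inverse (Suc n) < Sup Q" by (simp add: s_def)
    then obtain q where "q \<in> Q" "s - inverse (Suc n) < q"
      using less_cSup_iff[OF \<open>Q \<noteq> {}\<close> bdd] by blast
    then show ?thesis by (auto simp: Q_def)
  qed
  then obtain x where x: "\<And>n. x n \<in> V" "\<And>n. norm (x n) = 1"
      "\<And>n::nat. s - inverse (Suc n) < inner (T (x n)) (x n)" by metis
  define A where "A z = s *\<^sub>R z - T z" for z
  have A: "(norm (A z))\<^sup>2 \<le> s * inner (A z) z" if "z \<in> V" for z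
  proof (rule norm_image_le_positive_form[where V = V])
    show "linear A" unfolding A_def
      by (rule linearI) (simp_all add: T.add T.scaleR algebra_simps)
    show "inner (A y) z = inner y (A z)" for y z
      by (simp add: A_def inner_diff_left inner_diff_right sym)
    show "A z \<in> V" if "z \<in> V" for z
      using V(1,3) that by (simp add: A_def subspace_diff subspace_mul)
    show "0 \<le> inner (A z) z" if "z \<in> V" for z
      using upper[OF that] by (simp add: A_def inner_diff_left power2_norm_eq_inner)
    show "inner (A z) z \<le> s * (norm z)\<^sup>2" for z
      using pos[of z] by (simp add: A_def inner_diff_left power2_norm_eq_inner)
  qed fact+
  have Ax_le: "(norm (A (x n)))\<^sup>2 \<le> s * inverse (Suc n)" for n
  proof -
    have "inner (A (x n)) (x n) \<le> inverse (Suc n)"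
      using x(3)[of n] x(2)[of n] by (simp add: A_def inner_diff_left norm_eq_1)
    then show ?thesis
      using A[OF x(1)[of n]] \<open>0 < s\<close> by (meson mult_le_cancel_left_pos order_trans)
  qed
  have "(\<lambda>n. (norm (A (x n)))\<^sup>2) \<longlonglongrightarrow> 0"
  proof (rule Lim_null_comparison)
    show "\<forall>\<^sub>F n in sequentially. norm ((norm (A (x n)))\<^sup>2) \<le> s * inverse (real (Suc n))"
      using Ax_le by simp
    show "(\<lambda>n. s * inverse (real (Suc n))) \<longlonglongrightarrow> 0"
      by (intro tendsto_mult_right_zero LIMSEQ_inverse_real_of_nat)
  qed
  then have Ax: "(\<lambda>n. A (x n)) \<longlonglongrightarrow> 0"
    using tendsto_real_sqrt[of "\<lambda>n. (norm (A (x n)))\<^sup>2" 0] by (simp add: tendsto_norm_zero_iff)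
  obtain r y where r: "strict_mono (r :: nat \<Rightarrow> nat)" "(\<lambda>n. T (x (r n))) \<longlonglongrightarrow> y"
    using compact_operator_convergent_subseq[OF T(1)] x(2) by (metis order_refl)
  define u where "u = inverse s *\<^sub>R y"
  have "(\<lambda>n. inverse s *\<^sub>R (A (x (r n)) + T (x (r n)))) \<longlonglongrightarrow> inverse s *\<^sub>R (0 + y)"
    using LIMSEQ_subseq_LIMSEQ[OF Ax r(1)] r(2) by (intro tendsto_intros) (simp_all add: comp_def)
  then have u: "(\<lambda>n. x (r n)) \<longlonglongrightarrow> u"
    using \<open>0 < s\<close> by (simp add: A_def u_def)
  have "(\<lambda>n. norm (x (r n))) \<longlonglongrightarrow> norm u" by (rule tendsto_norm[OF u])
  then have "norm u = 1" by (simp add: x(2) LIMSEQ_const_iff)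
  moreover have "T u = s *\<^sub>R u"
    using LIMSEQ_unique[OF T.tendsto[OF u] r(2)] \<open>0 < s\<close> by (simp add: u_def)
  moreover have "u \<in> V"
    using closed_sequentially[OF V(2) _ u] x(1) by blast
  ultimately show ?thesis using that \<open>0 < s\<close> upper by blast
qed

text \<open>The eigenvectors are chosen successively, each maximising the Rayleigh quotient on the orthogonal
  complement of its predecessors; once the quotient vanishes there, zero vectors follow.\<close>

theorem spectral_theorem_compact_positive:
  fixes T :: "'h::{real_inner,banach} \<Rightarrow> 'h"
  assumes T: "compact_operator T" "positive_operator T" and inj: "\<And>x. T x = 0 \<Longrightarrow> x = 0"
  obtains e s where "orthonormal_basis e" "T = orthonormal_basis.diag e s"
    "decseq s" "s \<longlonglongrightarrow> 0" "\<And>n. s n = 0 \<longleftrightarrow> e n = 0"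
proof -
  have bl: "bounded_linear T" and sym: "\<And>x y. inner (T x) y = inner x (T y)"
    and pos: "\<And>x. 0 \<le> inner (T x) x"
    using T(2) by (auto simp: positive_operator_def)
  interpret T: bounded_linear T by (rule bl)
  define V where "V e n = {x. \<forall>i<n. inner x (e i) = 0}" for e :: "nat \<Rightarrow> 'h" and n
  define P where "P e n u \<longleftrightarrow> u \<in> V e n \<and> (norm u = 1 \<or> u = 0) \<and>
    (\<exists>s\<ge>0. (s = 0 \<longleftrightarrow> u = 0) \<and> T u = s *\<^sub>R u \<and> (\<forall>x\<in>V e n. inner (T x) x \<le> s * (norm x)\<^sup>2))"
    for e n u
  have "\<exists>e. \<forall>n. P e n (e n)"
  proof (rule dependent_wellorder_choice)
    show "P e n u = P e' n u" if "\<And>m. m < n \<Longrightarrow> e m = e' m" for e e' n u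
    proof -
      have "V e n = V e' n" using that by (auto simp: V_def)
      then show ?thesis by (simp add: P_def)
    qed
    fix n e assume IH: "\<And>m. m < n \<Longrightarrow> P e m (e m)"
    have sub: "subspace (V e n)"
      by (auto simp: V_def subspace_def inner_add_left)
    have clo: "closed (V e n)"
    proof -
      have "V e n = (\<Inter>i\<in>{..<n}. {x. inner x (e i) = 0})" by (auto simp: V_def)
      then show ?thesis by (auto intro!: closed_INT closed_Collect_eq continuous_intros)
    qed
    have inv: "T x \<in> V e n" if "x \<in> V e n" for x
      using that IH by (force simp: V_def sym P_def)
    show "\<exists>u. P e n u"
    proof (cases "\<exists>x\<in>V e n. 0 < inner (T x) x")
      case True
      then obtain x0 where "x0 \<in> V e n" "0 < inner (T x0) x0" by blast
      from rayleigh_maximizer_exists[OF T sub clo inv this] obtain u s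
        where "u \<in> V e n" "norm u = 1" "0 < s" "T u = s *\<^sub>R u"
          "\<And>x. x \<in> V e n \<Longrightarrow> inner (T x) x \<le> s * (norm x)\<^sup>2" by metis
      then have "P e n u" unfolding P_def by (auto intro!: exI[of _ s])
      then show ?thesis by blast
    next
      case False
      then have "P e n 0"
        using sub by (auto simp: P_def T.zero subspace_0 not_less intro!: exI[of _ 0])
      then show ?thesis by blast
    qed
  qed
  then obtain e where e: "\<And>n. P e n (e n)" by blast
  then obtain s where s: "\<And>n. 0 \<le> s n" "\<And>n. s n = 0 \<longleftrightarrow> e n = 0" "\<And>n. T (e n) = s n *\<^sub>R e n"
    "\<And>n x. x \<in> V e n \<Longrightarrow> inner (T x) x \<le> s n * (norm x)\<^sup>2"
    unfolding P_def by metis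
  have unit: "norm (e n) = 1 \<or> e n = 0" for n using e[of n] by (simp add: P_def)
  have orth: "inner (e i) (e j) = 0" if "i \<noteq> j" for i j
  proof -
    have "inner (e n) (e m) = 0" if "m < n" for m n
      using e[of n] that by (simp add: P_def V_def)
    with that show ?thesis by (metis inner_commute linorder_neqE_nat)
  qed
  have "decseq s"
  proof (rule decseq_SucI)
    fix n
    show "s (Suc n) \<le> s n"
    proof (cases "e (Suc n) = 0")
      case True
      then show ?thesis using s(1,2) by metis
    next
      case False
      have "e (Suc n) \<in> V e n" using orth by (auto simp: V_def)
      moreover have "norm (e (Suc n)) = 1" using unit False by blast
      moreover from this have "inner (e (Suc n)) (e (Suc n)) = 1" by (simp add: norm_eq_1)
      ultimately show ?thesis
        using s(4)[of "e (Suc n)" n] by (simp add: s(3))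
    qed
  qed
  have "s \<longlonglongrightarrow> 0"
  proof -
    from decseq_convergent[OF \<open>decseq s\<close>, of 0] s(1) obtain L
      where L: "s \<longlonglongrightarrow> L" "\<And>n. L \<le> s n" by metis
    have "L = 0"
    proof (rule ccontr)
      assume "L \<noteq> 0"
      then have "0 < L" using LIMSEQ_le_const[OF L(1), of 0] s(1) by force
      then have e1: "norm (e n) = 1" for n using L(2)[of n] s(2)[of n] unit[of n] by auto
      obtain r y where r: "strict_mono (r :: nat \<Rightarrow> nat)" "(\<lambda>n. T (e (r n))) \<longlonglongrightarrow> y"
        using compact_operator_convergent_subseq[OF T(1)] e1 by (metis order_refl)
      then have "Cauchy (\<lambda>n. T (e (r n)))" by (simp add: LIMSEQ_imp_Cauchy)
      then obtain N where "\<And>m n. m \<ge> N \<Longrightarrow> n \<ge> N \<Longrightarrow> norm (T (e (r m)) - T (e (r n))) < L"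
        using CauchyD[OF _ \<open>0 < L\<close>] by blast
      then have "norm (T (e (r N)) - T (e (r (Suc N)))) < L" by simp
      moreover have "r N \<noteq> r (Suc N)" using r(1) by (metis n_not_Suc_n strict_mono_eq)
      then have "(norm (T (e (r N)) - T (e (r (Suc N)))))\<^sup>2 = (s (r N))\<^sup>2 + (s (r (Suc N)))\<^sup>2"
        using orth[of "r N" "r (Suc N)"] orth[of "r (Suc N)" "r N"] e1
        by (simp add: s(3) power2_norm_eq_inner inner_diff_left inner_diff_right norm_eq_1)
           (simp add: power2_eq_square)
      moreover have "L\<^sup>2 \<le> (s (r N))\<^sup>2"
        using L(2) \<open>0 < L\<close> by (intro power_mono) auto
      ultimately show False
        using \<open>0 < L\<close> by (smt (verit) norm_ge_zero power_strict_mono zero_le_power2 zero_less_numeral)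
    qed
    with L(1) show ?thesis by simp
  qed
  interpret orthonormal_basis e
  proof
    fix x assume x: "\<And>i. inner x (e i) = 0"
    have "inner (T x) x \<le> s n * (norm x)\<^sup>2" for n
      using x by (intro s(4)) (simp add: V_def)
    moreover have "(\<lambda>n. s n * (norm x)\<^sup>2) \<longlonglongrightarrow> 0 * (norm x)\<^sup>2"
      by (intro tendsto_intros \<open>s \<longlonglongrightarrow> 0\<close>)
    ultimately have "inner (T x) x \<le> 0"
      using LIMSEQ_le_const[of "\<lambda>n. s n * (norm x)\<^sup>2" "0 * (norm x)\<^sup>2" "inner (T x) x"] by simp
    moreover obtain K where K: "0 < K" "\<And>x. norm (T x) \<le> norm x * K" using T.pos_bounded by blast
    have "(norm (T x))\<^sup>2 \<le> K * inner (T x) x"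
    proof (rule norm_image_le_positive_form[where V = UNIV])
      show "inner (T y) y \<le> K * (norm y)\<^sup>2" for y
        using norm_cauchy_schwarz[of "T y" y] mult_right_mono[OF K(2)[of y] norm_ge_zero[of y]]
        by (simp add: power2_eq_square mult_ac)
    qed (use sym pos K T.linear_axioms in auto)
    ultimately have "T x = 0"
      using pos[of x] by simp
    then show "x = 0" by (rule inj)
  qed (use orth unit in auto)
  have sb: "\<bar>s n\<bar> \<le> s 0" for n using s(1) \<open>decseq s\<close> by (simp add: decseqD)
  have "T = diag s"
  proof
    show "T x = diag s x" for x
      by (rule eq_by_coords) (simp add: inner_diag[OF sb] sym s(3))
  qed
  then show ?thesis
    using that orthonormal_basis_axioms \<open>decseq s\<close> \<open>s \<longlonglongrightarrow> 0\<close> s(2) by blast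
qed

section \<open>Singular values of diagonal operators\<close>

text \<open>At the first index where two decreasing sequences differ, the larger of the two values occurs more
  often in the sequence that takes it there.\<close>

lemma lists_eigenvalues_unique:
  assumes s: "lists_eigenvalues S s" and s': "lists_eigenvalues S s'"
  shows "s = s'"
proof -
  have not_below: "\<not> b n < a n" if "lists_eigenvalues S a" "lists_eigenvalues S b" "\<And>m. m < n \<Longrightarrow> a m = b m"
    for a b :: "nat \<Rightarrow> real" and n
  proof
    assume "b n < a n"
    define l where "l = a n"
    have dec: "decseq b" using that(2) by (simp add: lists_eigenvalues_def)
    have "0 \<le> b n" using that(2) by (simp add: lists_eigenvalues_def)
    then have "0 < l" using \<open>b n < a n\<close> by (simp add: l_def)
    then have fin: "finite {m. a m = l}" and card: "card {m. a m = l} = card {m. b m = l}"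
      using that(1,2) by (auto simp: lists_eigenvalues_def)
    have "{m. b m = l} \<subset> {m. a m = l}"
    proof
      show "{m. b m = l} \<subseteq> {m. a m = l}"
      proof
        fix m assume m: "m \<in> {m. b m = l}"
        have "m < n"
        proof (rule ccontr)
          assume "\<not> m < n"
          then have "b m \<le> b n" using dec by (simp add: decseqD)
          then show False using m \<open>b n < a n\<close> by (simp add: l_def)
        qed
        then show "m \<in> {m. a m = l}" using m that(3) by simp
      qed
      have "n \<in> {m. a m = l}" "n \<notin> {m. b m = l}" using \<open>b n < a n\<close> by (simp_all add: l_def)
      then show "{m. b m = l} \<noteq> {m. a m = l}" by blast
    qed
    from psubset_card_mono[OF fin this] card show False by simp
  qed
  have "s n = s' n" for n
  proof (induction n rule: less_induct)
    case (less n)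
    then show ?case
      using not_below[OF s s', of n] not_below[OF s' s, of n] by (metis linorder_neqE)
  qed
  then show ?thesis by blast
qed

context orthonormal_basis
begin

lemma inj_on_basis: "inj_on e {n. e n \<noteq> 0}"
  using orth by (auto simp: inj_on_def) (metis inner_eq_zero_iff)

text \<open>On $e_j$ a positive square root $S$ of $T^2$ acts as $\tau_j$, because
  $(S+\tau_j)(S-\tau_j)e_j = 0$ and $S+\tau_j$ is injective when $\tau_j>0$.\<close>

lemma operator_abs_diag:
  assumes bounded: "\<And>i. \<bar>\<tau> i\<bar> \<le> M" and nonneg: "\<And>i. 0 \<le> \<tau> i" and zero: "\<And>i. \<tau> i = 0 \<Longrightarrow> e i = 0"
  shows "operator_abs (diag \<tau>) = diag \<tau>"
proof -
  have adj: "adjoint (diag \<tau>) = diag \<tau>"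
    by (rule adjoint_unique) (simp add: inner_diag_symmetric[OF bounded])
  show ?thesis
    unfolding operator_abs_def adj
  proof (rule the_equality)
    show "positive_operator (diag \<tau>) \<and> diag \<tau> \<circ> diag \<tau> = diag \<tau> \<circ> diag \<tau>"
      using positive_operator_diag[OF bounded nonneg] by simp
    fix S assume S: "positive_operator S \<and> S \<circ> S = diag \<tau> \<circ> diag \<tau>"
    then have bl: "bounded_linear S" and sym: "\<And>x y. inner (S x) y = inner x (S y)"
      and pos: "\<And>x. 0 \<le> inner (S x) x" and SS: "\<And>x. S (S x) = diag \<tau> (diag \<tau> x)"
      by (auto simp: positive_operator_def fun_eq_iff)
    interpret S: bounded_linear S by (rule bl)
    interpret D: bounded_linear "diag \<tau>" by (rule bounded_linear_diag[OF bounded])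
    have "S (e j) = \<tau> j *\<^sub>R e j" for j
    proof (cases "\<tau> j = 0")
      case True
      then show ?thesis using zero[of j] by (simp add: S.zero)
    next
      case False
      define v where "v = S (e j) - \<tau> j *\<^sub>R e j"
      have "S v = - \<tau> j *\<^sub>R v"
        by (simp add: v_def S.diff S.scaleR SS diag_basis[OF bounded] D.scaleR algebra_simps)
      then have "\<tau> j * inner v v \<le> 0"
        using pos[of v] by simp
      moreover have "0 < \<tau> j" using nonneg[of j] False by simp
      ultimately have "v = 0"
        by (metis inner_gt_zero_iff mult_pos_pos not_less)
      then show ?thesis by (simp add: v_def)
    qed
    then show "S = diag \<tau>"
      by (intro ext eq_by_coords) (simp add: inner_diag[OF bounded] sym)
  qed
qed

lemma lists_eigenvalues_diag:
  assumes dec: "decseq \<tau>" and lim: "\<tau> \<longlonglongrightarrow> 0" and zero: "\<And>i. \<tau> i = 0 \<longleftrightarrow> e i = 0"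
  shows "lists_eigenvalues (diag \<tau>) \<tau>"
proof -
  have nonneg: "0 \<le> \<tau> i" for i using decseq_ge[OF dec lim] .
  have bounded: "\<bar>\<tau> i\<bar> \<le> \<tau> 0" for i using nonneg dec by (simp add: decseqD)
  have "finite {n. \<tau> n = l} \<and> card {n. \<tau> n = l} = dim (eigenspace (diag \<tau>) l)" if "0 < l" for l
  proof
    obtain N where "\<And>n. n \<ge> N \<Longrightarrow> \<tau> n < l"
      using order_tendstoD(2)[OF lim \<open>0 < l\<close>] by (auto simp: eventually_sequentially)
    then have "{n. \<tau> n = l} \<subseteq> {..<N}" by (force simp: not_less[symmetric])
    then show fin: "finite {n. \<tau> n = l}" by (rule finite_subset) simp
    let ?B = "e ` {n. \<tau> n = l}"
    have nz: "{n. \<tau> n = l} \<subseteq> {n. e n \<noteq> 0}" using zero \<open>0 < l\<close> by force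
    have card: "card ?B = card {n. \<tau> n = l}"
      using inj_on_subset[OF inj_on_basis nz] by (rule card_image)
    have "independent ?B"
    proof (rule pairwise_orthogonal_independent)
      show "pairwise orthogonal ?B"
        by (auto simp: pairwise_def orthogonal_def intro!: orth)
      show "0 \<notin> ?B" using nz by auto
    qed
    moreover have "span ?B = eigenspace (diag \<tau>) l"
    proof (rule subset_antisym)
      have "subspace (eigenspace (diag \<tau>) l)"
      proof -
        interpret D: bounded_linear "diag \<tau>" by (rule bounded_linear_diag[OF bounded])
        show ?thesis by (auto simp: subspace_def eigenspace_def D.zero D.add D.scaleR algebra_simps)
      qed
      moreover have "?B \<subseteq> eigenspace (diag \<tau>) l" by (auto simp: eigenspace_def diag_basis[OF bounded])
      ultimately show "span ?B \<subseteq> eigenspace (diag \<tau>) l" by (rule span_minimal[rotated])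
      show "eigenspace (diag \<tau>) l \<subseteq> span ?B"
      proof
        fix x assume "x \<in> eigenspace (diag \<tau>) l"
        then have x: "inner x (e i) = 0" if "\<tau> i \<noteq> l" for i
          using inner_diag[of \<tau> "\<tau> 0" x i, OF bounded] that by (auto simp: eigenspace_def)
        have "x = (\<Sum>i\<in>{n. \<tau> n = l}. inner x (e i) *\<^sub>R e i)"
        proof (rule eq_by_coords)
          fix j
          have "inner (\<Sum>i\<in>{n. \<tau> n = l}. inner x (e i) *\<^sub>R e i) (e j) =
              (\<Sum>i\<in>{n. \<tau> n = l}. if i = j then inner x (e i) else 0)"
            unfolding inner_sum_left using orth inner_self_mult by (intro sum.cong) auto
          then show "inner x (e j) = inner (\<Sum>i\<in>{n. \<tau> n = l}. inner x (e i) *\<^sub>R e i) (e j)"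
            using x fin by auto
        qed
        also have "\<dots> \<in> span ?B" by (intro span_sum span_scale span_base) auto
        finally show "x \<in> span ?B" .
      qed
    qed
    ultimately show "card {n. \<tau> n = l} = dim (eigenspace (diag \<tau>) l)"
      using dim_span_eq_card_independent card by metis
  qed
  then show ?thesis
    using dec nonneg by (simp add: lists_eigenvalues_def)
qed

lemma singular_value_diag:
  assumes "decseq \<tau>" "\<tau> \<longlonglongrightarrow> 0" "\<And>i. \<tau> i = 0 \<longleftrightarrow> e i = 0"
  shows "singular_value (diag \<tau>) n = \<tau> (n - 1)"
proof -
  have nonneg: "0 \<le> \<tau> i" for i using decseq_ge[OF assms(1,2)] .
  then have "\<bar>\<tau> i\<bar> \<le> \<tau> 0" for i using assms(1) by (simp add: decseqD)
  then have abs: "operator_abs (diag \<tau>) = diag \<tau>"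
    by (rule operator_abs_diag) (use nonneg assms(3) in auto)
  have "(THE s. lists_eigenvalues (diag \<tau>) s) = \<tau>"
    using lists_eigenvalues_diag[OF assms] lists_eigenvalues_unique by blast
  then show ?thesis by (simp add: singular_value_def abs)
qed

end

section \<open>Compactness by counting large directions\<close>

lemma sum_lessThan_add: "(\<Sum>i<n + m. g i) = (\<Sum>i<n. g i) + (\<Sum>i<m. g (n + i))"
  for g :: "nat \<Rightarrow> 'b::comm_monoid_add"
  by (induction m) (simp_all add: add.assoc)

definition orthonormal_family :: "nat \<Rightarrow> (nat \<Rightarrow> 'h::real_inner) \<Rightarrow> bool" where
  "orthonormal_family n f \<longleftrightarrow> (\<forall>i<n. norm (f i) = 1) \<and> (\<forall>i<n. \<forall>j<n. i \<noteq> j \<longrightarrow> inner (f i) (f j) = 0)"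

text \<open>On the orthogonal complement of a maximal orthonormal family with $\langle Tf_i,f_i\rangle\ge\varepsilon$
  the form of $T$ is below $\varepsilon$. With $Q$ the projection onto this complement, $QTQ$ has norm at most
  $\varepsilon$, and $T-QTQ$ has finite rank.\<close>

lemma compact_operator_if_few_large:
  fixes T :: "'h::{real_inner,banach} \<Rightarrow> 'h"
  assumes T: "positive_operator T"
    and few: "\<And>\<epsilon>. 0 < \<epsilon> \<Longrightarrow> \<exists>N. \<forall>n f. orthonormal_family n f \<and> (\<forall>i<n. \<epsilon> \<le> inner (T (f i)) (f i)) \<longrightarrow> n \<le> N"
  shows "compact_operator T"
proof -
  have bl: "bounded_linear T" and sym: "\<And>x y. inner (T x) y = inner x (T y)"
    and pos: "\<And>x. 0 \<le> inner (T x) x"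
    using T by (auto simp: positive_operator_def)
  interpret T: bounded_linear T by (rule bl)
  show ?thesis
  proof (rule compact_operator_if_finite_rank_limit[OF bl])
    fix \<epsilon> :: real assume "0 < \<epsilon>"
    define P where "P n \<longleftrightarrow> (\<exists>f. orthonormal_family n f \<and> (\<forall>i<n. \<epsilon> \<le> inner (T (f i)) (f i)))" for n
    obtain N where "\<And>n. P n \<Longrightarrow> n \<le> N" using few[OF \<open>0 < \<epsilon>\<close>] unfolding P_def by blast
    moreover have "P 0" by (simp add: P_def orthonormal_family_def)
    ultimately obtain n where "P n" and max: "\<And>m. P m \<Longrightarrow> m \<le> n"
      using ex_has_greatest_nat[of P 0 "\<lambda>n. n" "Suc N"] by (auto simp: less_Suc_eq_le)
    then obtain f where f: "orthonormal_family n f" and large: "\<And>i. i < n \<Longrightarrow> \<epsilon> \<le> inner (T (f i)) (f i)"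
      unfolding P_def by blast
    have unit: "norm (f i) = 1" if "i < n" for i using f that by (simp add: orthonormal_family_def)
    have orth: "inner (f i) (f j) = 0" if "i < n" "j < n" "i \<noteq> j" for i j
      using f that by (simp add: orthonormal_family_def)
    have small: "inner (T x) x \<le> \<epsilon> * (norm x)\<^sup>2" if "\<And>i. i < n \<Longrightarrow> inner x (f i) = 0" for x
    proof (rule ccontr)
      assume neg: "\<not> inner (T x) x \<le> \<epsilon> * (norm x)\<^sup>2"
      then have "x \<noteq> 0" by (auto simp: T.zero)
      define u where "u = inverse (norm x) *\<^sub>R x"
      have "norm u = 1" using \<open>x \<noteq> 0\<close> by (simp add: u_def)
      moreover have "inner u (f i) = 0" "inner (f i) u = 0" if "i < n" for i
        using \<open>\<And>i. i < n \<Longrightarrow> inner x (f i) = 0\<close>[OF that] by (simp_all add: u_def inner_commute)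
      ultimately have "orthonormal_family (Suc n) (f(n := u))"
        using unit orth by (auto simp: orthonormal_family_def less_Suc_eq)
      moreover have "\<epsilon> \<le> inner (T u) u"
      proof -
        have "inner (T u) u * (norm x)\<^sup>2 = inner (T x) x"
          using \<open>x \<noteq> 0\<close> by (simp add: u_def T.scaleR power2_eq_square field_simps)
        then have "\<epsilon> * (norm x)\<^sup>2 \<le> inner (T u) u * (norm x)\<^sup>2"
          using neg by linarith
        then show ?thesis using \<open>x \<noteq> 0\<close> by simp
      qed
      then have "\<forall>i<Suc n. \<epsilon> \<le> inner (T ((f(n := u)) i)) ((f(n := u)) i)"
        using large by (auto simp: less_Suc_eq)
      ultimately have "P (Suc n)"
        unfolding P_def by blast
      then show False using max[of "Suc n"] by simp
    qed
    define p where "p x = (\<Sum>i<n. inner x (f i) *\<^sub>R f i)" for x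
    define q where "q x = x - p x" for x
    have p_add: "p (x + y) = p x + p y" and p_scale: "p (r *\<^sub>R x) = r *\<^sub>R p x" for x y r
      by (simp_all add: p_def inner_add_left scaleR_add_left sum.distrib scaleR_sum_right)
    have q_add: "q (x + y) = q x + q y" and q_scale: "q (r *\<^sub>R x) = r *\<^sub>R q x" for x y r
      by (simp_all add: q_def p_add p_scale algebra_simps)
    have lin_q: "linear q" by (rule linearI) (rule q_add q_scale)+
    have p_sym: "inner (p x) y = inner x (p y)" for x y
      by (simp add: p_def inner_sum_left inner_sum_right inner_commute mult.commute)
    have q_sym: "inner (q x) y = inner x (q y)" for x y
      by (simp add: q_def inner_diff_left inner_diff_right p_sym)
    have q_orth: "inner (q x) (f i) = 0" if "i < n" for x i
    proof -
      have "inner (p x) (f i) = (\<Sum>j<n. if j = i then inner x (f j) else 0)"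
        unfolding p_def inner_sum_left
        using that orth unit by (intro sum.cong) (auto simp: norm_eq_1)
      also have "\<dots> = inner x (f i)" using that by simp
      finally show ?thesis by (simp add: q_def inner_diff_left)
    qed
    have q_p: "inner (q x) (p x) = 0" for x
      by (simp add: p_def inner_sum_right q_orth)
    have norm_q: "norm (q x) \<le> norm x" for x
    proof -
      have "(norm x)\<^sup>2 = (norm (q x))\<^sup>2 + (norm (p x))\<^sup>2"
        using norm_add_Pythagorean[of "q x" "p x"] q_p[of x] by (simp add: orthogonal_def) (simp add: q_def)
      then have "(norm (q x))\<^sup>2 \<le> (norm x)\<^sup>2" by simp
      then show ?thesis by (rule power2_le_imp_le) simp
    qed
    define A where "A x = q (T (q x))" for x
    have A_upper: "inner (A x) x \<le> \<epsilon> * (norm x)\<^sup>2" for x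
    proof -
      have "inner (A x) x = inner (T (q x)) (q x)" by (simp add: A_def q_sym)
      also have "\<dots> \<le> \<epsilon> * (norm (q x))\<^sup>2" by (rule small) (rule q_orth)
      also have "\<dots> \<le> \<epsilon> * (norm x)\<^sup>2" using \<open>0 < \<epsilon>\<close> norm_q[of x] by (simp add: power_mono)
      finally show ?thesis .
    qed
    have A_norm: "norm (A x) \<le> \<epsilon> * norm x" for x
    proof -
      have "(norm (A x))\<^sup>2 \<le> \<epsilon> * inner (A x) x"
      proof (rule norm_image_le_positive_form[where V = UNIV])
        show "linear A" unfolding A_def
          by (rule linearI) (simp_all add: q_add q_scale T.add T.scaleR)
        show "inner (A x) y = inner x (A y)" for x y by (simp add: A_def q_sym sym)
        show "0 \<le> inner (A x) x" for x using pos[of "q x"] by (simp add: A_def q_sym)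
      qed (use A_upper \<open>0 < \<epsilon>\<close> in auto)
      also have "\<dots> \<le> (\<epsilon> * norm x)\<^sup>2"
        using A_upper[of x] \<open>0 < \<epsilon>\<close> by (simp add: power_mult_distrib power2_eq_square[of \<epsilon>])
      finally show ?thesis by (rule power2_le_imp_le) (use \<open>0 < \<epsilon>\<close> in simp)
    qed
    define a where "a i = (if i < n then T (f i) else f (i - n))" for i
    define b where "b i = (if i < n then f i else q (T (f (i - n))))" for i
    have "T x - (\<Sum>i<n + n. inner x (a i) *\<^sub>R b i) = A x" for x
    proof -
      have "(\<Sum>i<n + n. inner x (a i) *\<^sub>R b i) =
          (\<Sum>i<n. inner x (a i) *\<^sub>R b i) + (\<Sum>i<n. inner x (a (n + i)) *\<^sub>R b (n + i))"
        by (rule sum_lessThan_add)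
      also have "(\<Sum>i<n. inner x (a i) *\<^sub>R b i) = p (T x)"
        by (simp add: a_def b_def p_def sym)
      also have "(\<Sum>i<n. inner x (a (n + i)) *\<^sub>R b (n + i)) = (\<Sum>i<n. inner x (f i) *\<^sub>R q (T (f i)))"
        by (simp add: a_def b_def)
      also have "(\<Sum>i<n. inner x (f i) *\<^sub>R q (T (f i))) = q (T (p x))"
        by (simp add: p_def T.sum T.scaleR linear_sum[OF lin_q] q_scale)
      finally show ?thesis
        by (simp add: A_def) (simp add: q_def T.diff p_def inner_diff_left scaleR_diff_left sum_subtractf)
    qed
    then show "\<exists>n a b. \<forall>x. norm (T x - (\<Sum>i<(n::nat). inner x (a i) *\<^sub>R b i)) \<le> \<epsilon> * norm x"
      using A_norm by (intro exI[of _ "n + n"] exI[of _ a] exI[of _ b]) simp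
  qed
qed

section \<open>Projection-valued measures\<close>

locale spectral_resolution =
  fixes E :: "real set \<Rightarrow> 'h::real_inner \<Rightarrow> 'h"
  assumes pvm: "projection_valued_measure E"
begin

lemma bounded_linear_proj: "B \<in> sets borel \<Longrightarrow> bounded_linear (E B)"
  and proj_idem: "B \<in> sets borel \<Longrightarrow> E B (E B x) = E B x"
  and proj_sym: "B \<in> sets borel \<Longrightarrow> inner (E B x) y = inner x (E B y)"
  and proj_UNIV: "E UNIV x = x"
  using pvm by (auto simp: projection_valued_measure_def fun_eq_iff)

lemma proj_sums:
  "range B \<subseteq> sets borel \<Longrightarrow> disjoint_family B \<Longrightarrow> (\<lambda>i. E (B i) x) sums E (\<Union>i. B i) x"
  for B :: "nat \<Rightarrow> real set"
  using pvm by (simp add: projection_valued_measure_def)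

lemma proj_add: "B \<in> sets borel \<Longrightarrow> E B (x + y) = E B x + E B y"
  and proj_diff: "B \<in> sets borel \<Longrightarrow> E B (x - y) = E B x - E B y"
  and proj_scaleR: "B \<in> sets borel \<Longrightarrow> E B (r *\<^sub>R x) = r *\<^sub>R E B x"
  using bounded_linear_proj[THEN bounded_linear.linear]
  by (simp_all add: linear_add linear_diff linear_scale)

lemma inner_proj: "B \<in> sets borel \<Longrightarrow> inner (E B x) x = (norm (E B x))\<^sup>2"
  by (metis power2_norm_eq_inner proj_idem proj_sym)

lemma proj_empty: "E {} x = 0"
proof -
  have "(\<lambda>i::nat. E {} x) sums E (\<Union>i::nat. {}) x"
    by (rule proj_sums) (auto simp: disjoint_family_on_def)
  then have "(\<lambda>i::nat. E {} x) \<longlonglongrightarrow> 0"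
    using sums_summable summable_LIMSEQ_zero by blast
  then show ?thesis by (simp add: LIMSEQ_const_iff)
qed

lemma proj_Un:
  assumes "B \<in> sets borel" "C \<in> sets borel" "B \<inter> C = {}"
  shows "E (B \<union> C) x = E B x + E C x"
proof -
  have "(\<lambda>i. E (binaryset B C i) x) sums E (\<Union>i. binaryset B C i) x"
    using assms by (intro proj_sums) (auto simp: range_binaryset_eq disjoint_family_on_def binaryset_def)
  moreover have "(\<lambda>i. E (binaryset B C i) x) sums (\<Sum>i\<in>{0, 1}. E (binaryset B C i) x)"
    by (rule sums_finite) (auto simp: binaryset_def proj_empty)
  ultimately have "E (\<Union>i. binaryset B C i) x = (\<Sum>i\<in>{0, 1}. E (binaryset B C i) x)"
    by (rule sums_unique2)
  then show ?thesis by (simp add: UN_binaryset_eq) (simp add: binaryset_def)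
qed

lemma proj_Compl: "B \<in> sets borel \<Longrightarrow> E (- B) x = x - E B x"
  using proj_Un[of B "- B" x] by (simp add: proj_UNIV) (metis add_diff_cancel_left')

text \<open>If $y = E(C)y$, then $\|E(B)y\|^2+\|y\|^2 = \langle E(B\cup C)y,y\rangle \le \|y\|^2$.\<close>

lemma proj_disjoint:
  assumes B: "B \<in> sets borel" and C: "C \<in> sets borel" and "B \<inter> C = {}"
  shows "E B (E C x) = 0"
proof -
  define y where "y = E C x"
  have y: "E C y = y" using C by (simp add: y_def proj_idem)
  have BC: "B \<union> C \<in> sets borel" using B C by simp
  have "(norm (E B y))\<^sup>2 + (norm y)\<^sup>2 = (norm (E (B \<union> C) y))\<^sup>2"
    using inner_proj[OF BC, of y] inner_proj[OF B, of y]
    by (simp add: proj_Un[OF B C \<open>B \<inter> C = {}\<close>] y inner_add_left power2_norm_eq_inner)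
  also have "\<dots> \<le> (norm y)\<^sup>2"
  proof -
    have "(norm (E (B \<union> C) y))\<^sup>2 \<le> norm (E (B \<union> C) y) * norm y"
      using inner_proj[OF BC, of y] norm_cauchy_schwarz[of "E (B \<union> C) y" y] by simp
    then have "norm (E (B \<union> C) y) \<le> norm y"
      by (cases "norm (E (B \<union> C) y) = 0") (auto simp: power2_eq_square)
    then show ?thesis by (simp add: power_mono)
  qed
  finally show ?thesis by (simp add: y_def)
qed

lemma proj_Int:
  assumes B: "B \<in> sets borel" and C: "C \<in> sets borel"
  shows "E B (E C x) = E (B \<inter> C) x"
proof -
  have *: "E C x = E (B \<inter> C) x + E (C - B) x"
    using proj_Un[of "B \<inter> C" "C - B" x] B C by (simp add: Int_Diff_disjoint Un_Diff_Int inf_commute)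
       (metis Int_Diff_Un Int_Diff_disjoint inf_commute)
  have **: "E B y = E (B \<inter> C) y + E (B - C) y" for y
    using proj_Un[of "B \<inter> C" "B - C" y] B C by (metis Int_Diff_Un Int_Diff_disjoint sets.Diff sets.Int)
  have "E B (E C x) = E B (E (B \<inter> C) x)"
    unfolding * using B C by (simp add: proj_add proj_disjoint)
  also have "\<dots> = E (B \<inter> C) (E (B \<inter> C) x) + E (B - C) (E (B \<inter> C) x)"
    by (rule **)
  also have "\<dots> = E (B \<inter> C) x"
    using B C by (simp add: proj_idem proj_disjoint Diff_Int_distrib2)
  finally show ?thesis .
qed

lemma inner_proj_disjoint:
  assumes "B \<in> sets borel" "C \<in> sets borel" "B \<inter> C = {}"
  shows "inner (E B x) (E C y) = 0"
  using proj_disjoint[of C B x] assms by (metis inf_commute inner_zero_left proj_sym inner_commute)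

lemma sets_scalar_measure [measurable_cong, simp]: "sets (scalar_measure E x) = sets borel"
  unfolding scalar_measure_def by (metis sets.sigma_sets_eq sets_measure_of space_borel subset_UNIV Pow_UNIV)

lemma space_scalar_measure [simp]: "space (scalar_measure E x) = UNIV"
  using sets_eq_imp_space_eq[OF sets_scalar_measure] by simp

lemma emeasure_scalar_measure:
  assumes "B \<in> sets borel"
  shows "emeasure (scalar_measure E x) B = ennreal ((norm (E B x))\<^sup>2)"
proof -
  have "emeasure (scalar_measure E x) B = ennreal (inner (E B x) x)"
  proof (rule emeasure_measure_of[OF scalar_measure_def])
    show "sets borel \<subseteq> Pow (UNIV :: real set)" by simp
    show "B \<in> sets (scalar_measure E x)" using assms by simp
    show "positive (sets (scalar_measure E x)) (\<lambda>B. ennreal (inner (E B x) x))"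
      by (simp add: positive_def proj_empty)
    show "countably_additive (sets (scalar_measure E x)) (\<lambda>B. ennreal (inner (E B x) x))"
    proof (rule countably_additiveI, unfold sets_scalar_measure)
      fix A :: "nat \<Rightarrow> real set"
      assume A: "range A \<subseteq> sets borel" "disjoint_family A"
      have "(\<lambda>i. inner (E (A i) x) x) sums inner (E (\<Union>i. A i) x) x"
        by (rule bounded_linear.sums[OF bounded_linear_inner_left proj_sums[OF A]])
      moreover have "0 \<le> inner (E (A i) x) x" for i
        using A(1) by (subst inner_proj) auto
      ultimately show "(\<Sum>i. ennreal (inner (E (A i) x) x)) = ennreal (inner (E (\<Union>i. A i) x) x)"
        by (intro suminf_ennreal_eq)
    qed
  qed
  then show ?thesis by (simp add: inner_proj[OF assms])
qed

lemma finite_measure_scalar_measure: "finite_measure (scalar_measure E x)"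
  by (rule finite_measureI) (simp add: emeasure_scalar_measure)

lemma measure_scalar_measure: "B \<in> sets borel \<Longrightarrow> measure (scalar_measure E x) B = (norm (E B x))\<^sup>2"
  by (simp add: measure_def emeasure_scalar_measure)

text \<open>For every $C$ the vectors $E(C)E(B)x$ and $E(C)E(-B)x$ are orthogonal, so that the measures of the two
  components add up.\<close>

lemma scalar_measure_combination:
  assumes B: "B \<in> sets borel"
  shows "scalar_measure E (a *\<^sub>R E B x + b *\<^sub>R E (- B) x) =
    density (scalar_measure E x) (\<lambda>l. ennreal (if l \<in> B then a\<^sup>2 else b\<^sup>2))" (is "scalar_measure E ?v = ?D")
proof (rule measure_eqI)
  show "sets (scalar_measure E ?v) = sets ?D" by simp
  fix C assume "C \<in> sets (scalar_measure E ?v)"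
  then have C: "C \<in> sets borel" by simp
  have [measurable]: "B \<in> sets borel" "C \<in> sets borel" by fact+
  have "emeasure ?D C = (\<integral>\<^sup>+l. ennreal (if l \<in> B then a\<^sup>2 else b\<^sup>2) * indicator C l \<partial>scalar_measure E x)"
    using C by (subst emeasure_density) auto
  also have "\<dots> = (\<integral>\<^sup>+l. ennreal (a\<^sup>2) * indicator (B \<inter> C) l + ennreal (b\<^sup>2) * indicator (C - B) l \<partial>scalar_measure E x)"
    by (intro nn_integral_cong) (auto simp: indicator_def)
  also have "\<dots> = ennreal (a\<^sup>2) * ennreal ((norm (E (B \<inter> C) x))\<^sup>2) + ennreal (b\<^sup>2) * ennreal ((norm (E (C - B) x))\<^sup>2)"
    using B C by (simp add: nn_integral_add nn_integral_cmult emeasure_scalar_measure)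
  also have "\<dots> = ennreal (a\<^sup>2 * (norm (E (B \<inter> C) x))\<^sup>2 + b\<^sup>2 * (norm (E (C - B) x))\<^sup>2)"
    by (simp add: ennreal_mult ennreal_plus)
  also have "a\<^sup>2 * (norm (E (B \<inter> C) x))\<^sup>2 + b\<^sup>2 * (norm (E (C - B) x))\<^sup>2 = (norm (E C ?v))\<^sup>2"
  proof -
    have "E C ?v = a *\<^sub>R E (B \<inter> C) x + b *\<^sub>R E (C - B) x"
      using B C by (simp add: proj_add proj_scaleR proj_Int inf_commute Diff_eq)
    moreover have "orthogonal (a *\<^sub>R E (B \<inter> C) x) (b *\<^sub>R E (C - B) x)"
      using B C inner_proj_disjoint[of "B \<inter> C" "C - B" x x] by (auto simp: orthogonal_def)
    ultimately show ?thesis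
      by (simp add: norm_add_Pythagorean power_mult_distrib)
  qed
  finally show "emeasure (scalar_measure E ?v) C = emeasure ?D C"
    by (simp add: emeasure_scalar_measure[OF C])
qed

lemma scalar_measure_proj:
  assumes B: "B \<in> sets borel"
  shows "scalar_measure E (E B x) = density (scalar_measure E x) (\<lambda>l. ennreal (indicator B l))"
proof -
  have "scalar_measure E (E B x) = density (scalar_measure E x) (\<lambda>l. ennreal (if l \<in> B then 1\<^sup>2 else 0\<^sup>2))"
    using scalar_measure_combination[OF B, of 1 x 0] by simp
  also have "\<dots> = density (scalar_measure E x) (\<lambda>l. ennreal (indicator B l))"
    by (intro arg_cong[where f = "density _"]) auto
  finally show ?thesis .
qed

lemma integrable_if_spectral_dom:
  assumes [measurable]: "\<phi> \<in> borel_measurable borel" and x: "x \<in> spectral_dom E \<phi>"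
  shows "integrable (scalar_measure E x) \<phi>"
proof -
  interpret finite_measure "scalar_measure E x" by (rule finite_measure_scalar_measure)
  have "integrable (scalar_measure E x) (\<lambda>l. (\<phi> l)\<^sup>2)"
    using x by (intro integrableI_nonneg) (auto simp: spectral_dom_def)
  then have "integrable (scalar_measure E x) (\<lambda>l. 1 + (\<phi> l)\<^sup>2)" by simp
  then show ?thesis
  proof (rule Bochner_Integration.integrable_bound)
    have "\<bar>t\<bar> \<le> 1 + t\<^sup>2" for t :: real
      using sum_squares_bound[of 1 "\<bar>t\<bar>"] abs_ge_zero[of t] unfolding power2_abs by simp
    then show "AE l in scalar_measure E x. norm (\<phi> l) \<le> norm (1 + (\<phi> l)\<^sup>2)" by simp
  qed simp
qed

text \<open>Testing the defining identity against $z = E(B)u$ gives $\kappa\mu_u(B) = \int_B l\,d\mu_u(l)$ for every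
  Borel set $B$, so that $l = \kappa$ holds $\mu_u$-almost everywhere.\<close>

lemma proj_eigenvector:
  assumes u: "(u, \<kappa> *\<^sub>R u) \<in> spectral_integral E (\<lambda>l. l)"
  shows "E {\<kappa>} u = u"
proof -
  let ?\<mu> = "scalar_measure E u"
  interpret finite_measure ?\<mu> by (rule finite_measure_scalar_measure)
  have dom: "u \<in> spectral_dom E (\<lambda>l. l)" using u by (simp add: spectral_integral_def)
  have int: "integrable ?\<mu> (\<lambda>l. l)" by (rule integrable_if_spectral_dom[OF _ dom]) simp
  have null: "(\<integral>l. indicator B l * (l - \<kappa>) \<partial>?\<mu>) = 0" if B[measurable]: "B \<in> sets borel" for B
  proof -
    define a where "a = E B u"
    have split: "u = E B u + E (- B) u" using proj_Compl[OF B, of u] by simp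
    have plus: "u + a = 2 *\<^sub>R E B u + 1 *\<^sub>R E (- B) u"
      by (subst split) (simp add: a_def scaleR_2)
    have minus: "u - a = 0 *\<^sub>R E B u + 1 *\<^sub>R E (- B) u"
      by (subst split) (simp add: a_def)
    have int_plus: "(\<integral>l. l \<partial>scalar_measure E (u + a)) = (\<integral>l. (if l \<in> B then 4 else 1) * l \<partial>?\<mu>)"
      unfolding plus scalar_measure_combination[OF B] by (subst integral_density) (auto intro!: Bochner_Integration.integral_cong)
    have int_minus: "(\<integral>l. l \<partial>scalar_measure E (u - a)) = (\<integral>l. (if l \<in> B then 0 else 1) * l \<partial>?\<mu>)"
      unfolding minus scalar_measure_combination[OF B] by (subst integral_density) (auto intro!: Bochner_Integration.integral_cong)
    have "a \<in> spectral_dom E (\<lambda>l. l)"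
    proof -
      have "(\<integral>\<^sup>+l. ennreal (l\<^sup>2) \<partial>scalar_measure E a) = (\<integral>\<^sup>+l. ennreal (indicator B l) * ennreal (l\<^sup>2) \<partial>?\<mu>)"
        unfolding a_def scalar_measure_proj[OF B] by (subst nn_integral_density) auto
      also have "\<dots> \<le> (\<integral>\<^sup>+l. ennreal (l\<^sup>2) \<partial>?\<mu>)"
        by (intro nn_integral_mono) (auto simp: indicator_def)
      also have "\<dots> < \<infinity>" using dom by (simp add: spectral_dom_def)
      finally show ?thesis by (simp add: spectral_dom_def)
    qed
    then have "inner (\<kappa> *\<^sub>R u) a = ((\<integral>l. l \<partial>scalar_measure E (u + a)) - (\<integral>l. l \<partial>scalar_measure E (u - a))) / 4"
      using u by (simp add: spectral_integral_def)
    also have "\<dots> = ((\<integral>l. (if l \<in> B then 4 else 1) * l \<partial>?\<mu>) - (\<integral>l. (if l \<in> B then 0 else 1) * l \<partial>?\<mu>)) / 4"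
      by (simp only: int_plus int_minus)
    also have "(\<integral>l. (if l \<in> B then 4 else 1) * l \<partial>?\<mu>) - (\<integral>l. (if l \<in> B then 0 else 1) * l \<partial>?\<mu>) =
        (\<integral>l. (if l \<in> B then 4 else 1) * l - (if l \<in> B then 0 else 1) * l \<partial>?\<mu>)"
      by (rule Bochner_Integration.integral_diff[symmetric];
          rule Bochner_Integration.integrable_bound[OF integrable_mult_right[OF int, of 4]]) auto
    also have "\<dots> = (\<integral>l. 4 * (indicator B l * l) \<partial>?\<mu>)"
      by (rule Bochner_Integration.integral_cong) (auto simp: indicator_def)
    finally have "\<kappa> * (norm (E B u))\<^sup>2 = (\<integral>l. indicator B l * l \<partial>?\<mu>)"
      using inner_proj[OF B, of u] by (simp add: a_def inner_commute)
    moreover have "integrable ?\<mu> (\<lambda>l. indicator B l * l)"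
      by (rule Bochner_Integration.integrable_bound[OF int]) (auto simp: indicator_def)
    moreover have "integrable ?\<mu> (\<lambda>l. indicator B l * \<kappa>)"
      by (rule integrable_mult_left) (simp add: emeasure_scalar_measure[OF B] integrable_indicator_iff)
    moreover have "(\<integral>l. indicator B l * \<kappa> \<partial>?\<mu>) = \<kappa> * (norm (E B u))\<^sup>2"
      by (simp add: measure_scalar_measure[OF B])
    ultimately show ?thesis
      by (simp add: right_diff_distrib)
  qed
  have zero: "E B u = 0" if B: "B \<in> sets borel" and sgn: "\<And>l. l \<in> B \<Longrightarrow> 0 < c * (l - \<kappa>)" for B c
  proof -
    have [measurable]: "B \<in> sets borel" by fact
    have "(\<integral>l. indicator B l * (c * (l - \<kappa>)) \<partial>?\<mu>) = 0"
      using null[OF B] by (simp add: mult.left_commute)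
    moreover have "integrable ?\<mu> (\<lambda>l. indicator B l * (c * (l - \<kappa>)))"
    proof (rule Bochner_Integration.integrable_bound)
      show "integrable ?\<mu> (\<lambda>l. c * (l - \<kappa>))"
        by (intro integrable_mult_right Bochner_Integration.integrable_diff int) simp
      show "(\<lambda>l. indicator B l * (c * (l - \<kappa>))) \<in> borel_measurable ?\<mu>" by measurable
    qed (auto simp: indicator_def)
    moreover have "0 \<le> indicator B l * (c * (l - \<kappa>))" for l
      using sgn[of l] by (cases "l \<in> B") (auto simp: less_imp_le)
    ultimately have "AE l in ?\<mu>. indicator B l * (c * (l - \<kappa>)) = 0"
      by (subst (asm) integral_nonneg_eq_0_iff_AE) auto
    then have "AE l in ?\<mu>. l \<notin> B"
      by eventually_elim (use sgn in \<open>force simp: indicator_def split: if_splits\<close>)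
    then have "emeasure ?\<mu> B = 0"
      using B by (subst (asm) AE_iff_measurable[of B]) auto
    then show ?thesis by (simp add: emeasure_scalar_measure[OF B])
  qed
  have "E {..<\<kappa>} u = 0" by (rule zero[of _ "-1"]) auto
  moreover have "E {\<kappa><..} u = 0" by (rule zero[of _ 1]) auto
  moreover have "- {\<kappa>} = {..<\<kappa>} \<union> {\<kappa><..}" by auto
  then have "E (- {\<kappa>}) u = E {..<\<kappa>} u + E {\<kappa><..} u" using proj_Un[of "{..<\<kappa>}" "{\<kappa><..}" u] by force
  ultimately show ?thesis using proj_Compl[of "{\<kappa>}" u] by simp
qed

text \<open>Adding $u \in \operatorname{ran}E(\{\kappa\})$ to $x$ changes the scalar measure of $x$ only at $\kappa$, and the
  mass there changes by polarization of $\|E(\{\kappa\})x \pm u\|^2$.\<close>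

lemma spectral_integral_coord:
  assumes u: "E {\<kappa>} u = u" and \<phi>[measurable]: "\<phi> \<in> borel_measurable borel"
    and xy: "(x, y) \<in> spectral_integral E \<phi>"
  shows "inner y u = \<phi> \<kappa> * inner x u"
proof -
  define B where "B = {\<kappa>}"
  have B[measurable]: "B \<in> sets borel" "- B \<in> sets borel" by (auto simp: B_def)
  have split: "v = E B v + E (- B) v" for v using proj_Compl[OF B(1), of v] by simp
  have x: "x \<in> spectral_dom E \<phi>" using xy by (simp add: spectral_integral_def)
  have comp_u: "E (- B) u = 0" using proj_Compl[OF B(1), of u] u by (simp add: B_def)
  note dens = scalar_measure_proj[OF B(2)]
  have u_dom: "u \<in> spectral_dom E \<phi>"
  proof -
    have "scalar_measure E u = scalar_measure E (E B u)"
      by (simp add: B_def u)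
    then have "(\<integral>\<^sup>+l. ennreal ((\<phi> l)\<^sup>2) \<partial>scalar_measure E u) =
        (\<integral>\<^sup>+l. ennreal ((\<phi> l)\<^sup>2) \<partial>density (scalar_measure E u) (\<lambda>l. ennreal (indicator B l)))"
      by (simp only: scalar_measure_proj[OF B(1)])
    also have "\<dots> = (\<integral>\<^sup>+l. ennreal (indicator B l) * ennreal ((\<phi> l)\<^sup>2) \<partial>scalar_measure E u)"
      by (subst nn_integral_density) auto
    also have "\<dots> = (\<integral>\<^sup>+l. ennreal ((\<phi> \<kappa>)\<^sup>2) * indicator B l \<partial>scalar_measure E u)"
      by (intro nn_integral_cong) (auto simp: B_def indicator_def)
    also have "\<dots> < \<infinity>"
      by (subst nn_integral_cmult_indicator) (auto simp: emeasure_scalar_measure[OF B(1)] ennreal_mult_less_top)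
    finally show ?thesis by (simp add: spectral_dom_def)
  qed
  have int_v: "(\<integral>l. \<phi> l \<partial>scalar_measure E v) = \<phi> \<kappa> * (norm (E B v))\<^sup>2 + (\<integral>l. \<phi> l \<partial>scalar_measure E (E (- B) x))"
    if v: "E (- B) v = E (- B) x" for v
  proof -
    interpret v: finite_measure "scalar_measure E v" by (rule finite_measure_scalar_measure)
    have "integrable (scalar_measure E x) (\<lambda>l. indicator (- B) l * \<phi> l)"
      by (rule Bochner_Integration.integrable_bound[OF integrable_if_spectral_dom[OF \<phi> x]])
         (auto simp: indicator_def)
    then have "integrable (density (scalar_measure E x) (\<lambda>l. ennreal (indicator (- B) l))) \<phi>"
      by (subst integrable_density) auto
    then have "integrable (density (scalar_measure E v) (\<lambda>l. ennreal (indicator (- B) l))) \<phi>"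
      by (simp add: v flip: dens)
    then have int2: "integrable (scalar_measure E v) (\<lambda>l. indicator (- B) l * \<phi> l)"
      by (subst (asm) integrable_density) auto
    have int1: "integrable (scalar_measure E v) (\<lambda>l. indicator B l * \<phi> \<kappa>)"
      by (rule integrable_mult_left) (simp add: emeasure_scalar_measure[OF B(1)] integrable_indicator_iff)
    have "(\<integral>l. \<phi> l \<partial>scalar_measure E v) = (\<integral>l. indicator B l * \<phi> \<kappa> + indicator (- B) l * \<phi> l \<partial>scalar_measure E v)"
      by (rule Bochner_Integration.integral_cong) (auto simp: indicator_def B_def)
    also have "\<dots> = \<phi> \<kappa> * (norm (E B v))\<^sup>2 + (\<integral>l. indicator (- B) l * \<phi> l \<partial>scalar_measure E v)"
      by (subst Bochner_Integration.integral_add[OF int1 int2]) (simp add: measure_scalar_measure[OF B(1)])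
    also have "(\<integral>l. indicator (- B) l * \<phi> l \<partial>scalar_measure E v) = (\<integral>l. \<phi> l \<partial>scalar_measure E (E (- B) v))"
      unfolding dens by (subst integral_density) auto
    finally show ?thesis by (simp only: v)
  qed
  have "inner y u = ((\<integral>l. \<phi> l \<partial>scalar_measure E (x + u)) - (\<integral>l. \<phi> l \<partial>scalar_measure E (x - u))) / 4"
    using xy u_dom by (simp add: spectral_integral_def)
  also have "\<dots> = \<phi> \<kappa> * ((norm (E B x + u))\<^sup>2 - (norm (E B x - u))\<^sup>2) / 4"
    using u B by (simp add: int_v proj_add proj_diff comp_u) (simp add: B_def right_diff_distrib)
  also have "(norm (E B x + u))\<^sup>2 - (norm (E B x - u))\<^sup>2 = 4 * inner (E B x) u"
    by (simp add: power2_norm_eq_inner inner_add_left inner_add_right inner_diff_left inner_diff_right inner_commute)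
  also have "inner (E B x) u = inner x u"
    using u proj_sym[OF B(1), of x u] by (simp add: B_def)
  finally show ?thesis by simp
qed

end

section \<open>Functional calculus of a diagonal operator\<close>

context orthonormal_basis
begin

text \<open>The spectral measure of the operator with eigenvalues $\lambda_i$ at $e_i$.\<close>

definition eigen_projection :: "(nat \<Rightarrow> real) \<Rightarrow> real set \<Rightarrow> 'h \<Rightarrow> 'h" where
  "eigen_projection lam B = diag (\<lambda>i. indicator B (lam i))"

lemma inner_eigen_projection: "inner (eigen_projection lam B x) (e i) = indicator B (lam i) * inner x (e i)"
  unfolding eigen_projection_def by (rule inner_diag[where M = 1]) simp

lemma bounded_linear_eigen_projection: "bounded_linear (eigen_projection lam B)"
  unfolding eigen_projection_def by (rule bounded_linear_diag[where M = 1]) simp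

lemma norm_eigen_projection_le: "norm (eigen_projection lam B x) \<le> norm x"
  unfolding eigen_projection_def using norm_diag_le[of "\<lambda>i. indicator B (lam i)" 1 x] by simp

text \<open>The summands are orthogonal and bounded by $x$, so that the series converges; its sum is found
  coordinate by coordinate.\<close>

lemma eigen_projection_sums:
  assumes disj: "disjoint_family B"
  shows "(\<lambda>i. eigen_projection lam (B i) x) sums eigen_projection lam (\<Union>i. B i) x"
proof -
  define v where "v i = eigen_projection lam (B i) x" for i
  have orth_v: "inner (v i) (v j) = 0" if "i \<noteq> j" for i j
  proof -
    have "inner (v i) (e k) * inner (v j) (e k) = 0" for k
      using disj that by (auto simp: v_def inner_eigen_projection disjoint_family_on_def indicator_def)
    then have "(\<lambda>k. inner (v i) (e k) * inner (v j) (e k)) = (\<lambda>k. 0)" by (rule ext)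
    then show ?thesis
      using parseval[of "v i" "v j"] sums_unique2[OF _ sums_zero] by simp
  qed
  have partial: "(\<Sum>i<n. v i) = eigen_projection lam (\<Union>i<n. B i) x" for n
  proof (rule eq_by_coords)
    fix k
    have "(indicator (\<Union>i<n. B i) (lam k) :: real) = (\<Sum>i<n. indicator (B i) (lam k))"
      using disj by (intro indicator_UN_disjoint) (auto simp: disjoint_family_on_def)
    then show "inner (\<Sum>i<n. v i) (e k) = inner (eigen_projection lam (\<Union>i<n. B i) x) (e k)"
      by (simp add: inner_sum_left v_def inner_eigen_projection sum_distrib_right)
  qed
  have "summable (\<lambda>i. (norm (v i))\<^sup>2)"
  proof (rule summableI_nonneg_bounded)
    fix n
    have "(\<Sum>i<n. (norm (v i))\<^sup>2) = (norm (\<Sum>i<n. v i))\<^sup>2"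
      using orth_v by (intro norm_sum_Pythagorean[symmetric]) (auto simp: pairwise_def orthogonal_def)
    also have "\<dots> \<le> (norm x)\<^sup>2"
      unfolding partial by (intro power_mono norm_eigen_projection_le) simp
    finally show "(\<Sum>i<n. (norm (v i))\<^sup>2) \<le> (norm x)\<^sup>2" .
  qed simp
  then have "summable v" by (rule summable_orthogonal[rotated]) (rule orth_v)
  then have sums: "v sums (\<Sum>i. v i)" by (rule summable_sums)
  have "(\<Sum>i. v i) = eigen_projection lam (\<Union>i. B i) x"
  proof (rule eq_by_coords)
    fix k
    have "(\<lambda>i. inner (v i) (e k)) sums inner (\<Sum>i. v i) (e k)"
      by (rule bounded_linear.sums[OF bounded_linear_inner_left sums])
    moreover have "(\<lambda>i. indicator (B i) (lam k) * inner x (e k)) sums (indicator (\<Union>i. B i) (lam k) * inner x (e k))"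
      using disj by (intro sums_mult2 indicator_sums) (auto simp: disjoint_family_on_def)
    ultimately show "inner (\<Sum>i. v i) (e k) = inner (eigen_projection lam (\<Union>i. B i) x) (e k)"
      by (simp add: v_def inner_eigen_projection sums_unique2)
  qed
  with sums show ?thesis by (simp add: v_def[abs_def])
qed

lemma projection_valued_measure_eigen_projection: "projection_valued_measure (eigen_projection lam)"
  unfolding projection_valued_measure_def
proof (intro conjI ballI allI impI)
  fix B
  show "bounded_linear (eigen_projection lam B)" by (rule bounded_linear_eigen_projection)
  show "eigen_projection lam B \<circ> eigen_projection lam B = eigen_projection lam B"
    by (intro ext eq_by_coords) (simp add: inner_eigen_projection indicator_def)
  show "inner (eigen_projection lam B x) y = inner x (eigen_projection lam B y)" for x y
    unfolding eigen_projection_def by (rule inner_diag_symmetric[where M = 1]) simp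
next
  show "eigen_projection lam UNIV = id"
    by (intro ext eq_by_coords) (simp add: inner_eigen_projection)
qed (rule eigen_projection_sums)

sublocale eigen: spectral_resolution "eigen_projection lam" for lam
  by unfold_locales (rule projection_valued_measure_eigen_projection)

lemma eigen_projection_basis: "eigen_projection lam {lam i} (e i) = e i"
proof (rule eq_by_coords)
  show "inner (eigen_projection lam {lam i} (e i)) (e j) = inner (e i) (e j)" for j
    using orth[of i j] by (cases "i = j") (auto simp: inner_eigen_projection)
qed

lemma scalar_measure_eigen_projection:
  "scalar_measure (eigen_projection lam) x =
    distr (density (count_space UNIV) (\<lambda>i. ennreal ((inner x (e i))\<^sup>2))) borel lam" (is "_ = ?D")
proof (rule measure_eqI)
  fix B assume "B \<in> sets (scalar_measure (eigen_projection lam) x)"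
  then have B[measurable]: "B \<in> sets borel" by simp
  have "emeasure ?D B = (\<integral>\<^sup>+i. ennreal ((inner x (e i))\<^sup>2) * indicator (lam -` B) i \<partial>count_space UNIV)"
    by (simp add: emeasure_distr emeasure_density)
  also have "\<dots> = (\<Sum>i. ennreal ((inner (eigen_projection lam B x) (e i))\<^sup>2))"
    by (simp add: nn_integral_count_space_nat inner_eigen_projection)
       (intro suminf_cong, auto simp: indicator_def)
  also have "\<dots> = ennreal ((norm (eigen_projection lam B x))\<^sup>2)"
    by (rule suminf_ennreal_eq[OF _ parseval_norm]) simp
  finally show "emeasure (scalar_measure (eigen_projection lam) x) B = emeasure ?D B"
    by (simp add: eigen.emeasure_scalar_measure[OF B])
qed simp

lemma spectral_dom_eigen_projection:
  assumes [measurable]: "\<phi> \<in> borel_measurable borel"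
  shows "x \<in> spectral_dom (eigen_projection lam) \<phi> \<longleftrightarrow> summable (\<lambda>i. (\<phi> (lam i) * inner x (e i))\<^sup>2)"
proof -
  have "(\<integral>\<^sup>+l. ennreal ((\<phi> l)\<^sup>2) \<partial>scalar_measure (eigen_projection lam) x) =
      (\<Sum>i. ennreal ((\<phi> (lam i) * inner x (e i))\<^sup>2))"
    unfolding scalar_measure_eigen_projection
    by (simp add: nn_integral_distr nn_integral_density nn_integral_count_space_nat
        power_mult_distrib ennreal_mult mult.commute)
  moreover have "(\<Sum>i. ennreal ((\<phi> (lam i) * inner x (e i))\<^sup>2)) < \<infinity> \<longleftrightarrow>
      summable (\<lambda>i. (\<phi> (lam i) * inner x (e i))\<^sup>2)"
  proof
    assume "(\<Sum>i. ennreal ((\<phi> (lam i) * inner x (e i))\<^sup>2)) < \<infinity>"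
    then show "summable (\<lambda>i. (\<phi> (lam i) * inner x (e i))\<^sup>2)"
      by (intro summable_suminf_not_top) auto
  next
    assume "summable (\<lambda>i. (\<phi> (lam i) * inner x (e i))\<^sup>2)"
    then show "(\<Sum>i. ennreal ((\<phi> (lam i) * inner x (e i))\<^sup>2)) < \<infinity>"
      by (subst suminf_ennreal2) auto
  qed
  ultimately show ?thesis by (simp add: spectral_dom_def)
qed

lemma integral_eigen_projection:
  assumes [measurable]: "\<phi> \<in> borel_measurable borel"
    and x: "x \<in> spectral_dom (eigen_projection lam) \<phi>"
  shows "(\<lambda>i. \<phi> (lam i) * (inner x (e i))\<^sup>2) sums (\<integral>l. \<phi> l \<partial>scalar_measure (eigen_projection lam) x)"
proof -
  have eq: "(\<integral>l. \<phi> l \<partial>scalar_measure (eigen_projection lam) x) =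
      (\<integral>i. \<phi> (lam i) * (inner x (e i))\<^sup>2 \<partial>count_space UNIV)"
    unfolding scalar_measure_eigen_projection
    by (subst integral_distr, simp, simp, subst integral_density) (auto simp: mult.commute)
  have "integrable (scalar_measure (eigen_projection lam) x) \<phi>"
    by (rule eigen.integrable_if_spectral_dom[OF assms])
  then have "integrable (count_space UNIV) (\<lambda>i. \<phi> (lam i) * (inner x (e i))\<^sup>2)"
    unfolding scalar_measure_eigen_projection
    by (subst (asm) integrable_distr_eq, simp, simp, subst (asm) integrable_density) (auto simp: mult.commute)
  then show ?thesis
    unfolding eq by (rule sums_integral_count_space_nat)
qed

text \<open>For the inclusion from right to left, the integrals are sums over the basis; polarizing each term gives
  $4\langle y,e_i\rangle\langle z,e_i\rangle$, and these add up to $4\langle y,z\rangle$.\<close>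

lemma spectral_integral_eigen_projection:
  assumes \<phi>: "\<phi> \<in> borel_measurable borel"
  shows "spectral_integral (eigen_projection lam) \<phi> = {(x, y). \<forall>i. inner y (e i) = \<phi> (lam i) * inner x (e i)}"
proof (intro set_eqI iffI, safe)
  fix x y i assume "(x, y) \<in> spectral_integral (eigen_projection lam) \<phi>"
  then show "inner y (e i) = \<phi> (lam i) * inner x (e i)"
    by (rule eigen.spectral_integral_coord[OF eigen_projection_basis \<phi>])
next
  fix x y assume xy: "\<forall>i. inner y (e i) = \<phi> (lam i) * inner x (e i)"
  then have x: "x \<in> spectral_dom (eigen_projection lam) \<phi>"
    using summable_square_coords[of y] by (simp add: spectral_dom_eigen_projection[OF \<phi>])
  have "inner y z = ((\<integral>l. \<phi> l \<partial>scalar_measure (eigen_projection lam) (x + z)) -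
      (\<integral>l. \<phi> l \<partial>scalar_measure (eigen_projection lam) (x - z))) / 4"
    if z: "z \<in> spectral_dom (eigen_projection lam) \<phi>" for z
  proof -
    have comb: "x + t *\<^sub>R z \<in> spectral_dom (eigen_projection lam) \<phi>" if "\<bar>t\<bar> = 1" for t
      unfolding spectral_dom_eigen_projection[OF \<phi>]
    proof (rule summable_comparison_test')
      show "summable (\<lambda>i. 2 * (\<phi> (lam i) * inner x (e i))\<^sup>2 + 2 * (\<phi> (lam i) * inner z (e i))\<^sup>2)"
        using x z by (intro summable_add summable_mult) (simp_all add: spectral_dom_eigen_projection[OF \<phi>])
      have sq: "(a + t * b)\<^sup>2 \<le> 2 * a\<^sup>2 + 2 * b\<^sup>2" for a b :: real
      proof -
        have "0 \<le> (a - t * b)\<^sup>2" by simp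
        moreover have "t\<^sup>2 = 1" using that by (metis one_power2 power2_abs)
        ultimately show ?thesis by (simp add: power2_sum power2_diff power_mult_distrib)
      qed
      show "norm ((\<phi> (lam i) * inner (x + t *\<^sub>R z) (e i))\<^sup>2) \<le>
          2 * (\<phi> (lam i) * inner x (e i))\<^sup>2 + 2 * (\<phi> (lam i) * inner z (e i))\<^sup>2" for i
        using sq[of "\<phi> (lam i) * inner x (e i)" "\<phi> (lam i) * inner z (e i)"]
        by (simp add: inner_add_left algebra_simps)
    qed
    have "(\<lambda>i. \<phi> (lam i) * (inner (x + z) (e i))\<^sup>2 - \<phi> (lam i) * (inner (x - z) (e i))\<^sup>2) sums
        ((\<integral>l. \<phi> l \<partial>scalar_measure (eigen_projection lam) (x + z)) -
         (\<integral>l. \<phi> l \<partial>scalar_measure (eigen_projection lam) (x - z)))"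
      using comb[of 1] comb[of "-1"] by (intro sums_diff integral_eigen_projection \<phi>) simp_all
    moreover have "(\<lambda>i. \<phi> (lam i) * (inner (x + z) (e i))\<^sup>2 - \<phi> (lam i) * (inner (x - z) (e i))\<^sup>2) =
        (\<lambda>i. 4 * (inner y (e i) * inner z (e i)))"
      using xy by (simp add: inner_add_left inner_diff_left power2_eq_square algebra_simps)
    ultimately have "((\<integral>l. \<phi> l \<partial>scalar_measure (eigen_projection lam) (x + z)) -
         (\<integral>l. \<phi> l \<partial>scalar_measure (eigen_projection lam) (x - z))) = 4 * inner y z"
      using sums_unique2[OF _ sums_mult[OF parseval[of y z], of 4]] by metis
    then show ?thesis by simp
  qed
  with x show "(x, y) \<in> spectral_integral (eigen_projection lam) \<phi>"
    by (simp add: spectral_integral_def)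
qed

text \<open>For any spectral measure $E$ of the operator, $E(\{\lambda_i\})$ fixes $e_i$, which determines the $i$-th
  coordinate of the value at $x$.\<close>

lemma functional_calculus_diag:
  assumes A: "A = {(x, y). \<forall>i. inner y (e i) = lam i * inner x (e i)}"
    and \<phi>: "\<phi> \<in> borel_measurable borel" and bounded: "\<And>i. \<bar>\<phi> (lam i)\<bar> \<le> M"
  shows "functional_calculus A \<phi> = diag (\<lambda>i. \<phi> (lam i))"
proof
  fix x
  show "functional_calculus A \<phi> x = diag (\<lambda>i. \<phi> (lam i)) x"
    unfolding functional_calculus_def
  proof (rule the_equality)
    have "spectral_integral (eigen_projection lam) (\<lambda>l. l) = A"
      unfolding A by (subst spectral_integral_eigen_projection) auto
    moreover have "(x, diag (\<lambda>i. \<phi> (lam i)) x) \<in> spectral_integral (eigen_projection lam) \<phi>"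
      by (simp add: spectral_integral_eigen_projection[OF \<phi>] inner_diag[OF bounded])
    ultimately show "\<exists>E. projection_valued_measure E \<and> spectral_integral E (\<lambda>l. l) = A \<and>
        (x, diag (\<lambda>i. \<phi> (lam i)) x) \<in> spectral_integral E \<phi>"
      using projection_valued_measure_eigen_projection by blast
  next
    fix y assume "\<exists>E. projection_valued_measure E \<and> spectral_integral E (\<lambda>l. l) = A \<and> (x, y) \<in> spectral_integral E \<phi>"
    then obtain E where "projection_valued_measure E" and EA: "spectral_integral E (\<lambda>l. l) = A"
      and xy: "(x, y) \<in> spectral_integral E \<phi>" by blast
    then interpret E: spectral_resolution E by unfold_locales
    have "inner (lam i *\<^sub>R e i) (e j) = lam j * inner (e i) (e j)" for i j
      using orth[of i j] by (cases "i = j") auto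
    then have "(e i, lam i *\<^sub>R e i) \<in> spectral_integral E (\<lambda>l. l)" for i
      unfolding EA A by blast
    then have "inner y (e i) = \<phi> (lam i) * inner x (e i)" for i
      by (intro E.spectral_integral_coord[OF E.proj_eigenvector \<phi> xy])
    then show "y = diag (\<lambda>i. \<phi> (lam i)) x"
      by (intro eq_by_coords) (simp add: inner_diag[OF bounded])
  qed
qed

end

section \<open>From counting large directions to logarithmic eigenvalue growth\<close>

text \<open>Applying the counting bound to the first $n+1$ eigenvectors of $T$ gives
  $n+1\le A e^{B/s_n}$, hence $s_n = O(1/\log n)$ and, as $\lambda_n = 1/s_n-1$,
  $e^{-t\lambda_n} \le e^t (A/(n+1))^{t/B}$, which is summable for $t>B$.\<close>

theorem logarithmic_growth_if_exponentially_few_large: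
  fixes T :: "'h::{real_inner,banach} \<Rightarrow> 'h"
  assumes T: "positive_operator T" and inj: "\<And>x. T x = 0 \<Longrightarrow> x = 0"
    and A: "1 \<le> A" and B: "0 < B"
    and few: "\<And>\<epsilon> n f. 0 < \<epsilon> \<Longrightarrow> orthonormal_family n f \<Longrightarrow> (\<And>i. i < n \<Longrightarrow> \<epsilon> \<le> inner (T (f i)) (f i)) \<Longrightarrow>
      real n \<le> A * exp (B / \<epsilon>)"
    and \<Delta>: "\<Delta> = {(T f, f - T f) | f. True}"
  shows "compact_operator T"
    and "(\<lambda>n. singular_value T n) \<in> O(\<lambda>n. inverse (ln (real n)))"
    and "\<And>t. B < t \<Longrightarrow> trace_class (functional_calculus \<Delta> (\<lambda>l. exp (- t * l)))"
proof -
  show compact: "compact_operator T"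
  proof (rule compact_operator_if_few_large[OF T])
    fix \<epsilon> :: real assume "0 < \<epsilon>"
    have "n \<le> nat \<lceil>A * exp (B / \<epsilon>)\<rceil>"
      if "orthonormal_family n f" "\<forall>i<n. \<epsilon> \<le> inner (T (f i)) (f i)" for n f
      using few[OF \<open>0 < \<epsilon>\<close> that(1)] that(2) by (simp add: le_nat_iff) linarith
    then show "\<exists>N. \<forall>n f. orthonormal_family n f \<and> (\<forall>i<n. \<epsilon> \<le> inner (T (f i)) (f i)) \<longrightarrow> n \<le> N"
      by blast
  qed
  obtain e s where "orthonormal_basis e" and T_diag: "T = orthonormal_basis.diag e s"
    and s: "decseq s" "s \<longlonglongrightarrow> 0" "\<And>n. s n = 0 \<longleftrightarrow> e n = 0"
    using spectral_theorem_compact_positive[OF compact T inj] by metis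
  then interpret orthonormal_basis e by simp
  have s_nonneg: "0 \<le> s n" for n using decseq_ge[OF s(1,2)] .
  have s_bounded: "\<bar>s n\<bar> \<le> s 0" for n using s(1) s_nonneg by (simp add: decseqD)
  have T_coord: "inner (T x) (e i) = s i * inner x (e i)" for x i
    unfolding T_diag by (rule inner_diag[OF s_bounded])
  have T_basis: "T (e i) = s i *\<^sub>R e i" for i
    unfolding T_diag by (rule diag_basis[OF s_bounded])
  have count: "real (Suc n) \<le> A * exp (B / s n)" if "e n \<noteq> 0" for n
  proof (rule few)
    have "0 < s n" using s(3)[of n] s_nonneg[of n] that by simp
    then have nz: "e i \<noteq> 0" if "i < Suc n" for i
      using decseqD[OF s(1), of i n] that s(3)[of i] by auto
    then show "orthonormal_family (Suc n) e"
      using unit orth by (auto simp: orthonormal_family_def)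
    show "s n \<le> inner (T (e i)) (e i)" if "i < Suc n" for i
    proof -
      have "inner (e i) (e i) = 1" using unit[of i] nz[OF that] by (simp add: norm_eq_1)
      then show ?thesis using decseqD[OF s(1), of i n] that by (simp add: T_basis)
    qed
    show "0 < s n" by fact
  qed
  have sv: "singular_value T n = s (n - 1)" for n
    unfolding T_diag by (rule singular_value_diag[OF s])
  show "(\<lambda>n. singular_value T n) \<in> O(\<lambda>n. inverse (ln (real n)))"
  proof (rule bigoI)
    show "\<forall>\<^sub>F n in sequentially. norm (singular_value T n) \<le> 2 * B * norm (inverse (ln (real n)))"
    proof (rule eventually_sequentiallyI)
      fix n :: nat assume n: "nat \<lceil>A\<^sup>2\<rceil> + 2 \<le> n"
      then have "2 \<le> n" and "A\<^sup>2 \<le> real n" by linarith+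
      then have ln_pos: "0 < ln (real n)" by simp
      show "norm (singular_value T n) \<le> 2 * B * norm (inverse (ln (real n)))"
      proof (cases "e (n - 1) = 0")
        case True
        then have "singular_value T n = 0" using s(3)[of "n - 1"] by (simp add: sv)
        then show ?thesis using B by simp
      next
        case False
        define \<sigma> where "\<sigma> = s (n - 1)"
        have "0 < \<sigma>" using s(3)[of "n - 1"] s_nonneg[of "n - 1"] False by (simp add: \<sigma>_def)
        have "real n \<le> A * exp (B / \<sigma>)" using count[OF False] \<open>2 \<le> n\<close> by (simp add: \<sigma>_def)
        then have "ln (real n) \<le> ln (A * exp (B / \<sigma>))" using \<open>2 \<le> n\<close> A by simp
        also have "\<dots> = ln A + B / \<sigma>" using A by (simp add: ln_mult)
        finally have "ln (real n) \<le> ln A + B / \<sigma>" .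
        moreover have "2 * ln A \<le> ln (real n)"
        proof -
          have "2 * ln A = ln (A\<^sup>2)" using A by (simp add: ln_realpow)
          also have "\<dots> \<le> ln (real n)" using \<open>A\<^sup>2 \<le> real n\<close> \<open>2 \<le> n\<close> A by (subst ln_le_cancel_iff) auto
          finally show ?thesis .
        qed
        ultimately have "ln (real n) \<le> 2 * (B / \<sigma>)" by linarith
        then have "\<sigma> \<le> 2 * B / ln (real n)"
          using \<open>0 < \<sigma>\<close> ln_pos by (simp add: field_simps)
        then show ?thesis
          using \<open>0 < \<sigma>\<close> ln_pos by (simp add: sv \<sigma>_def divide_inverse)
      qed
    qed
  qed
  \<comment> \<open>At a zero vector $s_i = 0$ and the value is $-1$; thus all values are at least $-1$.\<close>
  define lam where "lam i = inverse (s i) - 1" for i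
  have \<Delta>_coord: "\<Delta> = {(x, y). \<forall>i. inner y (e i) = lam i * inner x (e i)}"
  proof (intro set_eqI iffI, safe)
    fix x y i assume "(x, y) \<in> \<Delta>"
    then obtain f where f: "x = T f" "y = f - T f" unfolding \<Delta> by blast
    show "inner y (e i) = lam i * inner x (e i)"
      using s(3)[of i] by (cases "e i = 0") (auto simp: f T_coord lam_def inner_diff_left field_simps)
  next
    fix x y assume xy: "\<forall>i. inner y (e i) = lam i * inner x (e i)"
    have "T (x + y) = x"
    proof (rule eq_by_coords)
      show "inner (T (x + y)) (e i) = inner x (e i)" for i
        using s(3)[of i] xy by (cases "e i = 0") (auto simp: T_coord inner_add_left lam_def field_simps)
    qed
    then show "(x, y) \<in> \<Delta>" unfolding \<Delta> by (auto intro!: exI[of _ "x + y"])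
  qed
  fix t assume t: "B < t"
  then have "0 < t" using B by simp
  \<comment> \<open>Without the entries at zero vectors, this lists the eigenvalues of $e^{-t\Delta}$.\<close>
  define \<tau> where "\<tau> i = (if e i = 0 then 0 else exp (- t * lam i))" for i
  have exp_le: "\<bar>exp (- t * lam i)\<bar> \<le> exp t" for i
    using \<open>0 < t\<close> s_nonneg[of i] by (simp add: lam_def algebra_simps)
  have \<tau>_le: "\<bar>\<tau> i\<bar> \<le> exp t" for i using exp_le[of i] by (auto simp: \<tau>_def)
  have "functional_calculus \<Delta> (\<lambda>l. exp (- t * l)) = diag (\<lambda>i. exp (- t * lam i))"
    by (rule functional_calculus_diag[where M = "exp t", OF \<Delta>_coord]) (simp, rule exp_le)
  also have "\<dots> = diag \<tau>"
  proof (intro ext eq_by_coords)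
    show "inner (diag (\<lambda>i. exp (- t * lam i)) x) (e i) = inner (diag \<tau> x) (e i)" for x i
      unfolding inner_diag[where \<tau> = "\<lambda>i. exp (- t * lam i)", OF exp_le] inner_diag[where \<tau> = \<tau>, OF \<tau>_le]
      by (simp add: \<tau>_def)
  qed
  finally have fc: "functional_calculus \<Delta> (\<lambda>l. exp (- t * l)) = diag \<tau>" .
  have "decseq \<tau>"
  proof (rule decseq_SucI)
    fix n
    show "\<tau> (Suc n) \<le> \<tau> n"
    proof (cases "e (Suc n) = 0")
      case True
      then show ?thesis by (simp add: \<tau>_def)
    next
      case False
      then have "0 < s (Suc n)" using s(3)[of "Suc n"] s_nonneg[of "Suc n"] by simp
      moreover have "s (Suc n) \<le> s n" using s(1) by (simp add: decseqD)
      ultimately have "lam n \<le> lam (Suc n)" "e n \<noteq> 0"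
        using s(3)[of n] by (auto simp: lam_def intro: le_imp_inverse_le)
      then show ?thesis using False \<open>0 < t\<close> by (simp add: \<tau>_def)
    qed
  qed
  have "summable \<tau>"
  proof (rule summable_comparison_test')
    have "summable (\<lambda>n. real n powr (- (t / B)))"
      using t B by (simp add: summable_real_powr_iff)
    then have "summable (\<lambda>n. real (Suc n) powr (- (t / B)))"
      by (subst summable_Suc_iff)
    then show "summable (\<lambda>n. exp t * A powr (t / B) * real (Suc n) powr (- (t / B)))"
      by (rule summable_mult)
    show "norm (\<tau> n) \<le> exp t * A powr (t / B) * real (Suc n) powr (- (t / B))" if "n \<ge> 0" for n
    proof (cases "e n = 0")
      case True
      then show ?thesis by (simp add: \<tau>_def)
    next
      case False
      have "real (Suc n) \<le> A * exp (B / s n)" by (rule count[OF False])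
      then have "ln (real (Suc n)) \<le> ln (A * exp (B / s n))" using A by (subst ln_le_cancel_iff) auto
      also have "\<dots> = ln A + B * (1 + lam n)" using A by (simp add: ln_mult lam_def divide_inverse)
      finally have "ln (real (Suc n)) - ln A \<le> B * (1 + lam n)" by simp
      then have "t / B * (ln (real (Suc n)) - ln A) \<le> t / B * (B * (1 + lam n))"
        using \<open>0 < t\<close> B by (intro mult_left_mono) auto
      also have "\<dots> = t * (1 + lam n)" using B by simp
      finally have "- t * lam n \<le> t + t / B * ln A + - (t / B) * ln (real (Suc n))"
        by (simp add: algebra_simps)
      then have "exp (- t * lam n) \<le> exp (t + t / B * ln A + - (t / B) * ln (real (Suc n)))" by simp
      also have "\<dots> = exp t * A powr (t / B) * real (Suc n) powr (- (t / B))"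
        unfolding exp_add powr_def using A by simp
      finally show ?thesis using False by (simp add: \<tau>_def)
    qed
  qed
  then have lim: "\<tau> \<longlonglongrightarrow> 0" by (rule summable_LIMSEQ_zero)
  have "singular_value (diag \<tau>) (Suc n) = \<tau> n" for n
    by (subst singular_value_diag[OF \<open>decseq \<tau>\<close> lim]) (auto simp: \<tau>_def)
  then show "trace_class (functional_calculus \<Delta> (\<lambda>l. exp (- t * l)))"
    unfolding fc using compact_operator_diag[OF \<tau>_le lim] \<open>summable \<tau>\<close> by (simp add: trace_class_def)
qed

section \<open>Representatives and completeness of the space of square-integrable functions\<close>

declare sets_mmeasure [measurable_cong]

lemma space_mmeasure [simp]: "space (mmeasure :: 'a::metric_measure_space measure) = UNIV"
  using sets_eq_imp_space_eq[OF sets_mmeasure] by simp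

interpretation mmeasure: finite_measure "mmeasure :: 'a::metric_measure_space measure"
  by (rule finite_mmeasure)

lemma square_integrable_rep: "square_integrable (rep_L2 u)"
  using Quotient3_rep_reflp[OF Quotient3_L2, of u] by blast

lemma borel_measurable_rep [measurable]: "rep_L2 u \<in> borel_measurable mmeasure"
  by (rule square_integrable_measurable[OF square_integrable_rep])

lemma integrable_rep_square: "integrable mmeasure (\<lambda>x. (rep_L2 u x)\<^sup>2)"
  using square_integrable_rep[of u] by (simp add: square_integrable_def)

lemma abs_rep_L2 [simp]: "abs_L2 (rep_L2 u) = u"
  by (rule Quotient3_abs_rep[OF Quotient3_L2])

lemma rep_abs_L2: "square_integrable f \<Longrightarrow> AE x in mmeasure. rep_L2 (abs_L2 f) x = f x"
  using Quotient3_rep_abs[OF Quotient3_L2, of f] by simp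

lemma abs_L2_eqI:
  "square_integrable f \<Longrightarrow> square_integrable g \<Longrightarrow> AE x in mmeasure. f x = g x \<Longrightarrow> abs_L2 f = abs_L2 g"
  by (rule Quotient3_rel_abs[OF Quotient3_L2]) simp

lemma rep_L2_plus: "AE x in mmeasure. rep_L2 (u + v) x = rep_L2 u x + rep_L2 v x"
proof -
  have "u + v = abs_L2 (\<lambda>x. rep_L2 u x + rep_L2 v x)"
    using plus_L2.abs_eq[of "rep_L2 u" "rep_L2 v"] square_integrable_rep[of u] square_integrable_rep[of v] by simp
  then show ?thesis
    using rep_abs_L2[OF square_integrable_add[OF square_integrable_rep square_integrable_rep]] by metis
qed

lemma rep_L2_scaleR: "AE x in mmeasure. rep_L2 (c *\<^sub>R u) x = c * rep_L2 u x"
proof -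
  have "c *\<^sub>R u = abs_L2 (\<lambda>x. c * rep_L2 u x)"
    using scaleR_L2.abs_eq[of "rep_L2 u" c] square_integrable_rep[of u] by simp
  then show ?thesis
    using rep_abs_L2[OF square_integrable_cmult[OF square_integrable_rep]] by metis
qed

lemma rep_L2_diff: "AE x in mmeasure. rep_L2 (u - v) x = rep_L2 u x - rep_L2 v x"
proof -
  have "u - v = u + (-1) *\<^sub>R v" by simp
  then show ?thesis
    using rep_L2_plus[of u "(-1) *\<^sub>R v"] rep_L2_scaleR[of "-1" v] by auto
qed

lemma inner_L2_rep: "inner u v = (\<integral>x. rep_L2 u x * rep_L2 v x \<partial>mmeasure)"
  by (rule inner_L2.rep_eq)

lemma norm_L2_rep: "(norm u)\<^sup>2 = (\<integral>x. (rep_L2 u x)\<^sup>2 \<partial>mmeasure)"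
  unfolding power2_norm_eq_inner inner_L2_rep by (simp add: power2_eq_square)

lemma inner_L2_abs:
  assumes "square_integrable f"
  shows "inner (abs_L2 f) v = (\<integral>x. f x * rep_L2 v x \<partial>mmeasure)"
  unfolding inner_L2_rep using rep_abs_L2[OF assms] square_integrable_measurable[OF assms]
  by (intro integral_cong_AE) auto

lemma norm_L2_abs:
  assumes "square_integrable f"
  shows "(norm (abs_L2 f))\<^sup>2 = (\<integral>x. (f x)\<^sup>2 \<partial>mmeasure)"
  unfolding norm_L2_rep using rep_abs_L2[OF assms] square_integrable_measurable[OF assms]
  by (intro integral_cong_AE) auto

lemma nn_integral_rep_square: "(\<integral>\<^sup>+x. ennreal ((rep_L2 u x)\<^sup>2) \<partial>mmeasure) = ennreal ((norm u)\<^sup>2)"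
  unfolding norm_L2_rep by (rule nn_integral_eq_integral[OF integrable_rep_square]) simp

text \<open>Fatou's lemma in the form in which it gives both the completeness of $L^2$ and the closedness
  of the Dirichlet form.\<close>

lemma nn_integral_limit_le:
  fixes g :: "nat \<Rightarrow> 'b \<Rightarrow> ennreal"
  assumes [measurable]: "\<And>n. g n \<in> borel_measurable M"
    and lim: "AE x in M. (\<lambda>n. g n x) \<longlonglongrightarrow> h x"
    and le: "\<forall>\<^sub>F n in sequentially. (\<integral>\<^sup>+x. g n x \<partial>M) \<le> C"
  shows "(\<integral>\<^sup>+x. h x \<partial>M) \<le> C"
proof -
  have "(\<integral>\<^sup>+x. h x \<partial>M) = (\<integral>\<^sup>+x. liminf (\<lambda>n. g n x) \<partial>M)"
    using lim by (intro nn_integral_cong_AE) (auto simp: lim_imp_Liminf)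
  also have "\<dots> \<le> liminf (\<lambda>n. \<integral>\<^sup>+x. g n x \<partial>M)"
    by (rule nn_integral_liminf) simp
  also have "\<dots> \<le> C"
    by (rule Liminf_le[OF _ le]) simp
  finally show ?thesis .
qed

text \<open>The inclusion of $L^2$ in $L^1$ for a finite measure.\<close>

lemma nn_integral_abs_rep_le:
  "(\<integral>\<^sup>+x. ennreal \<bar>rep_L2 (u :: 'a::metric_measure_space L2) x\<bar> \<partial>mmeasure)
    \<le> ennreal (sqrt (measure (mmeasure :: 'a measure) UNIV) * norm u)"
proof -
  define m where "m = measure (mmeasure :: 'a measure) UNIV"
  define h where "h x = \<bar>rep_L2 u x\<bar>" for x
  have h: "square_integrable h"
    using integrable_rep_square[of u] by (simp add: square_integrable_def h_def[abs_def])
  have one: "square_integrable (\<lambda>x :: 'a. 1)"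
    by (simp add: square_integrable_def)
  have int: "integrable mmeasure h"
    using square_integrable_mult[OF h one] by simp
  have "(\<integral>x. h x \<partial>mmeasure) = inner (abs_L2 h) (abs_L2 (\<lambda>x. 1))"
    using h one by (simp add: inner_L2.abs_eq)
  also have "\<dots> \<le> norm (abs_L2 h) * norm (abs_L2 (\<lambda>x :: 'a. 1))"
    by (rule norm_cauchy_schwarz)
  also have "norm (abs_L2 h) = norm u"
  proof -
    have "(norm (abs_L2 h))\<^sup>2 = (norm u)\<^sup>2"
      by (subst norm_L2_abs[OF h], subst norm_L2_rep) (simp add: h_def)
    then show ?thesis by simp
  qed
  also have "norm (abs_L2 (\<lambda>x :: 'a. 1)) = sqrt m"
  proof -
    have "(norm (abs_L2 (\<lambda>x :: 'a. 1)))\<^sup>2 = m"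
      by (subst norm_L2_abs[OF one]) (simp add: m_def)
    then show ?thesis by (metis norm_ge_zero real_sqrt_unique)
  qed
  finally have "(\<integral>x. h x \<partial>mmeasure) \<le> sqrt m * norm u" by (simp add: mult.commute)
  moreover have "(\<integral>\<^sup>+x. ennreal (h x) \<partial>mmeasure) = ennreal (\<integral>x. h x \<partial>mmeasure)"
    by (rule nn_integral_eq_integral[OF int]) (simp add: h_def)
  ultimately show ?thesis
    by (simp add: h_def m_def ennreal_leI)
qed

lemma Cauchy_fast_subseq:
  fixes X :: "nat \<Rightarrow> 'b::metric_space"
  assumes "Cauchy X"
  obtains r where "strict_mono r" "\<And>n. dist (X (r (Suc n))) (X (r n)) < (1 / 2) ^ n"
proof -
  have "\<exists>N. \<forall>m\<ge>N. \<forall>k\<ge>N. dist (X m) (X k) < (1 / 2) ^ n" for n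
    using assms unfolding Cauchy_def by (meson zero_less_power half_gt_zero_iff zero_less_one)
  then obtain N where N: "\<And>n m k. N n \<le> m \<Longrightarrow> N n \<le> k \<Longrightarrow> dist (X m) (X k) < (1 / 2) ^ n" by metis
  have "\<exists>r. \<forall>n. N n \<le> r n \<and> r n < r (Suc n)"
  proof (rule dependent_nat_choice)
    show "\<exists>k. N (Suc n) \<le> k \<and> m < k" for m n
      by (intro exI[of _ "max (N (Suc n)) (Suc m)"]) auto
  qed auto
  then obtain r where r: "\<And>n. N n \<le> r n" "\<And>n. r n < r (Suc n)" by blast
  show ?thesis
  proof (rule that)
    show "strict_mono r" using r(2) by (simp add: strict_mono_Suc_iff)
    show "dist (X (r (Suc n))) (X (r n)) < (1 / 2) ^ n" for n
      using r(1)[of n] r(2)[of n] by (intro N) auto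
  qed
qed

text \<open>A fast subsequence converges almost everywhere, since $\sum_n \|f_{n+1}-f_n\|_1 < \infty$;
  by Fatou's lemma its pointwise limit is the limit in $L^2$.\<close>

lemma L2_Cauchy_limit:
  fixes X :: "nat \<Rightarrow> 'a::metric_measure_space L2"
  assumes "Cauchy X"
  obtains r u where "strict_mono r" "X \<longlonglongrightarrow> u" "AE x in mmeasure. (\<lambda>n. rep_L2 (X (r n)) x) \<longlonglongrightarrow> rep_L2 u x"
proof -
  obtain r where r: "strict_mono r" and fast: "\<And>n. dist (X (r (Suc n))) (X (r n)) < (1 / 2) ^ n"
    using Cauchy_fast_subseq[OF assms] by blast
  define f where "f n = rep_L2 (X (r n))" for n
  have [measurable]: "f n \<in> borel_measurable mmeasure" for n by (simp add: f_def)
  define m where "m = sqrt (measure (mmeasure :: 'a measure) UNIV)"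
  have "0 \<le> m" by (simp add: m_def)
  have step: "(\<integral>\<^sup>+x. ennreal \<bar>f (Suc n) x - f n x\<bar> \<partial>mmeasure) \<le> ennreal (m * (1 / 2) ^ n)" for n
  proof -
    have "(\<integral>\<^sup>+x. ennreal \<bar>f (Suc n) x - f n x\<bar> \<partial>mmeasure) =
        (\<integral>\<^sup>+x. ennreal \<bar>rep_L2 (X (r (Suc n)) - X (r n)) x\<bar> \<partial>mmeasure)"
      using rep_L2_diff[of "X (r (Suc n))" "X (r n)"] by (intro nn_integral_cong_AE) (auto simp: f_def)
    also have "\<dots> \<le> ennreal (m * norm (X (r (Suc n)) - X (r n)))"
      unfolding m_def by (rule nn_integral_abs_rep_le)
    also have "\<dots> \<le> ennreal (m * (1 / 2) ^ n)"
      using fast[of n] \<open>0 \<le> m\<close> by (intro ennreal_leI mult_left_mono) (auto simp: dist_norm)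
    finally show ?thesis .
  qed
  have "(\<integral>\<^sup>+x. (\<Sum>n. ennreal \<bar>f (Suc n) x - f n x\<bar>) \<partial>mmeasure) =
      (\<Sum>n. \<integral>\<^sup>+x. ennreal \<bar>f (Suc n) x - f n x\<bar> \<partial>mmeasure)"
    by (rule nn_integral_suminf) simp
  also have "\<dots> \<le> (\<Sum>n. ennreal (m * (1 / 2) ^ n))"
    by (intro suminf_le step) auto
  also have "\<dots> < \<infinity>"
    using \<open>0 \<le> m\<close> by (subst suminf_ennreal2) (auto intro!: summable_mult summable_geometric)
  finally have "AE x in mmeasure. (\<Sum>n. ennreal \<bar>f (Suc n) x - f n x\<bar>) \<noteq> \<infinity>"
    by (intro nn_integral_noteq_infinite) auto
  then have conv: "AE x in mmeasure. convergent (\<lambda>n. f n x)"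
  proof eventually_elim
    case (elim x)
    then have "summable (\<lambda>n. \<bar>f (Suc n) x - f n x\<bar>)"
      by (intro summable_suminf_not_top) auto
    then have "summable (\<lambda>n. f (Suc n) x - f n x)"
      by (rule summable_rabs_cancel)
    then have "convergent (\<lambda>n. \<Sum>i<n. f (Suc i) x - f i x)"
      by (simp add: summable_iff_convergent)
    then have "convergent (\<lambda>n. f n x - f 0 x)"
      unfolding sum_lessThan_telescope[of "\<lambda>i. f i x"] .
    then have "convergent (\<lambda>n. (f n x - f 0 x) + f 0 x)"
      by (intro convergent_add convergent_const)
    then show ?case by simp
  qed
  define g where "g x = lim (\<lambda>n. f n x)" for x
  have [measurable]: "g \<in> borel_measurable mmeasure"
    unfolding g_def[abs_def] by (rule borel_measurable_lim_metric) simp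
  have lim_g: "AE x in mmeasure. (\<lambda>n. f n x) \<longlonglongrightarrow> g x"
    using conv by eventually_elim (simp add: g_def convergent_LIMSEQ_iff)
  have bound: "(\<integral>\<^sup>+x. ennreal ((g x - rep_L2 (X k) x)\<^sup>2) \<partial>mmeasure) \<le> ennreal (\<epsilon>\<^sup>2)"
    if k: "\<And>n. N \<le> n \<Longrightarrow> norm (X n - X k) \<le> \<epsilon>" for k N \<epsilon>
  proof (rule nn_integral_limit_le[where g = "\<lambda>n x. ennreal ((f n x - rep_L2 (X k) x)\<^sup>2)"])
    show "AE x in mmeasure. (\<lambda>n. ennreal ((f n x - rep_L2 (X k) x)\<^sup>2)) \<longlonglongrightarrow> ennreal ((g x - rep_L2 (X k) x)\<^sup>2)"
      using lim_g by eventually_elim (intro tendsto_ennrealI tendsto_intros)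
    have "(\<integral>\<^sup>+x. ennreal ((f n x - rep_L2 (X k) x)\<^sup>2) \<partial>mmeasure) \<le> ennreal (\<epsilon>\<^sup>2)" if "N \<le> n" for n
    proof -
      have "(\<integral>\<^sup>+x. ennreal ((f n x - rep_L2 (X k) x)\<^sup>2) \<partial>mmeasure) =
          (\<integral>\<^sup>+x. ennreal ((rep_L2 (X (r n) - X k) x)\<^sup>2) \<partial>mmeasure)"
        using rep_L2_diff[of "X (r n)" "X k"] by (intro nn_integral_cong_AE) (auto simp: f_def)
      also have "\<dots> \<le> ennreal (\<epsilon>\<^sup>2)"
        unfolding nn_integral_rep_square using seq_suble[OF r, of n] that
        by (intro ennreal_leI power_mono k) auto
      finally show ?thesis .
    qed
    then show "\<forall>\<^sub>F n in sequentially. (\<integral>\<^sup>+x. ennreal ((f n x - rep_L2 (X k) x)\<^sup>2) \<partial>mmeasure) \<le> ennreal (\<epsilon>\<^sup>2)"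
      by (rule eventually_sequentiallyI)
  qed simp
  have Cauchy: "\<exists>N. \<forall>m\<ge>N. \<forall>n\<ge>N. norm (X m - X n) < \<epsilon>" if "0 < \<epsilon>" for \<epsilon>
    using assms that by (simp add: Cauchy_iff)
  have sq_diff: "square_integrable (\<lambda>x. g x - rep_L2 (X k) x)" if "\<And>n. N \<le> n \<Longrightarrow> norm (X n - X k) \<le> \<epsilon>" for k N \<epsilon>
    unfolding square_integrable_def
  proof
    show "integrable mmeasure (\<lambda>x. (g x - rep_L2 (X k) x)\<^sup>2)"
      using le_less_trans[OF bound[OF that]] by (intro integrableI_nonneg) auto
  qed simp
  have g: "square_integrable g"
  proof -
    obtain N where "\<forall>m\<ge>N. \<forall>n\<ge>N. norm (X m - X n) < 1" using Cauchy[of 1] by auto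
    then have "square_integrable (\<lambda>x. g x - rep_L2 (X N) x)"
      by (intro sq_diff[of N N 1]) (auto simp: less_imp_le)
    from square_integrable_add[OF this square_integrable_rep[of "X N"]] show ?thesis by simp
  qed
  define u where "u = abs_L2 g"
  have rep_u: "AE x in mmeasure. rep_L2 u x = g x" unfolding u_def by (rule rep_abs_L2[OF g])
  have "X \<longlonglongrightarrow> u"
  proof (rule LIMSEQ_I)
    fix \<epsilon> :: real assume "0 < \<epsilon>"
    then obtain N where N: "\<forall>m\<ge>N. \<forall>n\<ge>N. norm (X m - X n) < \<epsilon> / 2" using Cauchy[of "\<epsilon> / 2"] by auto
    have "norm (X k - u) < \<epsilon>" if "N \<le> k" for k
    proof -
      have "ennreal ((norm (u - X k))\<^sup>2) = (\<integral>\<^sup>+x. ennreal ((g x - rep_L2 (X k) x)\<^sup>2) \<partial>mmeasure)"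
        unfolding nn_integral_rep_square[symmetric] using rep_L2_diff[of u "X k"] rep_u
        by (intro nn_integral_cong_AE) auto
      also have "\<dots> \<le> ennreal ((\<epsilon> / 2)\<^sup>2)"
        using N that by (intro bound[of N]) (auto simp: less_imp_le)
      finally have "(norm (u - X k))\<^sup>2 \<le> (\<epsilon> / 2)\<^sup>2" by simp
      then have "norm (u - X k) \<le> \<epsilon> / 2"
        by (rule power2_le_imp_le) (use \<open>0 < \<epsilon>\<close> in simp)
      then show ?thesis using \<open>0 < \<epsilon>\<close> by (simp add: norm_minus_commute)
    qed
    then show "\<exists>N. \<forall>k\<ge>N. norm (X k - u) < \<epsilon>" by blast
  qed
  moreover have "AE x in mmeasure. (\<lambda>n. rep_L2 (X (r n)) x) \<longlonglongrightarrow> rep_L2 u x"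
    using lim_g rep_u by eventually_elim (simp add: f_def)
  ultimately show ?thesis using that r by blast
qed

instance L2 :: (metric_measure_space) banach
proof
  fix X :: "nat \<Rightarrow> 'a L2" assume "Cauchy X"
  then show "convergent X" by (metis L2_Cauchy_limit convergentI)
qed

section \<open>The Dirichlet form as a form of difference quotients\<close>

interpretation mmeasure2: pair_sigma_finite "mmeasure :: 'a::metric_measure_space measure" "mmeasure :: 'a measure"
  by unfold_locales

text \<open>In terms of this quotient the Dirichlet form is half the $L^2$ inner product over the product measure.
  On the diagonal the quotient is $0/0$, which is $0$, so that the integral over the whole product is the
  one over the complement of the diagonal.\<close>

definition diff_quotient :: "real \<Rightarrow> ('a::metric_measure_space \<Rightarrow> real) \<Rightarrow> 'a \<times> 'a \<Rightarrow> real" where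
  "diff_quotient \<delta> f = (\<lambda>(x, y). (f x - f y) / dist x y powr (\<delta> / 2))"

abbreviation diff_quotient_L2 :: "real \<Rightarrow> 'a::metric_measure_space L2 \<Rightarrow> 'a \<times> 'a \<Rightarrow> real" where
  "diff_quotient_L2 \<delta> u \<equiv> diff_quotient \<delta> (rep_L2 u)"

lemma borel_measurable_diff_quotient [measurable]:
  assumes [measurable]: "f \<in> borel_measurable mmeasure"
  shows "diff_quotient \<delta> f \<in> borel_measurable (mmeasure \<Otimes>\<^sub>M mmeasure)"
  unfolding diff_quotient_def by measurable

lemma diff_quotient_mult:
  "diff_quotient \<delta> f (x, y) * diff_quotient \<delta> g (x, y) = (f x - f y) * (g x - g y) / dist x y powr \<delta>"
  by (simp add: diff_quotient_def flip: powr_add)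

lemma diff_quotient_square: "(diff_quotient \<delta> f (x, y))\<^sup>2 = (f x - f y)\<^sup>2 / dist x y powr \<delta>"
  using diff_quotient_mult[of \<delta> f x y f] by (simp add: power2_eq_square)

lemma AE_pair_mmeasure:
  assumes "AE x in mmeasure. P (x :: 'a::metric_measure_space)"
  shows "AE p in mmeasure \<Otimes>\<^sub>M mmeasure. P (fst p) \<and> P (snd p)"
proof -
  obtain A :: "'a set" where A: "A \<in> null_sets mmeasure" "{x \<in> space mmeasure. \<not> P x} \<subseteq> A"
    using assms by (auto simp: eventually_ae_filter)
  have null: "S \<times> T \<in> null_sets (mmeasure \<Otimes>\<^sub>M mmeasure)"
    if "S \<in> sets mmeasure" "T \<in> sets mmeasure" "emeasure mmeasure S = 0 \<or> emeasure mmeasure T = 0" for S T :: "'a set"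
    using that mmeasure.emeasure_pair_measure_Times[OF that(1,2)] by (auto simp: null_sets_def)
  have "A \<times> UNIV \<union> UNIV \<times> A \<in> null_sets (mmeasure \<Otimes>\<^sub>M mmeasure)"
    by (intro null_sets.Un null) (use A(1) in \<open>auto simp: sets_mmeasure\<close>)
  then show ?thesis
    by (rule AE_I') (use A(2) in auto)
qed

lemma diff_quotient_cong_AE:
  assumes "AE x in mmeasure. f x = g x"
  shows "AE p in mmeasure \<Otimes>\<^sub>M mmeasure. diff_quotient \<delta> f p = diff_quotient \<delta> g p"
  using AE_pair_mmeasure[OF assms] by eventually_elim (auto simp: diff_quotient_def split: prod.splits)

lemma diff_quotient_plus:
  "AE p in mmeasure \<Otimes>\<^sub>M mmeasure. diff_quotient_L2 \<delta> (u + v) p = diff_quotient_L2 \<delta> u p + diff_quotient_L2 \<delta> v p"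
  using AE_pair_mmeasure[OF rep_L2_plus[of u v]]
  by eventually_elim (auto simp: diff_quotient_def diff_divide_distrib add_divide_distrib split: prod.splits)

lemma diff_quotient_scaleR:
  "AE p in mmeasure \<Otimes>\<^sub>M mmeasure. diff_quotient_L2 \<delta> (c *\<^sub>R u) p = c * diff_quotient_L2 \<delta> u p"
  using AE_pair_mmeasure[OF rep_L2_scaleR[of c u]]
  by eventually_elim (auto simp: diff_quotient_def right_diff_distrib diff_divide_distrib split: prod.splits)

lemma dirichlet_energy_abs:
  assumes f: "square_integrable f"
  shows "dirichlet_energy \<delta> (abs_L2 f) = (\<integral>\<^sup>+p. ennreal ((diff_quotient \<delta> f p)\<^sup>2) \<partial>(mmeasure \<Otimes>\<^sub>M mmeasure))"
proof -
  have [measurable]: "f \<in> borel_measurable mmeasure" using f by (rule square_integrable_measurable)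
  have "dirichlet_energy \<delta> (abs_L2 f) =
      (\<integral>\<^sup>+x. (\<integral>\<^sup>+y. ennreal (\<bar>f x - f y\<bar>\<^sup>2 / dist x y powr \<delta>) * indicator (- {x}) y \<partial>mmeasure) \<partial>mmeasure)"
    using f by (simp add: dirichlet_energy.abs_eq)
  also have "\<dots> = (\<integral>\<^sup>+x. (\<integral>\<^sup>+y. ennreal ((diff_quotient \<delta> f (x, y))\<^sup>2) \<partial>mmeasure) \<partial>mmeasure)"
    unfolding diff_quotient_square by (intro nn_integral_cong) (auto simp: indicator_def)
  also have "\<dots> = (\<integral>\<^sup>+p. ennreal ((diff_quotient \<delta> f p)\<^sup>2) \<partial>(mmeasure \<Otimes>\<^sub>M mmeasure))"
    by (rule mmeasure.nn_integral_fst) simp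
  finally show ?thesis .
qed

lemma dirichlet_energy_rep:
  "dirichlet_energy \<delta> u = (\<integral>\<^sup>+p. ennreal ((diff_quotient_L2 \<delta> u p)\<^sup>2) \<partial>(mmeasure \<Otimes>\<^sub>M mmeasure))"
  using dirichlet_energy_abs[OF square_integrable_rep, of \<delta> u] by simp

lemma dirichlet_dom_iff:
  "u \<in> dirichlet_dom \<delta> \<longleftrightarrow> integrable (mmeasure \<Otimes>\<^sub>M mmeasure) (\<lambda>p. (diff_quotient_L2 \<delta> u p)\<^sup>2)"
  unfolding dirichlet_dom_def dirichlet_energy_rep mem_Collect_eq
  by (auto simp: integrable_iff_bounded)

lemma abs_mult_le_squares: "\<bar>s * t\<bar> \<le> s\<^sup>2 + t\<^sup>2" for s t :: real
proof -
  have "2 * \<bar>s * t\<bar> \<le> s\<^sup>2 + t\<^sup>2"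
    using sum_squares_bound[of "\<bar>s\<bar>" "\<bar>t\<bar>"] by (simp add: abs_mult)
  then show ?thesis using abs_ge_zero[of "s * t"] by linarith
qed

lemma integrable_diff_quotient_mult:
  assumes "u \<in> dirichlet_dom \<delta>" "v \<in> dirichlet_dom \<delta>"
  shows "integrable (mmeasure \<Otimes>\<^sub>M mmeasure) (\<lambda>p. diff_quotient_L2 \<delta> u p * diff_quotient_L2 \<delta> v p)"
proof (rule Bochner_Integration.integrable_bound)
  show "integrable (mmeasure \<Otimes>\<^sub>M mmeasure) (\<lambda>p. (diff_quotient_L2 \<delta> u p)\<^sup>2 + (diff_quotient_L2 \<delta> v p)\<^sup>2)"
    using assms by (simp add: dirichlet_dom_iff)
  show "AE p in mmeasure \<Otimes>\<^sub>M mmeasure. norm (diff_quotient_L2 \<delta> u p * diff_quotient_L2 \<delta> v p) \<le>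
      norm ((diff_quotient_L2 \<delta> u p)\<^sup>2 + (diff_quotient_L2 \<delta> v p)\<^sup>2)"
    using abs_mult_le_squares by simp
qed simp

lemma dirichlet_form_rep:
  assumes "u \<in> dirichlet_dom \<delta>" "v \<in> dirichlet_dom \<delta>"
  shows "dirichlet_form \<delta> u v =
    1 / 2 * (\<integral>p. diff_quotient_L2 \<delta> u p * diff_quotient_L2 \<delta> v p \<partial>(mmeasure \<Otimes>\<^sub>M mmeasure))"
proof -
  let ?f = "rep_L2 u" and ?g = "rep_L2 v"
  have "dirichlet_form \<delta> u v = 1 / 2 * (\<integral>x. (\<integral>y. indicator (- {x}) y *\<^sub>R
      ((?f x - ?f y) * (?g x - ?g y) / dist x y powr \<delta>) \<partial>mmeasure) \<partial>mmeasure)"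
    using dirichlet_form.abs_eq[of ?f ?g \<delta>] square_integrable_rep[of u] square_integrable_rep[of v]
    by (simp add: set_lebesgue_integral_def)
  also have "\<dots> = 1 / 2 * (\<integral>x. (\<integral>y. diff_quotient_L2 \<delta> u (x, y) * diff_quotient_L2 \<delta> v (x, y) \<partial>mmeasure) \<partial>mmeasure)"
    unfolding diff_quotient_mult
    by (intro arg_cong[where f = "\<lambda>t. 1 / 2 * t"] Bochner_Integration.integral_cong) (auto simp: indicator_def)
  also have "(\<integral>x. (\<integral>y. diff_quotient_L2 \<delta> u (x, y) * diff_quotient_L2 \<delta> v (x, y) \<partial>mmeasure) \<partial>mmeasure) =
      (\<integral>p. diff_quotient_L2 \<delta> u p * diff_quotient_L2 \<delta> v p \<partial>(mmeasure \<Otimes>\<^sub>M mmeasure))"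
    by (rule mmeasure2.integral_fst'[OF integrable_diff_quotient_mult[OF assms]])
  finally show ?thesis .
qed

lemma dirichlet_energy_eq_form:
  assumes "u \<in> dirichlet_dom \<delta>"
  shows "dirichlet_energy \<delta> u = ennreal (2 * dirichlet_form \<delta> u u)"
proof -
  have int: "integrable (mmeasure \<Otimes>\<^sub>M mmeasure) (\<lambda>p. (diff_quotient_L2 \<delta> u p)\<^sup>2)"
    using assms by (simp add: dirichlet_dom_iff)
  show ?thesis
    unfolding dirichlet_energy_rep dirichlet_form_rep[OF assms assms]
    by (subst nn_integral_eq_integral[OF int]) (auto simp: power2_eq_square)
qed

lemma subspace_dirichlet_dom: "subspace (dirichlet_dom \<delta>)"
proof -
  let ?N = "mmeasure \<Otimes>\<^sub>M mmeasure :: ('a \<times> 'a) measure"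
  have scale: "c *\<^sub>R u \<in> dirichlet_dom \<delta>" if u: "u \<in> dirichlet_dom \<delta>" for c and u :: "'a L2"
  proof -
    have "integrable ?N (\<lambda>p. c\<^sup>2 * (diff_quotient_L2 \<delta> u p)\<^sup>2)"
      using u by (simp add: dirichlet_dom_iff)
    then show ?thesis
      unfolding dirichlet_dom_iff
      by (rule integrable_cong_AE_imp) (use diff_quotient_scaleR[of \<delta> c u] in \<open>auto simp: power_mult_distrib\<close>)
  qed
  have add: "u + v \<in> dirichlet_dom \<delta>" if u: "u \<in> dirichlet_dom \<delta>" and v: "v \<in> dirichlet_dom \<delta>" for u v :: "'a L2"
  proof -
    have "integrable ?N (\<lambda>p. (diff_quotient_L2 \<delta> u p)\<^sup>2 + (diff_quotient_L2 \<delta> v p)\<^sup>2 +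
        2 * (diff_quotient_L2 \<delta> u p * diff_quotient_L2 \<delta> v p))"
      using u v integrable_diff_quotient_mult[OF u v] by (simp add: dirichlet_dom_iff)
    then show ?thesis
      unfolding dirichlet_dom_iff
      by (rule integrable_cong_AE_imp) (use diff_quotient_plus[of \<delta> u v] in \<open>auto simp: power2_sum\<close>)
  qed
  have "0 \<in> dirichlet_dom \<delta>"
    using scale[of _ 0] by (auto simp: zero_L2.abs_eq dirichlet_dom_def dirichlet_energy_abs[OF square_integrable_zero]
        diff_quotient_def split_beta)
  with scale add show ?thesis by (auto simp: subspace_def)
qed

lemma dirichlet_form_commute: "dirichlet_form \<delta> u v = dirichlet_form \<delta> v u"
  by transfer (simp add: mult.commute)

lemma dirichlet_form_add_left:
  assumes u: "u \<in> dirichlet_dom \<delta>" and v: "v \<in> dirichlet_dom \<delta>" and w: "w \<in> dirichlet_dom \<delta>"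
  shows "dirichlet_form \<delta> (u + v) w = dirichlet_form \<delta> u w + dirichlet_form \<delta> v w"
proof -
  let ?N = "mmeasure \<Otimes>\<^sub>M mmeasure :: ('a \<times> 'a) measure"
  have uv: "u + v \<in> dirichlet_dom \<delta>" by (rule subspace_add[OF subspace_dirichlet_dom u v])
  have "(\<integral>p. diff_quotient_L2 \<delta> (u + v) p * diff_quotient_L2 \<delta> w p \<partial>?N) =
      (\<integral>p. diff_quotient_L2 \<delta> u p * diff_quotient_L2 \<delta> w p + diff_quotient_L2 \<delta> v p * diff_quotient_L2 \<delta> w p \<partial>?N)"
    using diff_quotient_plus[of \<delta> u v] by (intro integral_cong_AE) (auto simp: distrib_right)
  also have "\<dots> = (\<integral>p. diff_quotient_L2 \<delta> u p * diff_quotient_L2 \<delta> w p \<partial>?N) +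
      (\<integral>p. diff_quotient_L2 \<delta> v p * diff_quotient_L2 \<delta> w p \<partial>?N)"
    by (intro Bochner_Integration.integral_add integrable_diff_quotient_mult u v w)
  finally show ?thesis
    by (simp add: dirichlet_form_rep[OF uv w] dirichlet_form_rep[OF u w] dirichlet_form_rep[OF v w])
qed

lemma dirichlet_form_scaleR_left:
  assumes u: "u \<in> dirichlet_dom \<delta>" and w: "w \<in> dirichlet_dom \<delta>"
  shows "dirichlet_form \<delta> (c *\<^sub>R u) w = c * dirichlet_form \<delta> u w"
proof -
  let ?N = "mmeasure \<Otimes>\<^sub>M mmeasure :: ('a \<times> 'a) measure"
  have cu: "c *\<^sub>R u \<in> dirichlet_dom \<delta>" by (rule subspace_scale[OF subspace_dirichlet_dom u])
  have "(\<integral>p. diff_quotient_L2 \<delta> (c *\<^sub>R u) p * diff_quotient_L2 \<delta> w p \<partial>?N) =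
      (\<integral>p. c * (diff_quotient_L2 \<delta> u p * diff_quotient_L2 \<delta> w p) \<partial>?N)"
    using diff_quotient_scaleR[of \<delta> c u] by (intro integral_cong_AE) auto
  then show ?thesis
    by (simp add: dirichlet_form_rep[OF cu w] dirichlet_form_rep[OF u w])
qed

lemma dirichlet_form_nonneg: "u \<in> dirichlet_dom \<delta> \<Longrightarrow> 0 \<le> dirichlet_form \<delta> u u"
  by (simp add: dirichlet_form_rep)

text \<open>Lower semicontinuity of the energy by Fatou's lemma. The fixed $v$ is subtracted so that the energy
  distance of a limit from the members of a Cauchy sequence can be bounded.\<close>

lemma dirichlet_energy_limit_le:
  assumes lim: "AE x in mmeasure. (\<lambda>n. rep_L2 (X n) x) \<longlonglongrightarrow> rep_L2 u x"
    and le: "\<forall>\<^sub>F n in sequentially. dirichlet_energy \<delta> (X n - v) \<le> C"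
  shows "dirichlet_energy \<delta> (u - v) \<le> C"
proof -
  let ?f = "\<lambda>n x. rep_L2 (X n) x - rep_L2 v x" and ?g = "\<lambda>x. rep_L2 u x - rep_L2 v x"
  have eq: "dirichlet_energy \<delta> (w - v) =
      (\<integral>\<^sup>+p. ennreal ((diff_quotient \<delta> (\<lambda>x. rep_L2 w x - rep_L2 v x) p)\<^sup>2) \<partial>(mmeasure \<Otimes>\<^sub>M mmeasure))" for w
    unfolding dirichlet_energy_rep using diff_quotient_cong_AE[OF rep_L2_diff, of \<delta> w v]
    by (intro nn_integral_cong_AE) auto
  show ?thesis
    unfolding eq
  proof (rule nn_integral_limit_le)
    show "AE p in mmeasure \<Otimes>\<^sub>M mmeasure. (\<lambda>n. ennreal ((diff_quotient \<delta> (?f n) p)\<^sup>2))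
        \<longlonglongrightarrow> ennreal ((diff_quotient \<delta> ?g p)\<^sup>2)"
      using AE_pair_mmeasure[OF lim]
    proof eventually_elim
      case (elim p)
      obtain x y where p: "p = (x, y)" by (cases p)
      have "(\<lambda>n. inverse (dist x y powr (\<delta> / 2)) * (?f n x - ?f n y))
          \<longlonglongrightarrow> inverse (dist x y powr (\<delta> / 2)) * (?g x - ?g y)"
        using elim unfolding p by (intro tendsto_intros) auto
      then have "(\<lambda>n. diff_quotient \<delta> (?f n) p) \<longlonglongrightarrow> diff_quotient \<delta> ?g p"
        unfolding p diff_quotient_def prod.case divide_inverse_commute .
      then show ?case by (intro tendsto_ennrealI tendsto_power)
    qed
    show "\<forall>\<^sub>F n in sequentially.
        (\<integral>\<^sup>+p. ennreal ((diff_quotient \<delta> (?f n) p)\<^sup>2) \<partial>(mmeasure \<Otimes>\<^sub>M mmeasure)) \<le> C"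
      using le unfolding eq .
  qed simp
qed

section \<open>The resolvent of a closed form\<close>

text \<open>The factor $G+1$ instead of $G$ covers the case $G=0$.\<close>

lemma discriminant_bound:
  fixes r c G :: real
  assumes "\<And>t. 0 \<le> r + 2 * t * c + t\<^sup>2 * G" and G: "0 \<le> G"
  shows "c\<^sup>2 \<le> r * (G + 1)"
proof -
  define t where "t = - c / (G + 1)"
  have c: "c = - t * (G + 1)" using G by (simp add: t_def)
  have "0 \<le> r + 2 * t * c + t\<^sup>2 * G" by (rule assms(1))
  also have "\<dots> = r - t\<^sup>2 * (G + 1) - t\<^sup>2"
    unfolding c by (simp add: power2_eq_square algebra_simps)
  also have "\<dots> \<le> r - t\<^sup>2 * (G + 1)" by simp
  finally have "t\<^sup>2 * (G + 1) \<le> r" by simp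
  then have "t\<^sup>2 * (G + 1) * (G + 1) \<le> r * (G + 1)"
    using G by (intro mult_right_mono) auto
  then show ?thesis
    unfolding c by (simp add: power2_eq_square mult_ac)
qed

text \<open>A minimising sequence of $Q(u,u)-2\langle f,u\rangle$ is Cauchy by the parallelogram law, and its
  limit solves the Euler--Lagrange equation.\<close>

lemma closed_form_representation:
  fixes Q :: "'h::real_inner \<Rightarrow> 'h \<Rightarrow> real" and f :: 'h
  assumes D: "subspace D"
    and add: "\<And>u v w. u \<in> D \<Longrightarrow> v \<in> D \<Longrightarrow> w \<in> D \<Longrightarrow> Q (u + v) w = Q u w + Q v w"
    and scale: "\<And>c u w. u \<in> D \<Longrightarrow> w \<in> D \<Longrightarrow> Q (c *\<^sub>R u) w = c * Q u w"
    and sym: "\<And>u v. Q u v = Q v u"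
    and coercive: "\<And>u. u \<in> D \<Longrightarrow> (norm u)\<^sup>2 \<le> Q u u"
    and complete: "\<And>X. (\<And>n::nat. X n \<in> D) \<Longrightarrow>
      (\<And>\<epsilon>. 0 < \<epsilon> \<Longrightarrow> \<exists>N. \<forall>m\<ge>N. \<forall>n\<ge>N. Q (X m - X n) (X m - X n) < \<epsilon>) \<Longrightarrow>
      \<exists>u\<in>D. (\<lambda>n. Q (X n - u) (X n - u)) \<longlonglongrightarrow> 0"
  shows "\<exists>u\<in>D. \<forall>g\<in>D. Q u g = inner f g"
proof -
  note D_add = subspace_add[OF D] and D_scale = subspace_scale[OF D] and D_diff = subspace_diff[OF D]
  have add': "Q w (u + v) = Q w u + Q w v" if "u \<in> D" "v \<in> D" "w \<in> D" for u v w
    using add[OF that] by (simp add: sym)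
  have scale': "Q w (c *\<^sub>R u) = c * Q w u" if "u \<in> D" "w \<in> D" for c u w
    using scale[OF that] by (simp add: sym)
  have diff: "Q (u - v) w = Q u w - Q v w" if "u \<in> D" "v \<in> D" "w \<in> D" for u v w
    using add[of u "(-1) *\<^sub>R v" w] scale[of v w "-1"] D_scale[of v "-1"] that by simp
  have expand: "Q (u + t *\<^sub>R g) (u + t *\<^sub>R g) = Q u u + 2 * t * Q u g + t\<^sup>2 * Q g g"
    if "u \<in> D" "g \<in> D" for u g t
    using that D_scale[OF that(2), of t] D_add[OF that(1) D_scale[OF that(2), of t]]
    by (simp add: add add' scale scale' sym[of g u] power2_eq_square distrib_left)
  have nonneg: "0 \<le> Q u u" if "u \<in> D" for u
    using coercive[OF that] zero_le_power2[of "norm u"] by linarith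
  define J where "J u = Q u u - 2 * inner f u" for u
  have J_lower: "- (norm f)\<^sup>2 \<le> J u" if "u \<in> D" for u
  proof -
    have "0 \<le> (norm f - norm u)\<^sup>2" by simp
    then show ?thesis
      using coercive[OF that] norm_cauchy_schwarz[of f u] by (simp add: J_def power2_diff)
  qed
  define m where "m = Inf (J ` D)"
  have bdd: "bdd_below (J ` D)" using J_lower by (intro bdd_belowI[of _ "- (norm f)\<^sup>2"]) auto
  have m_le: "m \<le> J u" if "u \<in> D" for u unfolding m_def using bdd that by (intro cInf_lower) auto
  have "J ` D \<noteq> {}" using subspace_0[OF D] by blast
  have "\<exists>x. x \<in> D \<and> J x < m + inverse (Suc n)" for n :: nat
  proof -
    have "Inf (J ` D) < m + inverse (Suc n)" by (simp add: m_def)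
    then show ?thesis using cInf_less_iff[OF \<open>J ` D \<noteq> {}\<close> bdd] by blast
  qed
  then obtain X where X: "\<And>n. X n \<in> D" "\<And>n::nat. J (X n) < m + inverse (Suc n)" by metis
  have "\<exists>N. \<forall>a\<ge>N. \<forall>b\<ge>N. Q (X a - X b) (X a - X b) < \<epsilon>" if "0 < \<epsilon>" for \<epsilon>
  proof -
    obtain N where N: "inverse (Suc N) < \<epsilon> / 4" using reals_Archimedean[of "\<epsilon> / 4"] \<open>0 < \<epsilon>\<close> by auto
    have "Q (X a - X b) (X a - X b) < \<epsilon>" if "N \<le> a" "N \<le> b" for a b
    proof -
      define s where "s = X a + X b"
      define c where "c = (1 / 2) *\<^sub>R s"
      have s: "s \<in> D" and c: "c \<in> D" unfolding c_def s_def by (intro D_add D_scale X)+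
      have plus: "Q s s = Q (X a) (X a) + 2 * Q (X a) (X b) + Q (X b) (X b)"
        using expand[OF X(1) X(1), of a 1 b] by (simp add: s_def)
      have minus: "Q (X a - X b) (X a - X b) = Q (X a) (X a) - 2 * Q (X a) (X b) + Q (X b) (X b)"
        using expand[OF X(1) X(1), of a "-1" b] by simp
      have quarter: "Q c c = Q s s / 4"
        unfolding c_def using scale[OF s D_scale[OF s, of "1/2"], of "1/2"] scale'[OF s s, of "1/2"] by simp
      have half: "inner f c = (inner f (X a) + inner f (X b)) / 2"
        by (simp add: c_def s_def inner_add_right)
      have "Q (X a - X b) (X a - X b) = 2 * J (X a) + 2 * J (X b) - 4 * J c"
        unfolding J_def quarter half plus minus by (simp add: field_simps)
      moreover have "m \<le> J c" by (rule m_le[OF c])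
      moreover have "inverse (real (Suc a)) \<le> inverse (real (Suc N))" "inverse (real (Suc b)) \<le> inverse (real (Suc N))"
        using that by (auto intro!: le_imp_inverse_le)
      ultimately show ?thesis
        using X(2)[of a] X(2)[of b] N by linarith
    qed
    then show ?thesis by blast
  qed
  from complete[OF X(1) this] obtain u where u: "u \<in> D" and lim: "(\<lambda>n. Q (X n - u) (X n - u)) \<longlonglongrightarrow> 0"
    by blast
  have "Q u g = inner f g" if g: "g \<in> D" for g
  proof -
    have bound1: "(Q (X n) g - inner f g)\<^sup>2 \<le> inverse (Suc n) * (Q g g + 1)" for n
    proof (rule discriminant_bound[OF _ nonneg[OF g]])
      fix t
      have "m \<le> J (X n + t *\<^sub>R g)" by (intro m_le D_add D_scale X g)
      also have "\<dots> = J (X n) + 2 * t * (Q (X n) g - inner f g) + t\<^sup>2 * Q g g"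
        unfolding J_def expand[OF X(1) g] by (simp add: inner_add_right algebra_simps)
      finally show "0 \<le> inverse (Suc n) + 2 * t * (Q (X n) g - inner f g) + t\<^sup>2 * Q g g"
        using X(2)[of n] by linarith
    qed
    have bound2: "(Q (X n - u) g)\<^sup>2 \<le> Q (X n - u) (X n - u) * (Q g g + 1)" for n
    proof (rule discriminant_bound[OF _ nonneg[OF g]])
      show "0 \<le> Q (X n - u) (X n - u) + 2 * t * Q (X n - u) g + t\<^sup>2 * Q g g" for t
        unfolding expand[OF D_diff[OF X(1) u] g, symmetric]
        by (intro nonneg D_add D_diff D_scale X u g)
    qed
    have bound: "(Q u g - inner f g)\<^sup>2 \<le> 2 * (inverse (Suc n) * (Q g g + 1)) + 2 * (Q (X n - u) (X n - u) * (Q g g + 1))" for n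
    proof -
      have "Q u g - inner f g = (Q (X n) g - inner f g) - Q (X n - u) g"
        using diff[OF X(1) u g, of n] by simp
      moreover have "(a - b)\<^sup>2 \<le> 2 * a\<^sup>2 + 2 * b\<^sup>2" for a b :: real
        using zero_le_power2[of "a + b"] by (simp add: power2_sum power2_diff)
      ultimately have "(Q u g - inner f g)\<^sup>2 \<le> 2 * (Q (X n) g - inner f g)\<^sup>2 + 2 * (Q (X n - u) g)\<^sup>2"
        by metis
      then show ?thesis using bound1[of n] bound2[of n] by linarith
    qed
    have "(\<lambda>n. 2 * (inverse (Suc n) * (Q g g + 1)) + 2 * (Q (X n - u) (X n - u) * (Q g g + 1)))
        \<longlonglongrightarrow> 2 * (0 * (Q g g + 1)) + 2 * (0 * (Q g g + 1))"
      by (intro tendsto_intros lim LIMSEQ_inverse_real_of_nat)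
    then have "(Q u g - inner f g)\<^sup>2 \<le> 2 * (0 * (Q g g + 1)) + 2 * (0 * (Q g g + 1))"
      by (rule LIMSEQ_le_const) (use bound in blast)
    then show ?thesis by simp
  qed
  with u show ?thesis by blast
qed

definition energy_inner :: "real \<Rightarrow> 'a::metric_measure_space L2 \<Rightarrow> 'a L2 \<Rightarrow> real" where
  "energy_inner \<delta> u v = inner u v + dirichlet_form \<delta> u v"

text \<open>The $L^2$-limit $u$ of an energy Cauchy sequence is also its limit in energy: the energy of $u-X_k$ is
  bounded by lower semicontinuity along an almost everywhere convergent subsequence of $X$.\<close>

lemma dirichlet_dom_complete:
  fixes X :: "nat \<Rightarrow> 'a::metric_measure_space L2"
  assumes X: "\<And>n. X n \<in> dirichlet_dom \<delta>"
    and Cauchy: "\<And>\<epsilon>. 0 < \<epsilon> \<Longrightarrow> \<exists>N. \<forall>m\<ge>N. \<forall>n\<ge>N. energy_inner \<delta> (X m - X n) (X m - X n) < \<epsilon>"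
  shows "\<exists>u\<in>dirichlet_dom \<delta>. (\<lambda>n. energy_inner \<delta> (X n - u) (X n - u)) \<longlonglongrightarrow> 0"
proof -
  note diff_dom = subspace_diff[OF subspace_dirichlet_dom]
  have norm_le: "(norm v)\<^sup>2 \<le> energy_inner \<delta> v v" if "v \<in> dirichlet_dom \<delta>" for v
    using dirichlet_form_nonneg[OF that] by (simp add: energy_inner_def power2_norm_eq_inner)
  have "Cauchy X"
  proof (rule CauchyI)
    fix \<epsilon> :: real assume "0 < \<epsilon>"
    then obtain N where N: "\<forall>m\<ge>N. \<forall>n\<ge>N. energy_inner \<delta> (X m - X n) (X m - X n) < \<epsilon>\<^sup>2"
      using Cauchy[of "\<epsilon>\<^sup>2"] by auto
    have "norm (X m - X n) < \<epsilon>" if "N \<le> m" "N \<le> n" for m n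
    proof -
      have "(norm (X m - X n))\<^sup>2 < \<epsilon>\<^sup>2"
        using norm_le[OF diff_dom[OF X X], of m n] N that by (meson le_less_trans)
      then show ?thesis by (rule power2_less_imp_less) (use \<open>0 < \<epsilon>\<close> in simp)
    qed
    then show "\<exists>N. \<forall>m\<ge>N. \<forall>n\<ge>N. norm (X m - X n) < \<epsilon>" by blast
  qed
  then obtain r u where r: "strict_mono r" and lim: "X \<longlonglongrightarrow> u"
    and ae: "AE x in mmeasure. (\<lambda>n. rep_L2 (X (r n)) x) \<longlonglongrightarrow> rep_L2 u x"
    by (rule L2_Cauchy_limit)
  have energy: "dirichlet_energy \<delta> (u - X k) \<le> ennreal (2 * \<epsilon>)"
    if N: "\<forall>m\<ge>N. \<forall>n\<ge>N. energy_inner \<delta> (X m - X n) (X m - X n) < \<epsilon>" and k: "N \<le> k" for k N \<epsilon>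
  proof (rule dirichlet_energy_limit_le[OF ae])
    have "dirichlet_energy \<delta> (X (r n) - X k) \<le> ennreal (2 * \<epsilon>)" if "N \<le> n" for n
    proof -
      have "N \<le> r n" using seq_suble[OF r, of n] that by simp
      then have "energy_inner \<delta> (X (r n) - X k) (X (r n) - X k) < \<epsilon>" using N k by blast
      then have "dirichlet_form \<delta> (X (r n) - X k) (X (r n) - X k) \<le> \<epsilon>"
        using inner_ge_zero[of "X (r n) - X k"] unfolding energy_inner_def by linarith
      then show ?thesis
        unfolding dirichlet_energy_eq_form[OF diff_dom[OF X X]] by (intro ennreal_leI) simp
    qed
    then show "\<forall>\<^sub>F n in sequentially. dirichlet_energy \<delta> (X (r n) - X k) \<le> ennreal (2 * \<epsilon>)"
      by (rule eventually_sequentiallyI)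
  qed
  have diff_mem: "u - X k \<in> dirichlet_dom \<delta>"
    if "\<forall>m\<ge>N. \<forall>n\<ge>N. energy_inner \<delta> (X m - X n) (X m - X n) < \<epsilon>" "N \<le> k" for k N \<epsilon>
    using le_less_trans[OF energy[OF that]] by (simp add: dirichlet_dom_def)
  have u: "u \<in> dirichlet_dom \<delta>"
  proof -
    obtain N where "\<forall>m\<ge>N. \<forall>n\<ge>N. energy_inner \<delta> (X m - X n) (X m - X n) < 1" using Cauchy[of 1] by auto
    then have "u - X N \<in> dirichlet_dom \<delta>" by (rule diff_mem) simp
    from subspace_add[OF subspace_dirichlet_dom this X[of N]] show ?thesis by simp
  qed
  have "(\<lambda>n. energy_inner \<delta> (X n - u) (X n - u)) \<longlonglongrightarrow> 0"
  proof (rule LIMSEQ_I)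
    fix \<epsilon> :: real assume "0 < \<epsilon>"
    then obtain N where N: "\<forall>m\<ge>N. \<forall>n\<ge>N. energy_inner \<delta> (X m - X n) (X m - X n) < \<epsilon> / 2"
      using Cauchy[of "\<epsilon> / 2"] by auto
    obtain M where M: "\<And>n. M \<le> n \<Longrightarrow> norm (X n - u) < sqrt (\<epsilon> / 2)"
      using LIMSEQ_D[OF lim, of "sqrt (\<epsilon> / 2)"] \<open>0 < \<epsilon>\<close> by auto
    have "norm (energy_inner \<delta> (X n - u) (X n - u) - 0) < \<epsilon>" if "max N M \<le> n" for n
    proof -
      have mem: "X n - u \<in> dirichlet_dom \<delta>" by (rule diff_dom[OF X u])
      have "ennreal (2 * dirichlet_form \<delta> (u - X n) (u - X n)) \<le> ennreal (2 * (\<epsilon> / 2))"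
        unfolding dirichlet_energy_eq_form[OF diff_dom[OF u X], symmetric]
        using that by (intro energy[OF N]) simp
      then have "2 * dirichlet_form \<delta> (u - X n) (u - X n) \<le> 2 * (\<epsilon> / 2)"
        using \<open>0 < \<epsilon>\<close> by (subst (asm) ennreal_le_iff) auto
      moreover have "dirichlet_form \<delta> (u - X n) (u - X n) = dirichlet_form \<delta> (X n - u) (X n - u)"
        using dirichlet_form_scaleR_left[OF mem mem, of "-1"]
          dirichlet_form_scaleR_left[OF mem diff_dom[OF u X], of "-1" n]
        by (simp add: dirichlet_form_commute[of \<delta> "X n - u" "u - X n"])
      moreover have "(norm (X n - u))\<^sup>2 < (sqrt (\<epsilon> / 2))\<^sup>2"
        using M[of n] that by (intro power_strict_mono) auto
      then have "inner (X n - u) (X n - u) < \<epsilon> / 2"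
        using \<open>0 < \<epsilon>\<close> by (simp add: power2_norm_eq_inner)
      ultimately show ?thesis
        using dirichlet_form_nonneg[OF mem] inner_ge_zero[of "X n - u"] unfolding energy_inner_def real_norm_def
        by linarith
    qed
    then show "\<exists>N. \<forall>n\<ge>N. norm (energy_inner \<delta> (X n - u) (X n - u) - 0) < \<epsilon>" by blast
  qed
  with u show ?thesis by blast
qed

lemma form_resolvent_unique:
  assumes "u \<in> dirichlet_dom \<delta>" "u' \<in> dirichlet_dom \<delta>"
    and "\<And>g. g \<in> dirichlet_dom \<delta> \<Longrightarrow> energy_inner \<delta> u g = energy_inner \<delta> u' g"
  shows "u = u'"
proof -
  have d: "u - u' \<in> dirichlet_dom \<delta>" by (rule subspace_diff[OF subspace_dirichlet_dom assms(1,2)])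
  have neg: "(-1) *\<^sub>R u' \<in> dirichlet_dom \<delta>" by (rule subspace_scale[OF subspace_dirichlet_dom assms(2)])
  have "dirichlet_form \<delta> (u - u') (u - u') = dirichlet_form \<delta> u (u - u') - dirichlet_form \<delta> u' (u - u')"
    using dirichlet_form_add_left[OF assms(1) neg d] dirichlet_form_scaleR_left[OF assms(2) d, of "-1"] by simp
  then have "inner (u - u') (u - u') + dirichlet_form \<delta> (u - u') (u - u') = 0"
    using assms(3)[OF d] by (simp add: energy_inner_def inner_diff_left)
  then have "inner (u - u') (u - u') = 0"
    using dirichlet_form_nonneg[OF d] inner_ge_zero[of "u - u'"] by linarith
  then show ?thesis by simp
qed

lemma form_resolvent:
  shows form_resolvent_dom: "form_resolvent \<delta> f \<in> dirichlet_dom \<delta>"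
    and energy_inner_form_resolvent: "g \<in> dirichlet_dom \<delta> \<Longrightarrow> energy_inner \<delta> (form_resolvent \<delta> f) g = inner f g"
proof -
  have "\<exists>u\<in>dirichlet_dom \<delta>. \<forall>g\<in>dirichlet_dom \<delta>. energy_inner \<delta> u g = inner f g"
  proof (rule closed_form_representation[where Q = "energy_inner \<delta>", OF subspace_dirichlet_dom _ _ _ _ dirichlet_dom_complete])
    show "energy_inner \<delta> (u + v) w = energy_inner \<delta> u w + energy_inner \<delta> v w"
      if "u \<in> dirichlet_dom \<delta>" "v \<in> dirichlet_dom \<delta>" "w \<in> dirichlet_dom \<delta>" for u v w
      by (simp add: energy_inner_def inner_add_left dirichlet_form_add_left[OF that])
    show "energy_inner \<delta> (c *\<^sub>R u) w = c * energy_inner \<delta> u w"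
      if "u \<in> dirichlet_dom \<delta>" "w \<in> dirichlet_dom \<delta>" for c u w
      by (simp add: energy_inner_def dirichlet_form_scaleR_left[OF that] distrib_left)
    show "energy_inner \<delta> u v = energy_inner \<delta> v u" for u v
      by (simp add: energy_inner_def inner_commute[of u v] dirichlet_form_commute[of \<delta> u v])
    show "(norm u)\<^sup>2 \<le> energy_inner \<delta> u u" if "u \<in> dirichlet_dom \<delta>" for u
      using dirichlet_form_nonneg[OF that] by (simp add: energy_inner_def power2_norm_eq_inner)
  qed
  then obtain u where u: "u \<in> dirichlet_dom \<delta>" "\<And>g. g \<in> dirichlet_dom \<delta> \<Longrightarrow> energy_inner \<delta> u g = inner f g"
    by blast
  have "form_resolvent \<delta> f \<in> dirichlet_dom \<delta> \<and>
      (\<forall>g\<in>dirichlet_dom \<delta>. inner (form_resolvent \<delta> f) g + dirichlet_form \<delta> (form_resolvent \<delta> f) g = inner f g)"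
    unfolding form_resolvent_def
  proof (rule theI)
    show "u \<in> dirichlet_dom \<delta> \<and> (\<forall>g\<in>dirichlet_dom \<delta>. inner u g + dirichlet_form \<delta> u g = inner f g)"
      using u by (simp add: energy_inner_def)
    show "u' = u" if "u' \<in> dirichlet_dom \<delta> \<and> (\<forall>g\<in>dirichlet_dom \<delta>. inner u' g + dirichlet_form \<delta> u' g = inner f g)" for u'
      using that u by (intro form_resolvent_unique) (auto simp: energy_inner_def)
  qed
  then show "form_resolvent \<delta> f \<in> dirichlet_dom \<delta>"
    and "g \<in> dirichlet_dom \<delta> \<Longrightarrow> energy_inner \<delta> (form_resolvent \<delta> f) g = inner f g"
    by (auto simp: energy_inner_def)
qed

lemma energy_form_resolvent_self:
  "energy_inner \<delta> (form_resolvent \<delta> f) (form_resolvent \<delta> f) = inner (form_resolvent \<delta> f) f"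
  using energy_inner_form_resolvent[OF form_resolvent_dom] by (simp add: inner_commute)

lemma norm_square_form_resolvent_le: "(norm (form_resolvent \<delta> f))\<^sup>2 \<le> inner (form_resolvent \<delta> f) f"
  using dirichlet_form_nonneg[OF form_resolvent_dom, of \<delta> f] energy_form_resolvent_self[of \<delta> f]
  by (simp add: energy_inner_def power2_norm_eq_inner)

lemma norm_form_resolvent_le: "norm (form_resolvent \<delta> f) \<le> norm f"
proof -
  have "norm (form_resolvent \<delta> f) * norm (form_resolvent \<delta> f) \<le> norm (form_resolvent \<delta> f) * norm f"
    using norm_square_form_resolvent_le[of \<delta> f] norm_cauchy_schwarz[of "form_resolvent \<delta> f" f]
    by (simp add: power2_eq_square)
  then show ?thesis
    by (cases "form_resolvent \<delta> f = 0") auto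
qed

lemma inner_form_resolvent_symmetric: "inner (form_resolvent \<delta> f) g = inner f (form_resolvent \<delta> g)"
proof -
  have "inner f (form_resolvent \<delta> g) = energy_inner \<delta> (form_resolvent \<delta> f) (form_resolvent \<delta> g)"
    by (rule energy_inner_form_resolvent[OF form_resolvent_dom, symmetric])
  also have "\<dots> = energy_inner \<delta> (form_resolvent \<delta> g) (form_resolvent \<delta> f)"
    by (simp add: energy_inner_def inner_commute dirichlet_form_commute)
  also have "\<dots> = inner g (form_resolvent \<delta> f)"
    by (rule energy_inner_form_resolvent[OF form_resolvent_dom])
  finally show ?thesis by (simp add: inner_commute)
qed

lemma positive_operator_form_resolvent:
  "positive_operator (form_resolvent \<delta> :: 'a::metric_measure_space L2 \<Rightarrow> 'a L2)"
proof -
  have "\<forall>h. inner (form_resolvent \<delta> (f + g)) h = inner (form_resolvent \<delta> f + form_resolvent \<delta> g) h"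
    "\<forall>h. inner (form_resolvent \<delta> (c *\<^sub>R f)) h = inner (c *\<^sub>R form_resolvent \<delta> f) h"
    for c and f g :: "'a L2"
    by (simp_all add: inner_form_resolvent_symmetric inner_add_left)
  then have "form_resolvent \<delta> (f + g) = form_resolvent \<delta> f + form_resolvent \<delta> g"
    "form_resolvent \<delta> (c *\<^sub>R f) = c *\<^sub>R form_resolvent \<delta> f" for c and f g :: "'a L2"
    by (simp_all only: vector_eq_rdot)
  then have "bounded_linear (form_resolvent \<delta> :: 'a L2 \<Rightarrow> 'a L2)"
    by (intro bounded_linear_intro[where K = 1]) (auto simp: norm_form_resolvent_le)
  moreover have "0 \<le> inner (form_resolvent \<delta> f) f" for f :: "'a L2"
    using norm_square_form_resolvent_le[of \<delta> f] zero_le_power2[of "norm (form_resolvent \<delta> f)"] by linarith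
  ultimately show ?thesis
    by (simp add: positive_operator_def inner_form_resolvent_symmetric)
qed

lemma inverse_one_plus_log_laplacian: "inverse_one_plus (log_laplacian \<delta>) = form_resolvent \<delta>"
proof
  fix f :: "'a L2"
  show "inverse_one_plus (log_laplacian \<delta>) f = form_resolvent \<delta> f"
    unfolding inverse_one_plus_def by (rule the_equality) (auto simp: log_laplacian_def)
qed

section \<open>Density of the form domain\<close>

text \<open>Ahlfors regularity at the radii $\rho 2^{-j}$ below the diameter, the form in which it enters sums over
  dyadic scales.\<close>

locale dyadic_regularity =
  fixes ty :: "'a::metric_measure_space itself" and \<delta> \<rho> a b :: real
  assumes \<delta>_pos: "0 < \<delta>" and \<rho>_pos: "0 < \<rho>" and a_pos: "0 < a"
    and ball_lower: "\<And>(x :: 'a) j. a / (2 powr \<delta>) ^ j \<le> measure mmeasure (cball x (\<rho> / 2 ^ j))"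
    and ball_upper: "\<And>(x :: 'a) j. measure mmeasure (cball x (\<rho> / 2 ^ j)) \<le> b / (2 powr \<delta>) ^ j"

lemma radius_powr: "0 < \<rho> \<Longrightarrow> (\<rho> / 2 ^ j) powr \<delta> = \<rho> powr \<delta> / (2 powr \<delta>) ^ j" for \<rho> :: real
  by (simp add: powr_divide powr_realpow[symmetric] powr_powr mult.commute flip: powr_power)

lemma dyadic_regularity_if_ahlfors_regular:
  assumes reg: "ahlfors_regular TYPE('a::metric_measure_space) \<delta>" and "0 < \<delta>" and "x0 \<noteq> (y0 :: 'a)"
  obtains \<rho> a b where "dyadic_regularity TYPE('a) \<delta> \<rho> a b"
proof -
  obtain C where "C \<ge> 1" and C: "\<And>(x::'a) r. 0 \<le> r \<Longrightarrow> ereal r < (SUP y::'a. SUP z::'a. ereal (dist y z)) \<Longrightarrow>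
       inverse C * r powr \<delta> \<le> measure mmeasure (cball x r) \<and> measure mmeasure (cball x r) \<le> C * r powr \<delta>"
    using reg unfolding ahlfors_regular_def by blast
  define \<rho> where "\<rho> = dist x0 y0 / 2"
  have "0 < \<rho>" using \<open>x0 \<noteq> y0\<close> by (simp add: \<rho>_def)
  have small: "ereal (\<rho> / 2 ^ j) < (SUP y::'a. SUP z::'a. ereal (dist y z))" for j :: nat
  proof -
    have "\<rho> / 2 ^ j \<le> \<rho>" using \<open>0 < \<rho>\<close> by (simp add: field_simps)
    also have "\<rho> < dist x0 y0" using \<open>x0 \<noteq> y0\<close> by (simp add: \<rho>_def)
    finally have "ereal (\<rho> / 2 ^ j) < ereal (dist x0 y0)" by simp
    also have "\<dots> \<le> (SUP y::'a. SUP z::'a. ereal (dist y z))"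
      by (meson SUP_upper SUP_upper2 UNIV_I)
    finally show ?thesis .
  qed
  have "dyadic_regularity TYPE('a) \<delta> \<rho> (inverse C * \<rho> powr \<delta>) (C * \<rho> powr \<delta>)"
  proof
    show "inverse C * \<rho> powr \<delta> / (2 powr \<delta>) ^ j \<le> measure mmeasure (cball x (\<rho> / 2 ^ j))"
      and "measure mmeasure (cball x (\<rho> / 2 ^ j)) \<le> C * \<rho> powr \<delta> / (2 powr \<delta>) ^ j" for x :: 'a and j
      using C[OF _ small, of j x] \<open>0 < \<rho>\<close> by (simp_all add: radius_powr)
  qed (use \<open>0 < \<delta>\<close> \<open>0 < \<rho>\<close> \<open>C \<ge> 1\<close> in auto)
  then show ?thesis by (rule that)
qed

lemma borel_measurable_mmeasure_continuous:
  "continuous_on UNIV f \<Longrightarrow> f \<in> borel_measurable (mmeasure :: 'a::metric_measure_space measure)"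
  by (subst measurable_cong_sets[OF sets_mmeasure refl]) (rule borel_measurable_continuous_onI)

lemma square_integrable_bounded:
  fixes f :: "'a::metric_measure_space \<Rightarrow> real"
  assumes [measurable]: "f \<in> borel_measurable mmeasure" and bound: "\<And>x. \<bar>f x\<bar> \<le> M"
  shows "square_integrable f"
proof -
  have "(f x)\<^sup>2 \<le> M\<^sup>2" for x using power_mono[OF bound[of x], of 2] by simp
  then have "integrable mmeasure (\<lambda>x. (f x)\<^sup>2)"
    by (intro mmeasure.integrable_const_bound[where B = "M\<^sup>2"]) auto
  then show ?thesis by (simp add: square_integrable_def)
qed

context dyadic_regularity
begin

abbreviation q :: real where "q \<equiv> 2 powr \<delta>"

lemma q_gt_1: "1 < q"
  using \<delta>_pos by simp

text \<open>Where $\rho 2^{-j-1} < d(x,y) \le \rho 2^{-j}$, the integrand of the energy of a Lipschitz function is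
  of size $(q/4)^j$, and this annulus has measure of order $q^{-j}$; the contributions $4^{-j}$ are summable.\<close>

lemma lipschitz_in_dirichlet_dom:
  fixes \<phi> :: "'a \<Rightarrow> real"
  assumes range: "\<And>x. 0 \<le> \<phi> x" "\<And>x. \<phi> x \<le> 1" and "0 \<le> L" and lip: "\<And>x y. \<bar>\<phi> x - \<phi> y\<bar> \<le> L * dist x y"
  shows "square_integrable \<phi>" and "abs_L2 \<phi> \<in> dirichlet_dom \<delta>"
proof -
  have cont: "continuous_on UNIV \<phi>"
  proof (rule lipschitz_on_continuous_on[of L])
    show "L-lipschitz_on UNIV \<phi>" using lip \<open>0 \<le> L\<close> by (intro lipschitz_onI) (auto simp: dist_real_def)
  qed
  then have [measurable]: "\<phi> \<in> borel_measurable mmeasure" by (rule borel_measurable_mmeasure_continuous)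
  show sq: "square_integrable \<phi>"
    by (rule square_integrable_bounded[where M = 1]) (use range in auto)
  define c where "c = L\<^sup>2 * \<rho>\<^sup>2 * q / \<rho> powr \<delta>"
  have "0 \<le> c" using \<rho>_pos by (simp add: c_def)
  let ?I = "\<lambda>j p. indicator {p. dist (fst p) (snd p) \<le> \<rho> / 2 ^ j} (p :: 'a \<times> 'a)"
  have pointwise: "ennreal ((diff_quotient \<delta> \<phi> p)\<^sup>2) \<le>
      ennreal (inverse (\<rho> powr \<delta>)) + (\<Sum>j. ennreal (c * (q / 4) ^ j) * ?I j p)" for p
  proof -
    obtain x y where p: "p = (x, y)" by (cases p)
    consider "x = y" | "\<rho> < dist x y" | "0 < dist x y" "dist x y \<le> \<rho>" by fastforce
    then show ?thesis
    proof cases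
      case 1
      then show ?thesis by (simp add: p diff_quotient_def)
    next
      case 2
      have "(\<phi> x - \<phi> y)\<^sup>2 \<le> 1"
        using range[of x] range[of y] by (auto simp: abs_square_le_1 abs_le_iff)
      moreover have "\<rho> powr \<delta> \<le> dist x y powr \<delta>" using 2 \<rho>_pos \<delta>_pos by (intro powr_mono2) auto
      ultimately have "(\<phi> x - \<phi> y)\<^sup>2 / dist x y powr \<delta> \<le> 1 / \<rho> powr \<delta>"
        using \<rho>_pos by (intro frac_le) auto
      then have "ennreal ((diff_quotient \<delta> \<phi> p)\<^sup>2) \<le> ennreal (inverse (\<rho> powr \<delta>))"
        by (intro ennreal_leI) (simp add: p diff_quotient_square divide_inverse)
      then show ?thesis by (rule order_trans) simp
    next
      case 3
      define g where "g i = ennreal (c * (q / 4) ^ i) * ?I i p" for i :: nat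
      have "\<exists>n. \<rho> / 2 ^ n < dist x y"
        using real_arch_pow_inv[of "dist x y / \<rho>" "1 / 2"] 3 \<rho>_pos by (auto simp: field_simps power_divide)
      then obtain n where n: "\<rho> / 2 ^ n < dist x y" and least: "\<And>i. i < n \<Longrightarrow> \<not> \<rho> / 2 ^ i < dist x y"
        using exists_least_iff[of "\<lambda>n. \<rho> / 2 ^ n < dist x y"] by blast
      have "n \<noteq> 0" using n 3 by (intro notI) simp
      then obtain j where j: "n = Suc j" by (cases n) auto
      have upper: "dist x y \<le> \<rho> / 2 ^ j" using least[of j] by (simp add: j)
      have "\<bar>\<phi> x - \<phi> y\<bar> \<le> L * (\<rho> / 2 ^ j)"
        using lip[of x y] mult_left_mono[OF upper \<open>0 \<le> L\<close>] by linarith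
      then have "(\<phi> x - \<phi> y)\<^sup>2 \<le> (L * (\<rho> / 2 ^ j))\<^sup>2"
        by (metis abs_ge_zero power2_abs power_mono)
      moreover have "\<rho> powr \<delta> / q ^ Suc j \<le> dist x y powr \<delta>"
        using n \<rho>_pos \<delta>_pos unfolding j by (subst radius_powr[symmetric]) (auto intro!: powr_mono2)
      ultimately have "(\<phi> x - \<phi> y)\<^sup>2 / dist x y powr \<delta> \<le> (L * (\<rho> / 2 ^ j))\<^sup>2 / (\<rho> powr \<delta> / q ^ Suc j)"
        using \<rho>_pos by (intro frac_le) auto
      also have "\<dots> = c * (q / 4) ^ j"
      proof -
        have "(2 ^ j)\<^sup>2 = (4 :: real) ^ j" by (simp add: power2_eq_square flip: power_mult_distrib)
        then show ?thesis by (simp add: c_def power_mult_distrib power_divide mult_ac)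
      qed
      finally have "ennreal ((diff_quotient \<delta> \<phi> p)\<^sup>2) \<le> ennreal (c * (q / 4) ^ j)"
        unfolding p diff_quotient_square by (rule ennreal_leI)
      also have "\<dots> = g j"
        using upper by (simp add: p g_def)
      also have "\<dots> = sum g {j}" by simp
      also have "\<dots> \<le> (\<Sum>i. g i)" by (rule sum_le_suminf) auto
      finally show ?thesis
        unfolding g_def by (rule add_increasing[OF zero_le])
    qed
  qed
  let ?N = "mmeasure \<Otimes>\<^sub>M mmeasure :: ('a \<times> 'a) measure"
  let ?m = "measure (mmeasure :: 'a measure) UNIV"
  have ball_N: "(\<integral>\<^sup>+p. ?I j p \<partial>?N) \<le> ennreal (b / q ^ j * ?m)" for j
  proof -
    have "(\<integral>\<^sup>+p. ?I j p \<partial>?N) = (\<integral>\<^sup>+x. (\<integral>\<^sup>+y. ?I j (x, y) \<partial>mmeasure) \<partial>mmeasure)"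
      by (rule mmeasure.nn_integral_fst[symmetric]) measurable
    also have "\<dots> = (\<integral>\<^sup>+x. emeasure mmeasure (cball (x :: 'a) (\<rho> / 2 ^ j)) \<partial>mmeasure)"
    proof (rule nn_integral_cong)
      fix x :: 'a
      have "(\<integral>\<^sup>+y. ?I j (x, y) \<partial>mmeasure) = (\<integral>\<^sup>+y. indicator (cball x (\<rho> / 2 ^ j)) y \<partial>mmeasure)"
        by (intro nn_integral_cong) (auto simp: indicator_def)
      then show "(\<integral>\<^sup>+y. ?I j (x, y) \<partial>mmeasure) = emeasure mmeasure (cball x (\<rho> / 2 ^ j))"
        by (simp add: sets_mmeasure)
    qed
    also have "\<dots> \<le> (\<integral>\<^sup>+x. ennreal (b / q ^ j) \<partial>(mmeasure :: 'a measure))"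
      by (intro nn_integral_mono) (auto simp: mmeasure.emeasure_eq_measure intro!: ennreal_leI ball_upper)
    also have "\<dots> = ennreal (b / q ^ j) * ennreal ?m"
      by (simp only: nn_integral_const space_mmeasure mmeasure.emeasure_eq_measure)
    also have "\<dots> = ennreal (b / q ^ j * ?m)"
      by (rule ennreal_mult[symmetric]) (rule order_trans[OF measure_nonneg ball_upper], rule measure_nonneg)
    finally show ?thesis .
  qed
  have "0 \<le> b / q ^ 0"
    by (rule order_trans[OF measure_nonneg ball_upper])
  then have b: "0 \<le> b" by simp
  have "dirichlet_energy \<delta> (abs_L2 \<phi>) = (\<integral>\<^sup>+p. ennreal ((diff_quotient \<delta> \<phi> p)\<^sup>2) \<partial>?N)"
    by (rule dirichlet_energy_abs[OF sq])
  also have "\<dots> \<le> (\<integral>\<^sup>+p. ennreal (inverse (\<rho> powr \<delta>)) + (\<Sum>j. ennreal (c * (q / 4) ^ j) * ?I j p) \<partial>?N)"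
    by (intro nn_integral_mono pointwise)
  also have "\<dots> = ennreal (inverse (\<rho> powr \<delta>)) * emeasure ?N (space ?N) +
      (\<Sum>j. ennreal (c * (q / 4) ^ j) * (\<integral>\<^sup>+p. ?I j p \<partial>?N))"
    by (subst nn_integral_add) (auto simp: nn_integral_suminf nn_integral_cmult)
  also have "\<dots> \<le> ennreal (inverse (\<rho> powr \<delta>)) * emeasure ?N (space ?N) +
      (\<Sum>j. ennreal (c * b * ?m * (1 / 4) ^ j))"
  proof (intro add_left_mono suminf_le)
    fix j
    have "ennreal (c * (q / 4) ^ j) * (\<integral>\<^sup>+p. ?I j p \<partial>?N) \<le> ennreal (c * (q / 4) ^ j) * ennreal (b / q ^ j * ?m)"
      by (intro mult_left_mono ball_N) simp
    also have "\<dots> = ennreal (c * (q / 4) ^ j * (b / q ^ j * ?m))"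
      using \<open>0 \<le> c\<close> b by (subst ennreal_mult) auto
    also have "c * (q / 4) ^ j * (b / q ^ j * ?m) = c * b * ?m * (1 / 4) ^ j"
      by (simp add: power_divide)
    finally show "ennreal (c * (q / 4) ^ j) * (\<integral>\<^sup>+p. ?I j p \<partial>?N) \<le> ennreal (c * b * ?m * (1 / 4) ^ j)" .
  qed auto
  also have "\<dots> < \<infinity>"
  proof -
    have "emeasure ?N (space ?N) < \<infinity>"
      using finite_measure.emeasure_finite[OF finite_measure_pair_measure[OF finite_mmeasure finite_mmeasure], of "space ?N"]
      by (simp add: less_top)
    moreover have "(\<Sum>j. ennreal (c * b * ?m * (1 / 4) ^ j)) < \<infinity>"
      using \<open>0 \<le> c\<close> b by (subst suminf_ennreal2) (auto intro!: summable_mult summable_geometric)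
    ultimately show ?thesis by (simp add: ennreal_mult_less_top)
  qed
  finally show "abs_L2 \<phi> \<in> dirichlet_dom \<delta>" by (simp add: dirichlet_dom_def)
qed

text \<open>Bounded Lipschitz functions approximate indicators of open sets, and open sets generate the
  Borel sets.\<close>

lemma orthogonal_to_dirichlet_dom:
  fixes f :: "'a L2"
  assumes orth: "\<And>g. g \<in> dirichlet_dom \<delta> \<Longrightarrow> inner f g = 0"
  shows "f = 0"
proof -
  let ?f = "rep_L2 f"
  have int_f: "integrable mmeasure ?f"
  proof -
    have "square_integrable (\<lambda>x :: 'a. 1)" by (rule square_integrable_bounded[where M = 1]) auto
    from square_integrable_mult[OF square_integrable_rep this, of f] show ?thesis by simp
  qed
  have test: "(\<integral>x. \<phi> x * ?f x \<partial>mmeasure) = 0"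
    if "\<And>x. 0 \<le> \<phi> x" "\<And>x. \<phi> x \<le> 1" "0 \<le> L" "\<And>x y. \<bar>\<phi> x - \<phi> y\<bar> \<le> L * dist x y" for \<phi> L
    using orth[OF lipschitz_in_dirichlet_dom(2)[OF that]] inner_L2_abs[OF lipschitz_in_dirichlet_dom(1)[OF that], of f]
    by (simp add: inner_commute)
  have "open U \<Longrightarrow> (\<integral>x. indicator U x * ?f x \<partial>mmeasure) = 0" for U :: "'a set"
  proof (cases "U = UNIV")
    case True
    then show ?thesis using test[of "\<lambda>x. 1" 0] by simp
  next
    case False
    assume "open U"
    define \<phi> where "\<phi> n x = min 1 (real n * infdist x (- U))" for n x
    have \<phi>_range: "0 \<le> \<phi> n x" "\<phi> n x \<le> 1" for n x by (simp_all add: \<phi>_def infdist_nonneg)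
    have "\<bar>\<phi> n x - \<phi> n y\<bar> \<le> real n * dist x y" for n x y
    proof -
      have "\<bar>\<phi> n x - \<phi> n y\<bar> \<le> \<bar>real n * infdist x (- U) - real n * infdist y (- U)\<bar>"
        unfolding \<phi>_def by linarith
      also have "\<dots> = real n * \<bar>infdist x (- U) - infdist y (- U)\<bar>"
        by (simp add: abs_mult flip: right_diff_distrib)
      also have "\<dots> \<le> real n * dist x y" by (intro mult_left_mono infdist_triangle_abs) simp
      finally show ?thesis .
    qed
    then have zero: "(\<integral>x. \<phi> n x * ?f x \<partial>mmeasure) = 0" for n
      using \<phi>_range by (intro test[of "\<phi> n" "real n"]) auto
    have [measurable]: "\<phi> n \<in> borel_measurable mmeasure" for n
      unfolding \<phi>_def[abs_def] by (intro borel_measurable_mmeasure_continuous continuous_intros)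
    have [measurable]: "U \<in> sets mmeasure" using \<open>open U\<close> by (simp add: sets_mmeasure)
    have "(\<lambda>n. \<integral>x. \<phi> n x * ?f x \<partial>mmeasure) \<longlonglongrightarrow> (\<integral>x. indicator U x * ?f x \<partial>mmeasure)"
    proof (rule integral_dominated_convergence[where w = "\<lambda>x. \<bar>?f x\<bar>"])
      show "integrable mmeasure (\<lambda>x. \<bar>?f x\<bar>)" using int_f by simp
      show "AE x in mmeasure. (\<lambda>n. \<phi> n x * ?f x) \<longlonglongrightarrow> indicator U x * ?f x"
      proof (rule AE_I2, rule tendsto_mult[OF _ tendsto_const])
        fix x
        show "(\<lambda>n. \<phi> n x) \<longlonglongrightarrow> indicator U x"
        proof (cases "x \<in> U")
          case True
          then have "0 < infdist x (- U)"
            using \<open>open U\<close> \<open>U \<noteq> UNIV\<close> by (intro infdist_pos_not_in_closed) auto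
          then obtain n0 where n0: "1 < real n0 * infdist x (- U)" using reals_Archimedean3 by blast
          have "\<phi> n x = 1" if "n0 \<le> n" for n
          proof -
            have "real n0 * infdist x (- U) \<le> real n * infdist x (- U)"
              using that by (intro mult_right_mono infdist_nonneg) simp
            then show ?thesis using n0 by (simp add: \<phi>_def)
          qed
          then have "\<forall>\<^sub>F n in sequentially. \<phi> n x = indicator U x"
            using True by (intro eventually_sequentiallyI[of n0]) simp
          then show ?thesis by (rule tendsto_eventually)
        next
          case False
          then show ?thesis by (simp add: \<phi>_def)
        qed
      qed
      show "AE x in mmeasure. norm (\<phi> n x * ?f x) \<le> \<bar>?f x\<bar>" for n
        using \<phi>_range by (intro AE_I2) (simp add: abs_mult mult_left_le_one_le)
    qed auto
    then show ?thesis by (simp add: zero LIMSEQ_const_iff)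
  qed
  then have open_zero: "\<And>U. open U \<Longrightarrow> (\<integral>x. indicator U x * ?f x \<partial>mmeasure) = 0" .
  have borel_zero: "(\<integral>x. indicator B x * ?f x \<partial>mmeasure) = 0" if "B \<in> sigma_sets UNIV {S. open S}" for B
    using _ _ that
  proof (rule sigma_sets_induct_disjoint)
    show "Int_stable {S :: 'a set. open S}" by (auto simp: Int_stable_def)
    show "{S :: 'a set. open S} \<subseteq> Pow UNIV" by simp
    show "(\<integral>x. indicator U x * ?f x \<partial>mmeasure) = 0" if "U \<in> {S. open S}" for U using open_zero that by simp
    show "(\<integral>x. indicator {} x * ?f x \<partial>mmeasure) = 0" by simp
  next
    fix A assume A: "A \<in> sigma_sets UNIV {S :: 'a set. open S}" and zero: "(\<integral>x. indicator A x * ?f x \<partial>mmeasure) = 0"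
    have [measurable]: "A \<in> sets mmeasure" using A by (simp add: sets_mmeasure_sigma)
    have "(\<integral>x. indicator (UNIV - A) x * ?f x \<partial>mmeasure) = (\<integral>x. ?f x - indicator A x * ?f x \<partial>mmeasure)"
      by (rule Bochner_Integration.integral_cong) (auto simp: indicator_def)
    also have "\<dots> = (\<integral>x. ?f x \<partial>mmeasure) - (\<integral>x. indicator A x * ?f x \<partial>mmeasure)"
      by (intro Bochner_Integration.integral_diff int_f Bochner_Integration.integrable_bound[OF int_f])
         (auto simp: indicator_def)
    also have "\<dots> = 0" using zero open_zero[of UNIV] by simp
    finally show "(\<integral>x. indicator (UNIV - A) x * ?f x \<partial>mmeasure) = 0" .
  next
    fix A :: "nat \<Rightarrow> 'a set"
    assume disj: "disjoint_family A" and A: "range A \<subseteq> sigma_sets UNIV {S. open S}"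
      and zero: "\<And>i. (\<integral>x. indicator (A i) x * ?f x \<partial>mmeasure) = 0"
    have A': "A i \<in> sets mmeasure" for i using A by (auto simp: sets_mmeasure_sigma)
    have "set_integrable mmeasure (\<Union>i. A i) ?f"
      unfolding set_integrable_def using A'
      by (intro integrable_mult_indicator int_f) auto
    then have "set_lebesgue_integral mmeasure (\<Union>i. A i) ?f = (\<Sum>i. set_lebesgue_integral mmeasure (A i) ?f)"
      using A' disj by (intro lebesgue_integral_countable_add) (auto simp: disjoint_family_on_def)
    then show "(\<integral>x. indicator (\<Union>i. A i) x * ?f x \<partial>mmeasure) = 0"
      using zero by (simp add: set_lebesgue_integral_def)
  qed
  have "AE x in mmeasure. ?f x = 0"
  proof (rule density_unique_real[OF int_f])
    show "set_lebesgue_integral mmeasure A ?f = set_lebesgue_integral mmeasure A (\<lambda>x. 0)" if "A \<in> sets mmeasure" for A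
      using borel_zero[of A] that by (simp add: set_lebesgue_integral_def sets_mmeasure_sigma)
  qed simp
  then have "abs_L2 ?f = abs_L2 (\<lambda>x. 0)"
    by (intro abs_L2_eqI square_integrable_rep square_integrable_zero)
  then show ?thesis by (simp add: zero_L2.abs_eq)
qed

end

section \<open>Counting directions in which the resolvent is large\<close>

lemma integrable_pair_fst:
  assumes "integrable (mmeasure :: 'a::metric_measure_space measure) h"
  shows "integrable (mmeasure \<Otimes>\<^sub>M mmeasure) (\<lambda>p :: 'a \<times> 'a. h (fst p) :: real)"
proof (rule mmeasure2.Fubini_integrable)
  have [measurable]: "h \<in> borel_measurable mmeasure" using assms by simp
  show "(\<lambda>p :: 'a \<times> 'a. h (fst p)) \<in> borel_measurable (mmeasure \<Otimes>\<^sub>M mmeasure)" by measurable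
  show "integrable mmeasure (\<lambda>x. \<integral>y. norm (h (fst (x, y))) \<partial>(mmeasure :: 'a measure))"
    using assms by simp
qed simp

context dyadic_regularity
begin

text \<open>A bounded truncation of $d(x,y)^{-\delta}$ at scale $\rho 2^{-k}$. Each of its $k$ summands contributes
  at least $a$ to the total mass, so that the mass grows linearly in $k$ although the bound is exponential.\<close>

definition truncated_kernel :: "nat \<Rightarrow> 'a \<Rightarrow> 'a \<Rightarrow> real" where
  "truncated_kernel k x y = (\<Sum>j<k. q ^ j * (if dist x y \<le> \<rho> / 2 ^ j then 1 else 0))"

lemma borel_measurable_truncated_kernel [measurable]:
  "(\<lambda>p. truncated_kernel k (fst p) (snd p)) \<in> borel_measurable (mmeasure \<Otimes>\<^sub>M mmeasure)"
  unfolding truncated_kernel_def by measurable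

lemma borel_measurable_truncated_kernel_section [measurable]:
  "truncated_kernel k x \<in> borel_measurable mmeasure"
  unfolding truncated_kernel_def[abs_def] by measurable

lemma truncated_kernel_nonneg: "0 \<le> truncated_kernel k x y"
  unfolding truncated_kernel_def by (intro sum_nonneg) simp

lemma truncated_kernel_commute: "truncated_kernel k x y = truncated_kernel k y x"
  by (simp add: truncated_kernel_def dist_commute)

lemma truncated_kernel_le: "truncated_kernel k x y \<le> q ^ k / (q - 1)"
proof -
  have "truncated_kernel k x y \<le> (\<Sum>j<k. q ^ j)"
    unfolding truncated_kernel_def by (intro sum_mono) simp
  also have "\<dots> = (q ^ k - 1) / (q - 1)" by (intro geometric_sum) (use \<delta>_pos in simp)
  also have "\<dots> \<le> q ^ k / (q - 1)" using q_gt_1 by (intro divide_right_mono) auto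
  finally show ?thesis .
qed

text \<open>The summands grow geometrically, so that the last one with $d(x,y) \le \rho 2^{-j}$ dominates, and
  $q^j \le (\rho/d(x,y))^\delta$ for it.\<close>

lemma truncated_kernel_mult_dist_le:
  "truncated_kernel k x y * dist x y powr \<delta> \<le> q * \<rho> powr \<delta> / (q - 1)"
proof (induction k)
  case 0
  then show ?case using q_gt_1 by (simp add: truncated_kernel_def)
next
  case (Suc k)
  show ?case
  proof (cases "dist x y \<le> \<rho> / 2 ^ k")
    case True
    have "dist x y powr \<delta> \<le> \<rho> powr \<delta> / q ^ k"
      unfolding radius_powr[OF \<rho>_pos, symmetric] using True \<delta>_pos by (intro powr_mono2) auto
    then have "truncated_kernel (Suc k) x y * dist x y powr \<delta> \<le> q ^ Suc k / (q - 1) * (\<rho> powr \<delta> / q ^ k)"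
      using q_gt_1 by (intro mult_mono truncated_kernel_le) auto
    also have "\<dots> = q * \<rho> powr \<delta> / (q - 1)" using q_gt_1 by simp
    finally show ?thesis .
  next
    case False
    then have "truncated_kernel (Suc k) x y = truncated_kernel k x y" by (simp add: truncated_kernel_def)
    then show ?thesis using Suc.IH by simp
  qed
qed

lemma truncated_kernel_mass: "real k * a \<le> (\<integral>y. truncated_kernel k x y \<partial>mmeasure)"
proof -
  have "truncated_kernel k x = (\<lambda>y. \<Sum>j<k. q ^ j * indicator (cball x (\<rho> / 2 ^ j)) y)"
    unfolding truncated_kernel_def by (intro ext sum.cong refl) (simp add: indicator_def)
  then have "(\<integral>y. truncated_kernel k x y \<partial>mmeasure) =
      (\<integral>y. (\<Sum>j<k. q ^ j * indicator (cball x (\<rho> / 2 ^ j)) y) \<partial>mmeasure)" by simp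
  also have "\<dots> = (\<Sum>j<k. \<integral>y. q ^ j * indicator (cball x (\<rho> / 2 ^ j)) y \<partial>mmeasure)"
    by (intro Bochner_Integration.integral_sum integrable_mult_right integrable_real_indicator)
       (auto simp: sets_mmeasure less_top[symmetric])
  also have "\<dots> = (\<Sum>j<k. q ^ j * measure mmeasure (cball x (\<rho> / 2 ^ j)))"
    by simp
  finally have "(\<integral>y. truncated_kernel k x y \<partial>mmeasure) = (\<Sum>j<k. q ^ j * measure mmeasure (cball x (\<rho> / 2 ^ j)))" .
  moreover have "a \<le> q ^ j * measure mmeasure (cball x (\<rho> / 2 ^ j))" for j
    using ball_lower[of j x] q_gt_1 by (simp add: field_simps)
  then have "(\<Sum>j<k. a) \<le> (\<Sum>j<k. q ^ j * measure mmeasure (cball x (\<rho> / 2 ^ j)))"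
    by (intro sum_mono)
  ultimately show ?thesis by simp
qed

lemma square_integrable_truncated_kernel: "square_integrable (truncated_kernel k x)"
  using truncated_kernel_nonneg truncated_kernel_le by (intro square_integrable_bounded) (auto simp: abs_of_nonneg)

definition kernel_vector :: "nat \<Rightarrow> 'a \<Rightarrow> 'a L2" where
  "kernel_vector k x = abs_L2 (truncated_kernel k x)"

lemma inner_kernel_vector: "inner (kernel_vector k x) u = (\<integral>y. truncated_kernel k x y * rep_L2 u y \<partial>mmeasure)"
  unfolding kernel_vector_def by (rule inner_L2_abs[OF square_integrable_truncated_kernel])

lemma borel_measurable_inner_kernel_vector [measurable]:
  "(\<lambda>x. inner (kernel_vector k x) u) \<in> borel_measurable mmeasure"
  unfolding inner_kernel_vector
proof (rule mmeasure.borel_measurable_lebesgue_integral)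
  have "(\<lambda>p :: 'a \<times> 'a. truncated_kernel k (fst p) (snd p) * rep_L2 u (snd p)) \<in> borel_measurable (mmeasure \<Otimes>\<^sub>M mmeasure)"
    by measurable
  then show "(\<lambda>(x, y). truncated_kernel k x y * rep_L2 u y) \<in> borel_measurable (mmeasure \<Otimes>\<^sub>M mmeasure)"
    by (simp add: case_prod_unfold)
qed

lemma norm_kernel_vector_le:
  "(norm (kernel_vector k x))\<^sup>2 \<le> (q ^ k / (q - 1))\<^sup>2 * measure (mmeasure :: 'a measure) UNIV"
proof -
  have "(norm (kernel_vector k x))\<^sup>2 = (\<integral>y. (truncated_kernel k x y)\<^sup>2 \<partial>mmeasure)"
    unfolding kernel_vector_def by (rule norm_L2_abs[OF square_integrable_truncated_kernel])
  also have "\<dots> \<le> (\<integral>y. (q ^ k / (q - 1))\<^sup>2 \<partial>(mmeasure :: 'a measure))"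
    using square_integrable_truncated_kernel[of k x]
    by (intro integral_mono power_mono truncated_kernel_le truncated_kernel_nonneg) (auto simp: square_integrable_def)
  finally show ?thesis by (simp add: mult.commute)
qed

lemma integrable_inner_kernel_vector_square: "integrable mmeasure (\<lambda>x. (inner (kernel_vector k x) u)\<^sup>2)"
proof (rule mmeasure.integrable_const_bound)
  have "(inner (kernel_vector k x) u)\<^sup>2 \<le> (q ^ k / (q - 1))\<^sup>2 * measure (mmeasure :: 'a measure) UNIV * (norm u)\<^sup>2" for x
  proof -
    have "(inner (kernel_vector k x) u)\<^sup>2 \<le> (norm (kernel_vector k x))\<^sup>2 * (norm u)\<^sup>2"
      using Cauchy_Schwarz_ineq[of "kernel_vector k x" u] by (simp add: power2_norm_eq_inner)
    also have "\<dots> \<le> (q ^ k / (q - 1))\<^sup>2 * measure (mmeasure :: 'a measure) UNIV * (norm u)\<^sup>2"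
      by (intro mult_right_mono norm_kernel_vector_le) simp
    finally show ?thesis .
  qed
  then show "AE x in mmeasure. norm ((inner (kernel_vector k x) u)\<^sup>2) \<le>
      (q ^ k / (q - 1))\<^sup>2 * measure (mmeasure :: 'a measure) UNIV * (norm u)\<^sup>2"
    by simp
qed measurable

text \<open>Expanding the square in $\frac12\iint (u(x)-u(y))^2 K_k(x,y)$, where $K_k$ is the truncated kernel,
  yields the mass of $K_k$ times $u^2$ minus the quadratic form of the integral operator with kernel $K_k$.\<close>

lemma truncated_form_le:
  assumes u: "u \<in> dirichlet_dom \<delta>"
  shows "real k * a * (norm u)\<^sup>2 \<le> q * \<rho> powr \<delta> / (q - 1) * dirichlet_form \<delta> u u +
    (\<integral>x. rep_L2 u x * inner (kernel_vector k x) u \<partial>mmeasure)"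
proof -
  let ?N = "mmeasure \<Otimes>\<^sub>M mmeasure :: ('a \<times> 'a) measure"
  let ?f = "rep_L2 u" and ?K = "truncated_kernel k"
  define M where "M = q ^ k / (q - 1)"
  define c where "c = q * \<rho> powr \<delta> / (q - 1)"
  have "0 \<le> M" unfolding M_def by (rule order_trans[OF truncated_kernel_nonneg truncated_kernel_le])
  have K_abs: "\<bar>?K x y\<bar> \<le> M" for x y using truncated_kernel_nonneg[of k x y] truncated_kernel_le[of k x y] by (simp add: M_def)
  define F where "F p = ?K (fst p) (snd p) * (?f (fst p))\<^sup>2" for p
  define G where "G p = ?K (fst p) (snd p) * (?f (snd p))\<^sup>2" for p
  define H where "H p = ?K (fst p) (snd p) * (?f (fst p) * ?f (snd p))" for p
  have [measurable]: "F \<in> borel_measurable ?N" "G \<in> borel_measurable ?N" "H \<in> borel_measurable ?N"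
    unfolding F_def[abs_def] G_def[abs_def] H_def[abs_def] by measurable
  have int_F: "integrable ?N F"
  proof (rule Bochner_Integration.integrable_bound)
    show "integrable ?N (\<lambda>p. M * (?f (fst p))\<^sup>2)"
      by (intro integrable_mult_right integrable_pair_fst integrable_rep_square)
    show "AE p in ?N. norm (F p) \<le> norm (M * (?f (fst p))\<^sup>2)"
      using K_abs \<open>0 \<le> M\<close> by (intro AE_I2) (simp add: F_def abs_mult mult_right_mono)
  qed simp
  have swap: "G = (\<lambda>(x, y). F (y, x))"
    by (rule ext) (simp add: F_def G_def case_prod_unfold, metis truncated_kernel_commute)
  have int_G: "integrable ?N G"
    unfolding swap by (rule mmeasure2.integrable_product_swap[OF int_F])
  have G_eq_F: "(\<integral>p. G p \<partial>?N) = (\<integral>p. F p \<partial>?N)"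
    unfolding swap by (rule mmeasure2.integral_product_swap) simp
  have int_H: "integrable ?N H"
  proof (rule Bochner_Integration.integrable_bound)
    show "integrable ?N (\<lambda>p. F p + G p)" by (intro Bochner_Integration.integrable_add int_F int_G)
    have "\<bar>H p\<bar> \<le> \<bar>F p + G p\<bar>" for p
      using truncated_kernel_nonneg[of k "fst p" "snd p"] abs_mult_le_squares[of "?f (fst p)" "?f (snd p)"]
      by (simp add: H_def F_def G_def abs_mult mult_left_mono flip: distrib_left)
    then show "AE p in ?N. norm (H p) \<le> norm (F p + G p)" by simp
  qed simp
  have pointwise: "F p + G p - 2 * H p \<le> c * (diff_quotient_L2 \<delta> u p)\<^sup>2" for p
  proof -
    obtain x y where p: "p = (x, y)" by (cases p)
    have "F p + G p - 2 * H p = ?K x y * (?f x - ?f y)\<^sup>2"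
      by (simp add: p F_def G_def H_def power2_diff algebra_simps)
    also have "\<dots> \<le> c * (diff_quotient_L2 \<delta> u p)\<^sup>2"
    proof (cases "x = y")
      case True
      then show ?thesis by (simp add: p diff_quotient_def)
    next
      case False
      then have d: "0 < dist x y powr \<delta>" by simp
      have "?K x y * (?f x - ?f y)\<^sup>2 = ?K x y * dist x y powr \<delta> * ((?f x - ?f y)\<^sup>2 / dist x y powr \<delta>)"
        using d by simp
      also have "\<dots> \<le> c * ((?f x - ?f y)\<^sup>2 / dist x y powr \<delta>)"
        unfolding c_def by (intro mult_right_mono truncated_kernel_mult_dist_le) simp
      finally show ?thesis by (simp add: p diff_quotient_square)
    qed
    finally show ?thesis .
  qed
  have "(\<integral>p. F p + G p - 2 * H p \<partial>?N) \<le> (\<integral>p. c * (diff_quotient_L2 \<delta> u p)\<^sup>2 \<partial>?N)"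
    using u pointwise
    by (intro integral_mono Bochner_Integration.integrable_diff Bochner_Integration.integrable_add
        integrable_mult_right int_F int_G int_H) (auto simp: dirichlet_dom_iff)
  also have "\<dots> = 2 * (c * dirichlet_form \<delta> u u)"
    by (simp add: dirichlet_form_rep[OF u u] power2_eq_square)
  also have "(\<integral>p. F p + G p - 2 * H p \<partial>?N) = 2 * (\<integral>p. F p \<partial>?N) - 2 * (\<integral>p. H p \<partial>?N)"
    using int_F int_G int_H by (simp add: G_eq_F)
  finally have main: "(\<integral>p. F p \<partial>?N) \<le> c * dirichlet_form \<delta> u u + (\<integral>p. H p \<partial>?N)" by simp
  have "real k * a * (norm u)\<^sup>2 = (\<integral>x. real k * a * (?f x)\<^sup>2 \<partial>mmeasure)"
    by (simp add: norm_L2_rep)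
  also have "\<dots> \<le> (\<integral>x. (\<integral>y. F (x, y) \<partial>mmeasure) \<partial>mmeasure)"
  proof (rule integral_mono)
    show "integrable mmeasure (\<lambda>x. real k * a * (?f x)\<^sup>2)"
      by (intro integrable_mult_right integrable_rep_square)
    show "integrable mmeasure (\<lambda>x. \<integral>y. F (x, y) \<partial>mmeasure)" by (rule mmeasure2.integrable_fst'[OF int_F])
    show "real k * a * (?f x)\<^sup>2 \<le> (\<integral>y. F (x, y) \<partial>mmeasure)" for x
      using mult_right_mono[OF truncated_kernel_mass[of k x], of "(?f x)\<^sup>2"] by (simp add: F_def)
  qed
  also have "\<dots> = (\<integral>p. F p \<partial>?N)" by (rule mmeasure2.integral_fst'[OF int_F])
  also note main
  also have "(\<integral>p. H p \<partial>?N) = (\<integral>x. (\<integral>y. H (x, y) \<partial>mmeasure) \<partial>mmeasure)"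
    by (rule mmeasure2.integral_fst'[OF int_H, symmetric])
  also have "\<dots> = (\<integral>x. ?f x * inner (kernel_vector k x) u \<partial>mmeasure)"
    unfolding H_def inner_kernel_vector
    by (simp add: mult.left_commute[of "truncated_kernel k _ _"])
  finally show ?thesis by (simp add: c_def)
qed

text \<open>Half of the mass term absorbs $\|u\|$ from the quadratic form of the integral operator, which leaves the
  norm of its image $x \mapsto \langle k_x,u\rangle$, where $k_x = K_k(x,\cdot)$.\<close>

lemma norm_square_le_form:
  assumes u: "u \<in> dirichlet_dom \<delta>" and k: "0 < k"
  shows "(real k * a)\<^sup>2 * (norm u)\<^sup>2 \<le> 2 * (real k * a) * (q * \<rho> powr \<delta> / (q - 1)) * dirichlet_form \<delta> u u +
    (\<integral>x. (inner (kernel_vector k x) u)\<^sup>2 \<partial>mmeasure)"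
proof -
  define A where "A = real k * a"
  have "0 < A" using k a_pos by (simp add: A_def)
  define I where "I = (\<integral>x. (inner (kernel_vector k x) u)\<^sup>2 \<partial>mmeasure)"
  have "2 * A * (\<integral>x. rep_L2 u x * inner (kernel_vector k x) u \<partial>mmeasure) =
      (\<integral>x. 2 * A * (rep_L2 u x * inner (kernel_vector k x) u) \<partial>mmeasure)"
    by simp
  also have "\<dots> \<le> (\<integral>x. A\<^sup>2 * (rep_L2 u x)\<^sup>2 + (inner (kernel_vector k x) u)\<^sup>2 \<partial>mmeasure)"
  proof (rule integral_mono)
    show bound: "2 * A * (rep_L2 u x * inner (kernel_vector k x) u) \<le>
        A\<^sup>2 * (rep_L2 u x)\<^sup>2 + (inner (kernel_vector k x) u)\<^sup>2" for x
      using sum_squares_bound[of "A * rep_L2 u x" "inner (kernel_vector k x) u"]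
      by (simp add: power_mult_distrib mult.assoc)
    show int: "integrable mmeasure (\<lambda>x. A\<^sup>2 * (rep_L2 u x)\<^sup>2 + (inner (kernel_vector k x) u)\<^sup>2)"
      by (intro Bochner_Integration.integrable_add integrable_mult_right integrable_rep_square
          integrable_inner_kernel_vector_square)
    show "integrable mmeasure (\<lambda>x. 2 * A * (rep_L2 u x * inner (kernel_vector k x) u))"
    proof (rule Bochner_Integration.integrable_bound[OF int])
      have "\<bar>2 * A * (s * t)\<bar> \<le> A\<^sup>2 * s\<^sup>2 + t\<^sup>2" for s t :: real
        using sum_squares_bound[of "\<bar>A * s\<bar>" "\<bar>t\<bar>"] \<open>0 < A\<close>
        by (simp add: abs_mult power_mult_distrib mult.assoc)
      then show "AE x in mmeasure. norm (2 * A * (rep_L2 u x * inner (kernel_vector k x) u)) \<le>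
          norm (A\<^sup>2 * (rep_L2 u x)\<^sup>2 + (inner (kernel_vector k x) u)\<^sup>2)" by simp
    qed measurable
  qed
  also have "\<dots> = A\<^sup>2 * (norm u)\<^sup>2 + I"
    unfolding I_def norm_L2_rep
    by (subst Bochner_Integration.integral_add)
       (auto intro: integrable_rep_square integrable_inner_kernel_vector_square)
  finally have cross: "2 * A * (\<integral>x. rep_L2 u x * inner (kernel_vector k x) u \<partial>mmeasure) \<le> A\<^sup>2 * (norm u)\<^sup>2 + I" .
  have "2 * A * (A * (norm u)\<^sup>2) \<le> 2 * A * (q * \<rho> powr \<delta> / (q - 1) * dirichlet_form \<delta> u u +
      (\<integral>x. rep_L2 u x * inner (kernel_vector k x) u \<partial>mmeasure))"
    using truncated_form_le[OF u, of k] \<open>0 < A\<close> unfolding A_def by (intro mult_left_mono) auto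
  also have "\<dots> = 2 * A * (q * \<rho> powr \<delta> / (q - 1)) * dirichlet_form \<delta> u u +
      2 * A * (\<integral>x. rep_L2 u x * inner (kernel_vector k x) u \<partial>mmeasure)"
    by (simp add: distrib_left)
  finally have "2 * (A\<^sup>2 * (norm u)\<^sup>2) \<le> 2 * A * (q * \<rho> powr \<delta> / (q - 1)) * dirichlet_form \<delta> u u +
      2 * A * (\<integral>x. rep_L2 u x * inner (kernel_vector k x) u \<partial>mmeasure)"
    by (simp add: power2_eq_square mult.assoc)
  with cross show ?thesis unfolding A_def[symmetric] I_def[symmetric] by linarith
qed

text \<open>For $u = Rf_i$ the energy is at most $\langle u,f_i\rangle \le \|u\| \le \|u\|^2/\varepsilon$. Once $ka$ exceeds
  a multiple of $1/\varepsilon$, the energy is absorbed, and each $f_i$ contributes a fixed amount to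
  $\sum_i\int\langle Rk_x,f_i\rangle^2d\mu(x)$. By Bessel's inequality this sum is at most
  $\int\|k_x\|^2d\mu(x)$, which is exponential in $k$.\<close>

lemma resolvent_large_directions_le_kernel:
  fixes f :: "nat \<Rightarrow> 'a L2"
  assumes \<epsilon>: "0 < \<epsilon>" and f: "orthonormal_family n f"
    and large: "\<And>i. i < n \<Longrightarrow> \<epsilon> \<le> inner (form_resolvent \<delta> (f i)) (f i)"
    and k: "4 * (q * \<rho> powr \<delta> / (q - 1)) \<le> real k * a * \<epsilon>" "0 < k"
  shows "real n * (8 * (q * \<rho> powr \<delta> / (q - 1))\<^sup>2) \<le> (q ^ k / (q - 1))\<^sup>2 * (measure (mmeasure :: 'a measure) UNIV)\<^sup>2"
proof -
  define c where "c = q * \<rho> powr \<delta> / (q - 1)"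
  define m where "m = measure (mmeasure :: 'a measure) UNIV"
  define A where "A = real k * a"
  have "0 < A" using k(2) a_pos by (simp add: A_def)
  have "0 < c" using q_gt_1 \<rho>_pos by (simp add: c_def)
  have cA: "4 * c \<le> A * \<epsilon>" using k(1) by (simp add: c_def A_def)
  have unit: "norm (f i) = 1" if "i < n" for i using f that by (simp add: orthonormal_family_def)
  have orth: "inner (f i) (f j) = 0" if "i < n" "j < n" "i \<noteq> j" for i j
    using f that by (simp add: orthonormal_family_def)
  have each: "8 * c\<^sup>2 \<le> (\<integral>x. (inner (kernel_vector k x) (form_resolvent \<delta> (f i)))\<^sup>2 \<partial>mmeasure)" if i: "i < n" for i
  proof -
    define u where "u = form_resolvent \<delta> (f i)"
    have dom: "u \<in> dirichlet_dom \<delta>" unfolding u_def by (rule form_resolvent_dom)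
    have "inner u (f i) \<le> norm u" using norm_cauchy_schwarz[of u "f i"] unit[OF i] by simp
    have "\<epsilon> \<le> norm u" using large[OF i] \<open>inner u (f i) \<le> norm u\<close> by (simp add: u_def)
    have "dirichlet_form \<delta> u u \<le> inner u (f i)"
      using energy_form_resolvent_self[of \<delta> "f i"] inner_ge_zero[of u] unfolding energy_inner_def u_def by linarith
    then have "dirichlet_form \<delta> u u \<le> norm u" using \<open>inner u (f i) \<le> norm u\<close> by linarith
    then have "dirichlet_form \<delta> u u * \<epsilon> \<le> (norm u)\<^sup>2"
      using mult_mono[OF \<open>dirichlet_form \<delta> u u \<le> norm u\<close> \<open>\<epsilon> \<le> norm u\<close>] \<epsilon> by (simp add: power2_eq_square)
    then have "A * (dirichlet_form \<delta> u u * \<epsilon>) \<le> A * (norm u)\<^sup>2"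
      using \<open>0 < A\<close> by (intro mult_left_mono) auto
    moreover have "4 * c * dirichlet_form \<delta> u u \<le> A * \<epsilon> * dirichlet_form \<delta> u u"
      by (intro mult_right_mono cA dirichlet_form_nonneg dom)
    moreover have "A * \<epsilon> * dirichlet_form \<delta> u u = A * (dirichlet_form \<delta> u u * \<epsilon>)" by simp
    ultimately have "4 * c * dirichlet_form \<delta> u u \<le> A * (norm u)\<^sup>2" by linarith
    then have "A * (4 * c * dirichlet_form \<delta> u u) \<le> A * (A * (norm u)\<^sup>2)"
      using \<open>0 < A\<close> by (intro mult_left_mono) auto
    then have "2 * A * c * dirichlet_form \<delta> u u \<le> A\<^sup>2 * (norm u)\<^sup>2 / 2"
      by (simp add: power2_eq_square mult_ac)
    moreover have "A\<^sup>2 * (norm u)\<^sup>2 \<le> 2 * A * c * dirichlet_form \<delta> u u +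
        (\<integral>x. (inner (kernel_vector k x) u)\<^sup>2 \<partial>mmeasure)"
      using norm_square_le_form[OF dom k(2)] by (simp add: A_def c_def)
    moreover have "(4 * c)\<^sup>2 \<le> (A * norm u)\<^sup>2"
    proof (rule power_mono)
      show "4 * c \<le> A * norm u"
        using cA mult_left_mono[OF \<open>\<epsilon> \<le> norm u\<close>, of A] \<open>0 < A\<close> by linarith
    qed (use \<open>0 < c\<close> in simp)
    ultimately show ?thesis
      unfolding u_def by (simp add: power_mult_distrib)
  qed
  have "real n * (8 * c\<^sup>2) = (\<Sum>i<n. 8 * c\<^sup>2)" by simp
  also have "\<dots> \<le> (\<Sum>i<n. \<integral>x. (inner (kernel_vector k x) (form_resolvent \<delta> (f i)))\<^sup>2 \<partial>mmeasure)"
    by (intro sum_mono each) simp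
  also have "\<dots> = (\<integral>x. (\<Sum>i<n. (inner (kernel_vector k x) (form_resolvent \<delta> (f i)))\<^sup>2) \<partial>mmeasure)"
    by (intro Bochner_Integration.integral_sum[symmetric] integrable_inner_kernel_vector_square)
  also have "\<dots> \<le> (\<integral>x. (q ^ k / (q - 1))\<^sup>2 * m \<partial>(mmeasure :: 'a measure))"
  proof (rule integral_mono)
    show "integrable mmeasure (\<lambda>x. \<Sum>i<n. (inner (kernel_vector k x) (form_resolvent \<delta> (f i)))\<^sup>2)"
      by (intro Bochner_Integration.integrable_sum integrable_inner_kernel_vector_square)
    fix x
    have "(\<Sum>i<n. (inner (kernel_vector k x) (form_resolvent \<delta> (f i)))\<^sup>2) =
        (\<Sum>i<n. (inner (form_resolvent \<delta> (kernel_vector k x)) (f i))\<^sup>2)"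
      by (simp add: inner_form_resolvent_symmetric)
    also have "\<dots> \<le> (norm (form_resolvent \<delta> (kernel_vector k x)))\<^sup>2"
      using unit orth by (intro bessel_inequality) auto
    also have "\<dots> \<le> (norm (kernel_vector k x))\<^sup>2"
      by (intro power_mono norm_form_resolvent_le) simp
    also have "\<dots> \<le> (q ^ k / (q - 1))\<^sup>2 * m"
      unfolding m_def by (rule norm_kernel_vector_le)
    finally show "(\<Sum>i<n. (inner (kernel_vector k x) (form_resolvent \<delta> (f i)))\<^sup>2) \<le> (q ^ k / (q - 1))\<^sup>2 * m" .
  qed simp
  also have "\<dots> = (q ^ k / (q - 1))\<^sup>2 * m\<^sup>2"
    by (simp add: power2_eq_square m_def)
  finally show ?thesis by (simp add: c_def m_def)
qed

lemma resolvent_exponentially_few_large: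
  obtains A B where "1 \<le> A" "0 < B"
    "\<And>\<epsilon> n f. 0 < \<epsilon> \<Longrightarrow> orthonormal_family n f \<Longrightarrow>
      (\<And>i. i < n \<Longrightarrow> \<epsilon> \<le> inner (form_resolvent \<delta> (f i)) (f i :: 'a L2)) \<Longrightarrow> real n \<le> A * exp (B / \<epsilon>)"
proof -
  define c where "c = q * \<rho> powr \<delta> / (q - 1)"
  define m where "m = measure (mmeasure :: 'a measure) UNIV"
  have "0 < c" using q_gt_1 \<rho>_pos by (simp add: c_def)
  define A where "A = max 1 ((q / (q - 1))\<^sup>2 * m\<^sup>2 / (8 * c\<^sup>2))"
  define B where "B = 8 * c * ln q / a"
  have "0 < B" using \<open>0 < c\<close> \<delta>_pos a_pos by (simp add: B_def)
  have "real n \<le> A * exp (B / \<epsilon>)"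
    if \<epsilon>: "0 < \<epsilon>" and f: "orthonormal_family n f"
      and large: "\<And>i. i < n \<Longrightarrow> \<epsilon> \<le> inner (form_resolvent \<delta> (f i)) (f i)"
    for \<epsilon> n and f :: "nat \<Rightarrow> 'a L2"
  proof -
    \<comment> \<open>From this scale on, the mass $ka$ absorbs the energy, which is at most $\|u\|^2/\varepsilon$.\<close>
    define r where "r = 4 * c / (a * \<epsilon>)"
    have "0 < r" using \<open>0 < c\<close> a_pos \<epsilon> by (simp add: r_def)
    define k where "k = nat \<lceil>r\<rceil>"
    have k: "r \<le> real k" "real k \<le> r + 1" "0 < k"
      using \<open>0 < r\<close> unfolding k_def by linarith+
    have "4 * c = r * (a * \<epsilon>)" using a_pos \<epsilon> by (simp add: r_def)
    also have "\<dots> \<le> real k * (a * \<epsilon>)" using k(1) a_pos \<epsilon> by (intro mult_right_mono) auto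
    finally have "4 * (q * \<rho> powr \<delta> / (q - 1)) \<le> real k * a * \<epsilon>" by (simp add: c_def mult.assoc)
    from resolvent_large_directions_le_kernel[OF \<epsilon> f large this k(3)]
    have "real n * (8 * c\<^sup>2) \<le> (q ^ k / (q - 1))\<^sup>2 * m\<^sup>2" by (simp add: c_def m_def)
    also have "\<dots> \<le> (q * exp (r * ln q) / (q - 1))\<^sup>2 * m\<^sup>2"
    proof (intro mult_right_mono power_mono divide_right_mono)
      have exp_ln_q: "exp (ln q) = q" by (rule exp_ln) simp
      have "q ^ k = exp (real k * ln q)" unfolding exp_of_nat_mult exp_ln_q ..
      also have "\<dots> \<le> exp (ln q + r * ln q)"
        using mult_right_mono[OF k(2), of "ln q"] q_gt_1 \<delta>_pos by (simp add: distrib_right)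
      also have "\<dots> = q * exp (r * ln q)" unfolding exp_add exp_ln_q ..
      finally show "q ^ k \<le> q * exp (r * ln q)" .
    qed (use q_gt_1 in auto)
    also have "\<dots> = (q / (q - 1))\<^sup>2 * m\<^sup>2 * exp (B / \<epsilon>)"
    proof -
      have "(exp (r * ln q))\<^sup>2 = exp (B / \<epsilon>)"
        using a_pos \<epsilon> by (simp add: r_def B_def mult_ac flip: exp_double)
      then show ?thesis by (simp add: power_mult_distrib power_divide)
    qed
    finally have "real n \<le> (q / (q - 1))\<^sup>2 * m\<^sup>2 * exp (B / \<epsilon>) / (8 * c\<^sup>2)"
      using \<open>0 < c\<close> by (subst pos_le_divide_eq) auto
    then have "real n \<le> (q / (q - 1))\<^sup>2 * m\<^sup>2 / (8 * c\<^sup>2) * exp (B / \<epsilon>)"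
      by (simp only: times_divide_eq_left)
    also have "\<dots> \<le> A * exp (B / \<epsilon>)"
      by (intro mult_right_mono) (auto simp: A_def)
    finally show ?thesis .
  qed
  then show ?thesis using that[of A B] \<open>0 < B\<close> by (auto simp: A_def)
qed

lemma form_resolvent_injective:
  fixes f :: "'a L2"
  assumes "form_resolvent \<delta> f = 0"
  shows "f = 0"
proof (rule orthogonal_to_dirichlet_dom)
  fix g :: "'a L2" assume g: "g \<in> dirichlet_dom \<delta>"
  have "inner f g = energy_inner \<delta> 0 g"
    using energy_inner_form_resolvent[OF g, of f] assms by simp
  also have "\<dots> = 0"
    using dirichlet_form_scaleR_left[OF g g, of 0] by (simp add: energy_inner_def)
  finally show "inner f g = 0" .
qed

end

section \<open>Logarithmic eigenvalue growth\<close>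

text \<open>A one-point space has no radius below its diameter, so that regularity is vacuous there; but its energy
  vanishes and $L^2$ is at most one-dimensional.\<close>

lemma one_point_space:
  assumes triv: "\<And>x y :: 'a::metric_measure_space. x = y"
  shows "form_resolvent \<delta> (f :: 'a L2) = f"
    and "orthonormal_family n (h :: nat \<Rightarrow> 'a L2) \<Longrightarrow> n \<le> 1"
proof -
  have dq: "diff_quotient_L2 \<delta> u p = 0" for u :: "'a L2" and p
    using triv[of "fst p" "snd p"] by (cases p) (simp add: diff_quotient_def)
  have dom: "u \<in> dirichlet_dom \<delta>" for u :: "'a L2" by (simp add: dirichlet_dom_iff dq)
  show "form_resolvent \<delta> f = f"
    using dirichlet_form_rep[OF dom dom]
    by (intro form_resolvent_unique[OF dom dom]) (simp add: energy_inner_form_resolvent[OF dom], simp add: energy_inner_def dq)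
  assume h: "orthonormal_family n h"
  define m where "m = measure (mmeasure :: 'a measure) UNIV"
  obtain x :: 'a where True by blast
  have inner: "inner u v = m * (rep_L2 u x * rep_L2 v x)" for u v :: "'a L2"
  proof -
    have "(\<lambda>y. rep_L2 u y * rep_L2 v y) = (\<lambda>y. rep_L2 u x * rep_L2 v x)"
      by (rule ext) (metis triv)
    then show ?thesis unfolding inner_L2_rep by (simp only:) (simp add: m_def)
  qed
  show "n \<le> 1"
  proof (rule ccontr)
    assume "\<not> n \<le> 1"
    then have "norm (h 0) = 1" "norm (h 1) = 1" "inner (h 0) (h 1) = 0"
      using h by (auto simp: orthonormal_family_def)
    then have "m * (rep_L2 (h 0) x * rep_L2 (h 0) x) = 1" "m * (rep_L2 (h 1) x * rep_L2 (h 1) x) = 1"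
      "m * (rep_L2 (h 0) x * rep_L2 (h 1) x) = 0"
      by (simp_all add: norm_eq_1 flip: inner)
    then show False by auto
  qed
qed

theorem theorem1:
  fixes \<delta> :: real and \<Delta> :: "'a::metric_measure_space L2 partial_operator"
  assumes "0 < \<delta>" and "ahlfors_regular TYPE('a) \<delta>" and "\<Delta> = log_laplacian \<delta>"
  shows "compact_operator (inverse_one_plus \<Delta>) \<and>
    (\<lambda>n. singular_value (inverse_one_plus \<Delta>) n) \<in> O(\<lambda>n. inverse (ln (real n))) \<and>
    (\<exists>t\<^sub>0>0. \<forall>t>t\<^sub>0. trace_class (functional_calculus \<Delta> (\<lambda>l. exp (- t * l))))"
proof -
  let ?R = "form_resolvent \<delta> :: 'a L2 \<Rightarrow> 'a L2"
  have "(\<forall>f. ?R f = 0 \<longrightarrow> f = 0) \<and> (\<exists>A B. 1 \<le> A \<and> 0 < B \<and> (\<forall>\<epsilon> n f. 0 < \<epsilon> \<longrightarrow> orthonormal_family n f \<longrightarrow>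
      (\<forall>i<n. \<epsilon> \<le> inner (?R (f i)) (f i)) \<longrightarrow> real n \<le> A * exp (B / \<epsilon>)))"
  proof (cases "\<exists>x y :: 'a. x \<noteq> y")
    case True
    then obtain x y :: 'a where "x \<noteq> y" by blast
    then obtain \<rho> a b where "dyadic_regularity TYPE('a) \<delta> \<rho> a b"
      using dyadic_regularity_if_ahlfors_regular assms(1,2) by metis
    then interpret dyadic_regularity "TYPE('a)" \<delta> \<rho> a b .
    show ?thesis
      using form_resolvent_injective resolvent_exponentially_few_large by metis
  next
    case False
    then have triv: "x = y" for x y :: 'a by blast
    have "real n \<le> 1 * exp (1 / \<epsilon>)" if "0 < \<epsilon>" "orthonormal_family n f" for \<epsilon> n and f :: "nat \<Rightarrow> 'a L2"
    proof -
      have "real n \<le> 1" using one_point_space(2)[OF triv that(2)] by simp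
      also have "\<dots> \<le> exp (1 / \<epsilon>)" using that(1) by simp
      finally show ?thesis by simp
    qed
    then show ?thesis
      using one_point_space(1)[OF triv] by (metis order_refl zero_less_one)
  qed
  then obtain A B where inj: "\<And>f. ?R f = 0 \<Longrightarrow> f = 0" and AB: "1 \<le> A" "0 < B"
    and few: "\<And>\<epsilon> n f. 0 < \<epsilon> \<Longrightarrow> orthonormal_family n f \<Longrightarrow>
      (\<And>i. i < n \<Longrightarrow> \<epsilon> \<le> inner (?R (f i)) (f i)) \<Longrightarrow> real n \<le> A * exp (B / \<epsilon>)"
    by metis
  have "\<Delta> = {(?R f, f - ?R f) | f. True}" by (simp add: assms(3) log_laplacian_def)
  note growth = logarithmic_growth_if_exponentially_few_large[OF positive_operator_form_resolvent inj AB few this]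
  have "inverse_one_plus \<Delta> = ?R" unfolding assms(3) by (rule inverse_one_plus_log_laplacian)
  then show ?thesis using growth AB(2) by auto
qed

end
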